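(* There is a 2-functor $\underline{Hom}:\mathrm{SMC}^{op}\times\mathrm{SMC}\to\mathrm{SMC}$ sending: - any pair $(\mathcal A,\mathcal B)$ of symmetric monoidal categories to $[\mathcal A,\mathcal B]$; - any pair of symmetric monoidal functors $(F:\mathcal C\to\mathcal A,\ G:\mathcal B\to\mathcal D)$ to $[F,G]:[\mathcal A,\mathcal B]\to[\mathcal C,\mathcal D]$; - any pair of 2-cells $(\sigma:F\to F':\mathcal C\to\mathcal A,\ \tau:G\to G':\mathcal B\to\mathcal D)$ of $\mathrm{SMC}$ to $[\sigma,\tau]:[F,G]\to[F',G']:[\mathcal A,\mathcal B]\to[\mathcal C,\mathcal D]$.
   Context: All symmetric monoidal categories are small, with tensor $\otimes$, unit $I$ and natural isomorphisms $ass_{a,b,c}:a\otimes(b\otimes c)\to(a\otimes b)\otimes c$, $r_a:a\otimes I\to a$, $l_a:I\otimes a\to a$, $s_{a,b}:a\otimes b\to b\otimes a$ satisfying the usual coherence axioms. A symmetric monoidal functor $F:\mathcal A\to\mathcal B$ is a lax one: a functor with an arrow $F^0:I\to F(I)$ and a natural family $F^2_{x,y}:Fx\otimes Fy\to F(x\otimes y)$ satisfying the usual associativity, unit and symmetry axioms. $\mathrm{SMC}$ is the 2-category of symmetric monoidal categories, symmetric monoidal functors and monoidal natural transformations; $\mathrm{SMC}^{op}$ reverses 1-cells only. $[\mathcal A,\mathcal B]$ is the category $\mathrm{SMC}(\mathcal A,\mathcal B)$ with the pointwise symmetric monoidal structure: $(F\Box G)(a)=Fa\otimes Ga$, $(F\Box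 G)^0$ is $I\cong I\otimes I\xrightarrow{F^0\otimes G^0}F(I)\otimes G(I)$, $(F\Box G)^2_{a,b}$ is the canonical interchange $(Fa\otimes Ga)\otimes(Fb\otimes Gb)\cong(Fa\otimes Fb)\otimes(Ga\otimes Gb)$ followed by $F^2_{a,b}\otimes G^2_{a,b}$; $(\sigma\Box\tau)_a=\sigma_a\otimes\tau_a$; the unit is the constant functor at $I_{\mathcal B}$ (with $I\to I$ the identity and $I\otimes I\to I$ the canonical arrow); $ass,r,l,s$ are pointwise. For $F:\mathcal C\to\mathcal A$ and $G:\mathcal B\to\mathcal D$ in $\mathrm{SMC}$, $[F,G]$ is the functor $H\mapsto G\circ H\circ F$, $\theta\mapsto G*\theta*F$, with $[F,G]^0$ having every component equal to $G^0:I\to G(I_{\mathcal B})$ and $[F,G]^2_{H,K}:GHF\Box GKF\to G(H\Box K)F$ having component $G^2_{HFc,KFc}$ at each object $c$ of $\mathcal C$. For 2-cells $\sigma:F\to F'$, $\tau:G\to G'$, $[\sigma,\tau]$ has component at $H:\mathcal A\to\mathcal B$ the horizontal composite $\tau*H*\sigma:GHF\to G'HF'$. *)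

theory Defs
  imports Main "HOL-Library.FuncSet"
begin

section \<open>Symmetric monoidal categories\<close>

text \<open>
  Operations on a carrier are required to be extensional (to take the value \<open>undefined\<close> off the
  carrier), and functors and transformations carry their source and target as data, so that equality in HOL of categories, functors and transformations is equality of
  the mathematical objects.
\<close>

record ('o, 'm) cat =
  obj :: "'o set"
  arr :: "'m set"
  src :: "'m \<Rightarrow> 'o"
  tgt :: "'m \<Rightarrow> 'o"
  idn :: "'o \<Rightarrow> 'm"
  cmp :: "'m \<Rightarrow> 'm \<Rightarrow> 'm"  (infixr "\<cdot>\<index>" 55)

definition hom :: "('o, 'm, 'x) cat_scheme \<Rightarrow> 'o \<Rightarrow> 'o \<Rightarrow> 'm set" where
  "hom A a b = {f \<in> arr A. src A f = a \<and> tgt A f = b}"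

locale category =
  fixes A :: "('o, 'm, 'x) cat_scheme" (structure)
  assumes src_PiE: "src A \<in> arr A \<rightarrow>\<^sub>E obj A"
    and tgt_PiE: "tgt A \<in> arr A \<rightarrow>\<^sub>E obj A"
    and idn_PiE: "idn A \<in> (\<Pi>\<^sub>E a\<in>obj A. hom A a a)"
    and cmp_PiE: "cmp A \<in> (\<Pi>\<^sub>E g\<in>arr A. \<Pi>\<^sub>E f\<in>{f \<in> arr A. tgt A f = src A g}. hom A (src A f) (tgt A g))"
    and idn_left: "f \<in> hom A a b \<Longrightarrow> idn A b \<cdot> f = f"
    and idn_right: "f \<in> hom A a b \<Longrightarrow> f \<cdot> idn A a = f"
    and cmp_assoc: "f \<in> hom A a b \<Longrightarrow> g \<in> hom A b c \<Longrightarrow> h \<in> hom A c d \<Longrightarrow>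
      (h \<cdot> g) \<cdot> f = h \<cdot> (g \<cdot> f)"

definition inverse_pair :: "('o, 'm, 'x) cat_scheme \<Rightarrow> 'm \<Rightarrow> 'm \<Rightarrow> bool" where
  "inverse_pair A f g \<longleftrightarrow> f \<in> arr A \<and> g \<in> hom A (tgt A f) (src A f) \<and>
     g \<cdot>\<^bsub>A\<^esub> f = idn A (src A f) \<and> f \<cdot>\<^bsub>A\<^esub> g = idn A (tgt A f)"

definition isos :: "('o, 'm, 'x) cat_scheme \<Rightarrow> 'o \<Rightarrow> 'o \<Rightarrow> 'm set" where
  "isos A a b = {f \<in> hom A a b. \<exists>g. inverse_pair A f g}"

definition inv_arr :: "('o, 'm, 'x) cat_scheme \<Rightarrow> 'm \<Rightarrow> 'm" where
  "inv_arr A f = (THE g. inverse_pair A f g)"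

record ('o, 'm) smcat = "('o, 'm) cat" +
  ten :: "'o \<Rightarrow> 'o \<Rightarrow> 'o"  (infixr "\<otimes>\<index>" 70)
  tena :: "'m \<Rightarrow> 'm \<Rightarrow> 'm"  (infixr "\<boxtimes>\<index>" 70)
  un :: "'o"
  ass :: "'o \<Rightarrow> 'o \<Rightarrow> 'o \<Rightarrow> 'm"
  run :: "'o \<Rightarrow> 'm"
  lun :: "'o \<Rightarrow> 'm"
  swp :: "'o \<Rightarrow> 'o \<Rightarrow> 'm"

locale symm_mon_category = category A
  for A :: "('o, 'm) smcat" (structure) +
  assumes ten_PiE: "ten A \<in> obj A \<rightarrow>\<^sub>E obj A \<rightarrow>\<^sub>E obj A"
    and tena_PiE: "tena A \<in> (\<Pi>\<^sub>E f\<in>arr A. \<Pi>\<^sub>E g\<in>arr A. hom A (src A f \<otimes> src A g) (tgt A f \<otimes> tgt A g))"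
    and un_obj: "un A \<in> obj A"
    and ass_PiE: "ass A \<in> (\<Pi>\<^sub>E a\<in>obj A. \<Pi>\<^sub>E b\<in>obj A. \<Pi>\<^sub>E c\<in>obj A. isos A (a \<otimes> (b \<otimes> c)) ((a \<otimes> b) \<otimes> c))"
    and run_PiE: "run A \<in> (\<Pi>\<^sub>E a\<in>obj A. isos A (a \<otimes> un A) a)"
    and lun_PiE: "lun A \<in> (\<Pi>\<^sub>E a\<in>obj A. isos A (un A \<otimes> a) a)"
    and swp_PiE: "swp A \<in> (\<Pi>\<^sub>E a\<in>obj A. \<Pi>\<^sub>E b\<in>obj A. isos A (a \<otimes> b) (b \<otimes> a))"
    and tena_idn: "a \<in> obj A \<Longrightarrow> b \<in> obj A \<Longrightarrow> idn A a \<boxtimes> idn A b = idn A (a \<otimes> b)"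
    and tena_cmp: "f \<in> hom A a b \<Longrightarrow> g \<in> hom A b c \<Longrightarrow> f' \<in> hom A a' b' \<Longrightarrow> g' \<in> hom A b' c' \<Longrightarrow>
      (g \<cdot> f) \<boxtimes> (g' \<cdot> f') = (g \<boxtimes> g') \<cdot> (f \<boxtimes> f')"
    and ass_natural: "f \<in> hom A a a' \<Longrightarrow> g \<in> hom A b b' \<Longrightarrow> h \<in> hom A c c' \<Longrightarrow>
      ass A a' b' c' \<cdot> (f \<boxtimes> (g \<boxtimes> h)) = ((f \<boxtimes> g) \<boxtimes> h) \<cdot> ass A a b c"
    and run_natural: "f \<in> hom A a b \<Longrightarrow> run A b \<cdot> (f \<boxtimes> idn A (un A)) = f \<cdot> run A a"
    and lun_natural: "f \<in> hom A a b \<Longrightarrow> lun A b \<cdot> (idn A (un A) \<boxtimes> f) = f \<cdot> lun A a"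
    and swp_natural: "f \<in> hom A a a' \<Longrightarrow> g \<in> hom A b b' \<Longrightarrow>
      swp A a' b' \<cdot> (f \<boxtimes> g) = (g \<boxtimes> f) \<cdot> swp A a b"
    and pentagon: "a \<in> obj A \<Longrightarrow> b \<in> obj A \<Longrightarrow> c \<in> obj A \<Longrightarrow> d \<in> obj A \<Longrightarrow>
      ass A (a \<otimes> b) c d \<cdot> ass A a b (c \<otimes> d) =
      (ass A a b c \<boxtimes> idn A d) \<cdot> ass A a (b \<otimes> c) d \<cdot> (idn A a \<boxtimes> ass A b c d)"
    and triangle: "a \<in> obj A \<Longrightarrow> b \<in> obj A \<Longrightarrow>
      (run A a \<boxtimes> idn A b) \<cdot> ass A a (un A) b = idn A a \<boxtimes> lun A b"
    and lun_run_un: "lun A (un A) = run A (un A)"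
    and hexagon: "a \<in> obj A \<Longrightarrow> b \<in> obj A \<Longrightarrow> c \<in> obj A \<Longrightarrow>
      ass A c a b \<cdot> swp A (a \<otimes> b) c \<cdot> ass A a b c =
      (swp A a c \<boxtimes> idn A b) \<cdot> ass A a c b \<cdot> (idn A a \<boxtimes> swp A b c)"
    and swp_swp: "a \<in> obj A \<Longrightarrow> b \<in> obj A \<Longrightarrow> swp A b a \<cdot> swp A a b = idn A (a \<otimes> b)"
    and lun_swp: "a \<in> obj A \<Longrightarrow> lun A a \<cdot> swp A a (un A) = run A a"

text \<open>The canonical arrow \<open>(a \<otimes> b) \<otimes> (c \<otimes> d) \<rightarrow> (a \<otimes> c) \<otimes> (b \<otimes> d)\<close>.\<close>

definition interchange :: "('o, 'm) smcat \<Rightarrow> 'o \<Rightarrow> 'o \<Rightarrow> 'o \<Rightarrow> 'o \<Rightarrow> 'm" where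
  "interchange A a b c d =
     ass A a c (b \<otimes>\<^bsub>A\<^esub> d)
     \<cdot>\<^bsub>A\<^esub> (idn A a \<boxtimes>\<^bsub>A\<^esub> inv_arr A (ass A c b d))
     \<cdot>\<^bsub>A\<^esub> (idn A a \<boxtimes>\<^bsub>A\<^esub> (swp A b c \<boxtimes>\<^bsub>A\<^esub> idn A d))
     \<cdot>\<^bsub>A\<^esub> (idn A a \<boxtimes>\<^bsub>A\<^esub> ass A b c d)
     \<cdot>\<^bsub>A\<^esub> inv_arr A (ass A a b (c \<otimes>\<^bsub>A\<^esub> d))"


section \<open>Symmetric monoidal functors\<close>

record ('o, 'm, 'p, 'n) smfun =
  fdom :: "('o, 'm) smcat"
  fcod :: "('p, 'n) smcat"
  fobj :: "'o \<Rightarrow> 'p"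
  farr :: "'m \<Rightarrow> 'n"
  fzero :: "'n"
  ftwo :: "'o \<Rightarrow> 'o \<Rightarrow> 'n"

locale symm_mon_functor =
  fixes F :: "('o, 'm, 'p, 'n) smfun"
    and A :: "('o, 'm) smcat"
    and B :: "('p, 'n) smcat"
  assumes fdom: "fdom F = A" and smc_dom: "symm_mon_category A"
    and fcod: "fcod F = B" and smc_cod: "symm_mon_category B"
    and fobj_PiE: "fobj F \<in> obj A \<rightarrow>\<^sub>E obj B"
    and farr_PiE: "farr F \<in> (\<Pi>\<^sub>E f\<in>arr A. hom B (fobj F (src A f)) (fobj F (tgt A f)))"
    and farr_idn: "a \<in> obj A \<Longrightarrow> farr F (idn A a) = idn B (fobj F a)"
    and farr_cmp: "f \<in> hom A a b \<Longrightarrow> g \<in> hom A b c \<Longrightarrow> farr F (g \<cdot>\<^bsub>A\<^esub> f) = farr F g \<cdot>\<^bsub>B\<^esub> farr F f"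
    and fzero_hom: "fzero F \<in> hom B (un B) (fobj F (un A))"
    and ftwo_PiE: "ftwo F \<in> (\<Pi>\<^sub>E a\<in>obj A. \<Pi>\<^sub>E b\<in>obj A. hom B (fobj F a \<otimes>\<^bsub>B\<^esub> fobj F b) (fobj F (a \<otimes>\<^bsub>A\<^esub> b)))"
    and ftwo_natural: "f \<in> hom A a a' \<Longrightarrow> g \<in> hom A b b' \<Longrightarrow>
      ftwo F a' b' \<cdot>\<^bsub>B\<^esub> (farr F f \<boxtimes>\<^bsub>B\<^esub> farr F g) = farr F (f \<boxtimes>\<^bsub>A\<^esub> g) \<cdot>\<^bsub>B\<^esub> ftwo F a b"
    and ftwo_ass: "a \<in> obj A \<Longrightarrow> b \<in> obj A \<Longrightarrow> c \<in> obj A \<Longrightarrow>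
      ftwo F (a \<otimes>\<^bsub>A\<^esub> b) c \<cdot>\<^bsub>B\<^esub> (ftwo F a b \<boxtimes>\<^bsub>B\<^esub> idn B (fobj F c)) \<cdot>\<^bsub>B\<^esub> ass B (fobj F a) (fobj F b) (fobj F c) =
      farr F (ass A a b c) \<cdot>\<^bsub>B\<^esub> ftwo F a (b \<otimes>\<^bsub>A\<^esub> c) \<cdot>\<^bsub>B\<^esub> (idn B (fobj F a) \<boxtimes>\<^bsub>B\<^esub> ftwo F b c)"
    and ftwo_run: "a \<in> obj A \<Longrightarrow>
      farr F (run A a) \<cdot>\<^bsub>B\<^esub> ftwo F a (un A) \<cdot>\<^bsub>B\<^esub> (idn B (fobj F a) \<boxtimes>\<^bsub>B\<^esub> fzero F) = run B (fobj F a)"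
    and ftwo_lun: "a \<in> obj A \<Longrightarrow>
      farr F (lun A a) \<cdot>\<^bsub>B\<^esub> ftwo F (un A) a \<cdot>\<^bsub>B\<^esub> (fzero F \<boxtimes>\<^bsub>B\<^esub> idn B (fobj F a)) = lun B (fobj F a)"
    and ftwo_swp: "a \<in> obj A \<Longrightarrow> b \<in> obj A \<Longrightarrow>
      ftwo F b a \<cdot>\<^bsub>B\<^esub> swp B (fobj F a) (fobj F b) = farr F (swp A a b) \<cdot>\<^bsub>B\<^esub> ftwo F a b"

definition id_smf :: "('o, 'm) smcat \<Rightarrow> ('o, 'm, 'o, 'm) smfun" where
  "id_smf A = \<lparr>fdom = A, fcod = A,
     fobj = (\<lambda>a\<in>obj A. a),
     farr = (\<lambda>f\<in>arr A. f),
     fzero = idn A (un A),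
     ftwo = (\<lambda>a\<in>obj A. \<lambda>b\<in>obj A. idn A (a \<otimes>\<^bsub>A\<^esub> b))\<rparr>"

definition comp_smf :: "('p, 'n, 'q, 'k) smfun \<Rightarrow> ('o, 'm, 'p, 'n) smfun \<Rightarrow> ('o, 'm, 'q, 'k) smfun"
    (infixr "\<circ>\<^sub>F" 60) where
  "G \<circ>\<^sub>F F = (let A = fdom F; C = fcod G in \<lparr>fdom = A, fcod = C,
     fobj = (\<lambda>a\<in>obj A. fobj G (fobj F a)),
     farr = (\<lambda>f\<in>arr A. farr G (farr F f)),
     fzero = farr G (fzero F) \<cdot>\<^bsub>C\<^esub> fzero G,
     ftwo = (\<lambda>a\<in>obj A. \<lambda>b\<in>obj A. farr G (ftwo F a b) \<cdot>\<^bsub>C\<^esub> ftwo G (fobj F a) (fobj F b))\<rparr>)"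


section \<open>Monoidal natural transformations\<close>

record ('o, 'm, 'p, 'n) nattr =
  nsrc :: "('o, 'm, 'p, 'n) smfun"
  ntgt :: "('o, 'm, 'p, 'n) smfun"
  ncmp :: "'o \<Rightarrow> 'n"

locale mon_nat_trans =
  fixes t :: "('o, 'm, 'p, 'n) nattr"
    and F G :: "('o, 'm, 'p, 'n) smfun"
    and A :: "('o, 'm) smcat"
    and B :: "('p, 'n) smcat"
  assumes nsrc: "nsrc t = F" and smf_src: "symm_mon_functor F A B"
    and ntgt: "ntgt t = G" and smf_tgt: "symm_mon_functor G A B"
    and ncmp_PiE: "ncmp t \<in> (\<Pi>\<^sub>E a\<in>obj A. hom B (fobj F a) (fobj G a))"
    and ncmp_natural: "f \<in> hom A a b \<Longrightarrow> ncmp t b \<cdot>\<^bsub>B\<^esub> farr F f = farr G f \<cdot>\<^bsub>B\<^esub> ncmp t a"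
    and ncmp_zero: "ncmp t (un A) \<cdot>\<^bsub>B\<^esub> fzero F = fzero G"
    and ncmp_two: "a \<in> obj A \<Longrightarrow> b \<in> obj A \<Longrightarrow>
      ncmp t (a \<otimes>\<^bsub>A\<^esub> b) \<cdot>\<^bsub>B\<^esub> ftwo F a b = ftwo G a b \<cdot>\<^bsub>B\<^esub> (ncmp t a \<boxtimes>\<^bsub>B\<^esub> ncmp t b)"

definition id_nt :: "('o, 'm, 'p, 'n) smfun \<Rightarrow> ('o, 'm, 'p, 'n) nattr" where
  "id_nt F = \<lparr>nsrc = F, ntgt = F, ncmp = (\<lambda>a\<in>obj (fdom F). idn (fcod F) (fobj F a))\<rparr>"

definition vcomp_nt :: "('o, 'm, 'p, 'n) nattr \<Rightarrow> ('o, 'm, 'p, 'n) nattr \<Rightarrow> ('o, 'm, 'p, 'n) nattr" where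
  "vcomp_nt t s = \<lparr>nsrc = nsrc s, ntgt = ntgt t,
     ncmp = (\<lambda>a\<in>obj (fdom (nsrc s)). ncmp t a \<cdot>\<^bsub>fcod (nsrc s)\<^esub> ncmp s a)\<rparr>"

definition hcomp_nt :: "('p, 'n, 'q, 'k) nattr \<Rightarrow> ('o, 'm, 'p, 'n) nattr \<Rightarrow> ('o, 'm, 'q, 'k) nattr"
    (infixr "*\<^sub>N" 60) where
  "t *\<^sub>N s = \<lparr>nsrc = nsrc t \<circ>\<^sub>F nsrc s, ntgt = ntgt t \<circ>\<^sub>F ntgt s,
     ncmp = (\<lambda>a\<in>obj (fdom (nsrc s)).
       ncmp t (fobj (ntgt s) a) \<cdot>\<^bsub>fcod (nsrc t)\<^esub> farr (nsrc t) (ncmp s a))\<rparr>"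


section \<open>The symmetric monoidal category of symmetric monoidal functors\<close>

definition box_smf :: "('o, 'm, 'p, 'n) smfun \<Rightarrow> ('o, 'm, 'p, 'n) smfun \<Rightarrow> ('o, 'm, 'p, 'n) smfun"
    (infixr "\<box>" 70) where
  "F \<box> G = (let A = fdom F; B = fcod F in \<lparr>fdom = A, fcod = B,
     fobj = (\<lambda>a\<in>obj A. fobj F a \<otimes>\<^bsub>B\<^esub> fobj G a),
     farr = (\<lambda>f\<in>arr A. farr F f \<boxtimes>\<^bsub>B\<^esub> farr G f),
     fzero = (fzero F \<boxtimes>\<^bsub>B\<^esub> fzero G) \<cdot>\<^bsub>B\<^esub> inv_arr B (lun B (un B)),
     ftwo = (\<lambda>a\<in>obj A. \<lambda>b\<in>obj A. (ftwo F a b \<boxtimes>\<^bsub>B\<^esub> ftwo G a b)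
       \<cdot>\<^bsub>B\<^esub> interchange B (fobj F a) (fobj G a) (fobj F b) (fobj G b))\<rparr>)"

definition box_nt :: "('o, 'm, 'p, 'n) nattr \<Rightarrow> ('o, 'm, 'p, 'n) nattr \<Rightarrow> ('o, 'm, 'p, 'n) nattr" where
  "box_nt s t = \<lparr>nsrc = nsrc s \<box> nsrc t, ntgt = ntgt s \<box> ntgt t,
     ncmp = (\<lambda>a\<in>obj (fdom (nsrc s)). ncmp s a \<boxtimes>\<^bsub>fcod (nsrc s)\<^esub> ncmp t a)\<rparr>"

definition unit_smf :: "('o, 'm) smcat \<Rightarrow> ('p, 'n) smcat \<Rightarrow> ('o, 'm, 'p, 'n) smfun" where
  "unit_smf A B = \<lparr>fdom = A, fcod = B,
     fobj = (\<lambda>a\<in>obj A. un B),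
     farr = (\<lambda>f\<in>arr A. idn B (un B)),
     fzero = idn B (un B),
     ftwo = (\<lambda>a\<in>obj A. \<lambda>b\<in>obj A. lun B (un B))\<rparr>"

definition hom_smc :: "('o, 'm) smcat \<Rightarrow> ('p, 'n) smcat
    \<Rightarrow> (('o, 'm, 'p, 'n) smfun, ('o, 'm, 'p, 'n) nattr) smcat" where
  "hom_smc A B = (let
     Ob = {F. symm_mon_functor F A B};
     Ar = {t. \<exists>F G. mon_nat_trans t F G A B}
   in \<lparr>obj = Ob, arr = Ar,
     src = (\<lambda>t\<in>Ar. nsrc t),
     tgt = (\<lambda>t\<in>Ar. ntgt t),
     idn = (\<lambda>F\<in>Ob. id_nt F),
     cmp = (\<lambda>t\<in>Ar. \<lambda>s\<in>{s \<in> Ar. ntgt s = nsrc t}. vcomp_nt t s),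
     ten = (\<lambda>F\<in>Ob. \<lambda>G\<in>Ob. F \<box> G),
     tena = (\<lambda>s\<in>Ar. \<lambda>t\<in>Ar. box_nt s t),
     un = unit_smf A B,
     ass = (\<lambda>F\<in>Ob. \<lambda>G\<in>Ob. \<lambda>H\<in>Ob. \<lparr>nsrc = F \<box> (G \<box> H), ntgt = (F \<box> G) \<box> H,
       ncmp = (\<lambda>a\<in>obj A. ass B (fobj F a) (fobj G a) (fobj H a))\<rparr>),
     run = (\<lambda>F\<in>Ob. \<lparr>nsrc = F \<box> unit_smf A B, ntgt = F,
       ncmp = (\<lambda>a\<in>obj A. run B (fobj F a))\<rparr>),
     lun = (\<lambda>F\<in>Ob. \<lparr>nsrc = unit_smf A B \<box> F, ntgt = F,
       ncmp = (\<lambda>a\<in>obj A. lun B (fobj F a))\<rparr>),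
     swp = (\<lambda>F\<in>Ob. \<lambda>G\<in>Ob. \<lparr>nsrc = F \<box> G, ntgt = G \<box> F,
       ncmp = (\<lambda>a\<in>obj A. swp B (fobj F a) (fobj G a))\<rparr>)\<rparr>)"

definition hom_smf :: "('q, 'k, 'o, 'm) smfun \<Rightarrow> ('p, 'n, 'r, 'l) smfun
    \<Rightarrow> (('o, 'm, 'p, 'n) smfun, ('o, 'm, 'p, 'n) nattr,
        ('q, 'k, 'r, 'l) smfun, ('q, 'k, 'r, 'l) nattr) smfun" where
  "hom_smf F G = (let
     C = fdom F; A = fcod F; B = fdom G; D = fcod G;
     AB = hom_smc A B; CD = hom_smc C D
   in \<lparr>fdom = AB, fcod = CD,
     fobj = (\<lambda>H\<in>obj AB. G \<circ>\<^sub>F H \<circ>\<^sub>F F),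
     farr = (\<lambda>t\<in>arr AB. id_nt G *\<^sub>N t *\<^sub>N id_nt F),
     fzero = \<lparr>nsrc = un CD, ntgt = G \<circ>\<^sub>F un AB \<circ>\<^sub>F F,
       ncmp = (\<lambda>c\<in>obj C. fzero G)\<rparr>,
     ftwo = (\<lambda>H\<in>obj AB. \<lambda>K\<in>obj AB.
       \<lparr>nsrc = (G \<circ>\<^sub>F H \<circ>\<^sub>F F) \<box> (G \<circ>\<^sub>F K \<circ>\<^sub>F F), ntgt = G \<circ>\<^sub>F (H \<box> K) \<circ>\<^sub>F F,
        ncmp = (\<lambda>c\<in>obj C. ftwo G (fobj H (fobj F c)) (fobj K (fobj F c)))\<rparr>)\<rparr>)"

definition hom_nt :: "('q, 'k, 'o, 'm) nattr \<Rightarrow> ('p, 'n, 'r, 'l) nattr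
    \<Rightarrow> (('o, 'm, 'p, 'n) smfun, ('o, 'm, 'p, 'n) nattr,
        ('q, 'k, 'r, 'l) smfun, ('q, 'k, 'r, 'l) nattr) nattr" where
  "hom_nt s t = \<lparr>nsrc = hom_smf (nsrc s) (nsrc t), ntgt = hom_smf (ntgt s) (ntgt t),
     ncmp = (\<lambda>H\<in>obj (hom_smc (fcod (nsrc s)) (fdom (nsrc t))). t *\<^sub>N id_nt H *\<^sub>N s)\<rparr>"


section \<open>Strict 2-categories and 2-functors\<close>

record ('a, 'f, 't) two_cat =
  cell0 :: "'a set"
  cell1 :: "'f set"
  cell2 :: "'t set"
  src1 :: "'f \<Rightarrow> 'a"
  tgt1 :: "'f \<Rightarrow> 'a"
  src2 :: "'t \<Rightarrow> 'f"
  tgt2 :: "'t \<Rightarrow> 'f"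
  id1 :: "'a \<Rightarrow> 'f"
  id2 :: "'f \<Rightarrow> 't"
  comp1 :: "'f \<Rightarrow> 'f \<Rightarrow> 'f"
  vcomp :: "'t \<Rightarrow> 't \<Rightarrow> 't"
  hcomp :: "'t \<Rightarrow> 't \<Rightarrow> 't"

definition hom1 :: "('a, 'f, 't) two_cat \<Rightarrow> 'a \<Rightarrow> 'a \<Rightarrow> 'f set" where
  "hom1 X a b = {f \<in> cell1 X. src1 X f = a \<and> tgt1 X f = b}"

definition hom2 :: "('a, 'f, 't) two_cat \<Rightarrow> 'f \<Rightarrow> 'f \<Rightarrow> 't set" where
  "hom2 X f g = {t \<in> cell2 X. src2 X t = f \<and> tgt2 X t = g}"

locale two_category =
  fixes X :: "('a, 'f, 't) two_cat"
  assumes src1_cell: "f \<in> cell1 X \<Longrightarrow> src1 X f \<in> cell0 X"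
    and tgt1_cell: "f \<in> cell1 X \<Longrightarrow> tgt1 X f \<in> cell0 X"
    and src2_cell: "t \<in> cell2 X \<Longrightarrow> src2 X t \<in> cell1 X"
    and tgt2_cell: "t \<in> cell2 X \<Longrightarrow> tgt2 X t \<in> cell1 X"
    and src1_src2: "t \<in> cell2 X \<Longrightarrow> src1 X (src2 X t) = src1 X (tgt2 X t)"
    and tgt1_src2: "t \<in> cell2 X \<Longrightarrow> tgt1 X (src2 X t) = tgt1 X (tgt2 X t)"
    and id1_hom: "a \<in> cell0 X \<Longrightarrow> id1 X a \<in> hom1 X a a"
    and comp1_hom: "f \<in> hom1 X a b \<Longrightarrow> g \<in> hom1 X b c \<Longrightarrow> comp1 X g f \<in> hom1 X a c"
    and comp1_id_left: "f \<in> hom1 X a b \<Longrightarrow> comp1 X (id1 X b) f = f"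
    and comp1_id_right: "f \<in> hom1 X a b \<Longrightarrow> comp1 X f (id1 X a) = f"
    and comp1_assoc: "f \<in> hom1 X a b \<Longrightarrow> g \<in> hom1 X b c \<Longrightarrow> h \<in> hom1 X c d \<Longrightarrow>
      comp1 X (comp1 X h g) f = comp1 X h (comp1 X g f)"
    and id2_hom: "f \<in> cell1 X \<Longrightarrow> id2 X f \<in> hom2 X f f"
    and vcomp_hom: "s \<in> hom2 X f g \<Longrightarrow> t \<in> hom2 X g h \<Longrightarrow> vcomp X t s \<in> hom2 X f h"
    and vcomp_id_left: "t \<in> hom2 X f g \<Longrightarrow> vcomp X (id2 X g) t = t"
    and vcomp_id_right: "t \<in> hom2 X f g \<Longrightarrow> vcomp X t (id2 X f) = t"
    and vcomp_assoc: "s \<in> hom2 X f g \<Longrightarrow> t \<in> hom2 X g h \<Longrightarrow> u \<in> hom2 X h k \<Longrightarrow>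
      vcomp X (vcomp X u t) s = vcomp X u (vcomp X t s)"
    and hcomp_hom: "f \<in> hom1 X a b \<Longrightarrow> f' \<in> hom1 X a b \<Longrightarrow> g \<in> hom1 X b c \<Longrightarrow> g' \<in> hom1 X b c \<Longrightarrow>
      s \<in> hom2 X f f' \<Longrightarrow> t \<in> hom2 X g g' \<Longrightarrow> hcomp X t s \<in> hom2 X (comp1 X g f) (comp1 X g' f')"
    and hcomp_id_left: "f \<in> hom1 X a b \<Longrightarrow> t \<in> hom2 X f g \<Longrightarrow> hcomp X (id2 X (id1 X b)) t = t"
    and hcomp_id_right: "f \<in> hom1 X a b \<Longrightarrow> t \<in> hom2 X f g \<Longrightarrow> hcomp X t (id2 X (id1 X a)) = t"
    and hcomp_assoc: "f \<in> hom1 X a b \<Longrightarrow> g \<in> hom1 X b c \<Longrightarrow> h \<in> hom1 X c d \<Longrightarrow>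
      s \<in> hom2 X f f' \<Longrightarrow> t \<in> hom2 X g g' \<Longrightarrow> u \<in> hom2 X h h' \<Longrightarrow>
      hcomp X (hcomp X u t) s = hcomp X u (hcomp X t s)"
    and hcomp_id2: "f \<in> hom1 X a b \<Longrightarrow> g \<in> hom1 X b c \<Longrightarrow>
      hcomp X (id2 X g) (id2 X f) = id2 X (comp1 X g f)"
    and hcomp_vcomp: "f \<in> hom1 X a b \<Longrightarrow> g \<in> hom1 X b c \<Longrightarrow>
      s \<in> hom2 X f f' \<Longrightarrow> s' \<in> hom2 X f' f'' \<Longrightarrow> t \<in> hom2 X g g' \<Longrightarrow> t' \<in> hom2 X g' g'' \<Longrightarrow>
      hcomp X (vcomp X t' t) (vcomp X s' s) = vcomp X (hcomp X t' s') (hcomp X t s)"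

definition op1 :: "('a, 'f, 't) two_cat \<Rightarrow> ('a, 'f, 't) two_cat" where
  "op1 X = \<lparr>cell0 = cell0 X, cell1 = cell1 X, cell2 = cell2 X,
     src1 = tgt1 X, tgt1 = src1 X, src2 = src2 X, tgt2 = tgt2 X,
     id1 = id1 X, id2 = id2 X,
     comp1 = (\<lambda>g f. comp1 X f g), vcomp = vcomp X, hcomp = (\<lambda>t s. hcomp X s t)\<rparr>"

definition prod2 :: "('a, 'f, 's) two_cat \<Rightarrow> ('b, 'g, 't) two_cat \<Rightarrow> ('a \<times> 'b, 'f \<times> 'g, 's \<times> 't) two_cat"
    (infixr "\<times>\<^sub>2" 80) where
  "X \<times>\<^sub>2 Y = \<lparr>cell0 = cell0 X \<times> cell0 Y, cell1 = cell1 X \<times> cell1 Y, cell2 = cell2 X \<times> cell2 Y,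
     src1 = map_prod (src1 X) (src1 Y), tgt1 = map_prod (tgt1 X) (tgt1 Y),
     src2 = map_prod (src2 X) (src2 Y), tgt2 = map_prod (tgt2 X) (tgt2 Y),
     id1 = map_prod (id1 X) (id1 Y), id2 = map_prod (id2 X) (id2 Y),
     comp1 = (\<lambda>(g, g') (f, f'). (comp1 X g f, comp1 Y g' f')),
     vcomp = (\<lambda>(t, t') (s, s'). (vcomp X t s, vcomp Y t' s')),
     hcomp = (\<lambda>(t, t') (s, s'). (hcomp X t s, hcomp Y t' s'))\<rparr>"

record ('a, 'f, 's, 'b, 'g, 't) two_map =
  map0 :: "'a \<Rightarrow> 'b"
  map1 :: "'f \<Rightarrow> 'g"
  map2 :: "'s \<Rightarrow> 't"

locale two_functor = X: two_category X + Y: two_category Y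
  for X :: "('a, 'f, 's) two_cat"
    and Y :: "('b, 'g, 't) two_cat"
    and P :: "('a, 'f, 's, 'b, 'g, 't) two_map" +
  assumes map0_cell: "a \<in> cell0 X \<Longrightarrow> map0 P a \<in> cell0 Y"
    and map1_hom: "f \<in> hom1 X a b \<Longrightarrow> map1 P f \<in> hom1 Y (map0 P a) (map0 P b)"
    and map2_hom: "t \<in> hom2 X f g \<Longrightarrow> map2 P t \<in> hom2 Y (map1 P f) (map1 P g)"
    and map1_id1: "a \<in> cell0 X \<Longrightarrow> map1 P (id1 X a) = id1 Y (map0 P a)"
    and map1_comp1: "f \<in> hom1 X a b \<Longrightarrow> g \<in> hom1 X b c \<Longrightarrow>
      map1 P (comp1 X g f) = comp1 Y (map1 P g) (map1 P f)"
    and map2_id2: "f \<in> cell1 X \<Longrightarrow> map2 P (id2 X f) = id2 Y (map1 P f)"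
    and map2_vcomp: "s \<in> hom2 X f g \<Longrightarrow> t \<in> hom2 X g h \<Longrightarrow>
      map2 P (vcomp X t s) = vcomp Y (map2 P t) (map2 P s)"
    and map2_hcomp: "f \<in> hom1 X a b \<Longrightarrow> g \<in> hom1 X b c \<Longrightarrow> s \<in> hom2 X f f' \<Longrightarrow> t \<in> hom2 X g g' \<Longrightarrow>
      map2 P (hcomp X t s) = hcomp Y (map2 P t) (map2 P s)"


section \<open>The 2-category of symmetric monoidal categories\<close>

text \<open>
  The 0-cells are the symmetric monoidal categories whose objects and arrows form subsets of the
  types \<open>'o\<close> and \<open>'m\<close>; these two types bound the size of the categories considered.
\<close>

definition SMC :: "(('o, 'm) smcat, ('o, 'm, 'o, 'm) smfun, ('o, 'm, 'o, 'm) nattr) two_cat" where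
  "SMC = \<lparr>cell0 = {A. symm_mon_category A},
     cell1 = {F. \<exists>A B. symm_mon_functor F A B},
     cell2 = {t. \<exists>F G A B. mon_nat_trans t F G A B},
     src1 = fdom, tgt1 = fcod, src2 = nsrc, tgt2 = ntgt,
     id1 = id_smf, id2 = id_nt,
     comp1 = comp_smf, vcomp = vcomp_nt, hcomp = hcomp_nt\<rparr>"

end

theory Submission
  imports Defs
begin

text \<open>
  The Hom categories of the 2-functor live pointwise in the target category. An equation between
  transformations is an equation between their components, so the categories \<open>[A, B]\<close> inherit the
  coherence axioms of \<open>B\<close>, and \<open>[F, G]\<close> inherits the axioms of a lax functor from \<open>G\<close>. What is not
  pointwise is monoidality: the pointwise product \<open>F \<box> G\<close> must again be a symmetric lax monoidal
  functor, the pointwise structural arrows must be monoidal transformations, and so must the arrows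
  \<open>[F, G]\<^sup>0\<close> and \<open>[F, G]\<^sup>2\<close>. All of this rests on two facts about the canonical arrow
  \<open>(a \<otimes> b) \<otimes> (c \<otimes> d) \<rightarrow> (a \<otimes> c) \<otimes> (b \<otimes> d)\<close>.

  The first fact is that this interchange is coherent: it is compatible with the associativity, the
  units and the symmetry, both when these act across the two pairs (which makes \<open>F \<box> G\<close> a symmetric
  monoidal functor, \<open>box_smf_functor\<close>) and when they act inside them (which makes the structural
  arrows of \<open>[A, B]\<close> monoidal, \<open>ass_nt_trans\<close> and its companions). These coherence equations are
  obtained by strictification. The assignment \<open>x \<mapsto> x \<otimes> -\<close> is faithful, and \<open>x \<otimes> z\<close> is isomorphic to
  the right-nested product \<open>a\<^sub>1 \<otimes> (a\<^sub>2 \<otimes> (\<dots> \<otimes> z))\<close> of the factors of \<open>x\<close> with \<open>z\<close>. Conjugated by this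
  isomorphism, associativities and units become identities, and a symmetry becomes a composite of
  transpositions of neighbouring factors. Two canonical arrows are then equal as soon as
  the resulting composites of transpositions agree (\<open>acts_unique\<close>), and for the equations that are needed here
  the naturality of a transposition and the fact that it is an involution suffice.

  The second fact is that a lax symmetric monoidal functor commutes with the interchange
  (\<open>lax_interchange\<close>). It makes \<open>[F, G]\<^sup>2\<close> monoidal: precomposition with \<open>F\<close> preserves the products
  \<open>H \<box> K\<close> strictly (\<open>box_comp\<close>), so only postcomposition with \<open>G\<close> remains (\<open>comp_box_trans\<close>).

  The 2-functor laws hold strictly, because composition of lax functors is strictly associative and
  unital. On 2-cells they are instances of the interchange law of vertical and horizontal
  composition, as \<open>[\<sigma>, \<tau>]\<close> has the component \<open>\<tau> * id\<^sub>H * \<sigma>\<close> at \<open>H\<close>.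
\<close>

section \<open>Composition and isomorphisms\<close>

context category begin

lemma src_obj [simp]: "f \<in> arr A \<Longrightarrow> src A f \<in> obj A"
  and tgt_obj [simp]: "f \<in> arr A \<Longrightarrow> tgt A f \<in> obj A"
  using src_PiE tgt_PiE by auto

lemma idn_hom: "a \<in> obj A \<Longrightarrow> idn A a \<in> hom A a a"
  using idn_PiE by auto

lemma idn_arr [simp]: "a \<in> obj A \<Longrightarrow> idn A a \<in> arr A"
  and idn_src [simp]: "a \<in> obj A \<Longrightarrow> src A (idn A a) = a"
  and idn_tgt [simp]: "a \<in> obj A \<Longrightarrow> tgt A (idn A a) = a"
  using idn_hom by (auto simp: hom_def)

lemma cmp_hom:
  assumes "f \<in> arr A" "g \<in> arr A" "src A g = tgt A f"
  shows "g \<cdot> f \<in> hom A (src A f) (tgt A g)"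
proof -
  have "cmp A g \<in> (\<Pi>\<^sub>E f\<in>{f \<in> arr A. tgt A f = src A g}. hom A (src A f) (tgt A g))"
    using PiE_mem[OF cmp_PiE assms(2)] .
  then show ?thesis by (rule PiE_mem) (use assms in simp)
qed

lemma cmp_arr [simp]: "f \<in> arr A \<Longrightarrow> g \<in> arr A \<Longrightarrow> src A g = tgt A f \<Longrightarrow> g \<cdot> f \<in> arr A"
  and cmp_src [simp]: "f \<in> arr A \<Longrightarrow> g \<in> arr A \<Longrightarrow> src A g = tgt A f \<Longrightarrow> src A (g \<cdot> f) = src A f"
  and cmp_tgt [simp]: "f \<in> arr A \<Longrightarrow> g \<in> arr A \<Longrightarrow> src A g = tgt A f \<Longrightarrow> tgt A (g \<cdot> f) = tgt A g"
  using cmp_hom by (auto simp: hom_def)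

lemma cmp_idn_left [simp]: "f \<in> arr A \<Longrightarrow> tgt A f = b \<Longrightarrow> idn A b \<cdot> f = f"
  and cmp_idn_right [simp]: "f \<in> arr A \<Longrightarrow> src A f = a \<Longrightarrow> f \<cdot> idn A a = f"
  using idn_left idn_right by (auto simp: hom_def)

lemma assoc [simp]:
  "f \<in> arr A \<Longrightarrow> g \<in> arr A \<Longrightarrow> h \<in> arr A \<Longrightarrow> src A g = tgt A f \<Longrightarrow> src A h = tgt A g \<Longrightarrow>
   (h \<cdot> g) \<cdot> f = h \<cdot> (g \<cdot> f)"
  using cmp_assoc by (auto simp: hom_def)

text \<open>Right-nested composites are the normal form of the simplifier, so an equation between composites
  of two arrows is applied inside a longer composite in the following two forms.\<close>

lemma cmp_extend:
  assumes "g \<cdot> f = g' \<cdot> f'" "f \<in> arr A" "g \<in> arr A" "src A g = tgt A f"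
    "f' \<in> arr A" "g' \<in> arr A" "src A g' = tgt A f'" "h \<in> arr A" "tgt A h = src A f"
  shows "g \<cdot> f \<cdot> h = g' \<cdot> f' \<cdot> h"
proof -
  have "src A f' = src A f" using assms cmp_src by metis
  then show ?thesis
    using assms assoc[of h f g] assoc[of h f' g'] by simp
qed

lemma cmp_extend1:
  assumes "g \<cdot> f = k" "f \<in> arr A" "g \<in> arr A" "src A g = tgt A f" "h \<in> arr A" "tgt A h = src A f"
  shows "g \<cdot> f \<cdot> h = k \<cdot> h"
  using assms assoc[of h f g] by simp

lemma inv_arr_eq:
  assumes "inverse_pair A f g"
  shows "inv_arr A f = g"
  unfolding inv_arr_def
proof (rule the_equality)
  fix h assume h: "inverse_pair A f h"
  have "h = h \<cdot> f \<cdot> g" using assms h by (auto simp: inverse_pair_def hom_def)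
  also have "\<dots> = (h \<cdot> f) \<cdot> g"
    by (rule assoc[symmetric]) (use assms h in \<open>auto simp: inverse_pair_def hom_def\<close>)
  also have "\<dots> = g" using assms h by (auto simp: inverse_pair_def hom_def)
  finally show "h = g" .
qed fact

lemma iso_inverse_pair: "f \<in> isos A a b \<Longrightarrow> inverse_pair A f (inv_arr A f)"
  unfolding isos_def using inv_arr_eq by auto

lemma iso_facts:
  assumes "f \<in> isos A a b"
  shows "f \<in> arr A" "src A f = a" "tgt A f = b" "a \<in> obj A" "b \<in> obj A"
    "inv_arr A f \<in> arr A" "src A (inv_arr A f) = b" "tgt A (inv_arr A f) = a"
    "inv_arr A f \<cdot> f = idn A a" "f \<cdot> inv_arr A f = idn A b"
proof -
  have "inverse_pair A f (inv_arr A f)" "f \<in> hom A a b"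
    using iso_inverse_pair[OF assms] assms by (auto simp: isos_def)
  then show "f \<in> arr A" "src A f = a" "tgt A f = b" "a \<in> obj A" "b \<in> obj A"
    "inv_arr A f \<in> arr A" "src A (inv_arr A f) = b" "tgt A (inv_arr A f) = a"
    "inv_arr A f \<cdot> f = idn A a" "f \<cdot> inv_arr A f = idn A b"
    by (auto simp: inverse_pair_def hom_def)
qed

lemma isosI:
  assumes "f \<in> arr A" "g \<in> arr A" "src A f = a" "tgt A f = b" "src A g = b" "tgt A g = a"
    "g \<cdot> f = idn A a" "f \<cdot> g = idn A b"
  shows "f \<in> isos A a b" "inv_arr A f = g"
proof -
  have *: "inverse_pair A f g" using assms by (auto simp: inverse_pair_def hom_def)
  show "inv_arr A f = g" using * by (rule inv_arr_eq)
  show "f \<in> isos A a b" using * assms by (auto simp: isos_def hom_def)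
qed

lemma iso_cancel_left:
  assumes "f \<in> isos A a b" "f \<cdot> g = f \<cdot> h" "g \<in> arr A" "h \<in> arr A" "tgt A g = a" "tgt A h = a"
  shows "g = h"
proof -
  note i = iso_facts[OF assms(1)]
  have "g = inv_arr A f \<cdot> f \<cdot> g" using i assms(3-6) cmp_extend1[OF i(9), of g] by simp
  also have "\<dots> = h" unfolding assms(2) using i assms(3-6) cmp_extend1[OF i(9), of h] by simp
  finally show ?thesis .
qed

lemma iso_cancel_right:
  assumes "f \<in> isos A a b" "g \<cdot> f = h \<cdot> f" "g \<in> arr A" "h \<in> arr A" "src A g = b" "src A h = b"
  shows "g = h"
proof -
  note i = iso_facts[OF assms(1)]
  have "g = (g \<cdot> f) \<cdot> inv_arr A f" using i assms(3-6) by simp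
  also have "\<dots> = h" unfolding assms(2) using i assms(3-6) by simp
  finally show ?thesis .
qed

lemma iso_cmp:
  assumes "f \<in> isos A a b" "g \<in> isos A b c"
  shows "g \<cdot> f \<in> isos A a c"
proof (rule isosI)
  note i = iso_facts[OF assms(1)] iso_facts[OF assms(2)]
  show "(inv_arr A f \<cdot> inv_arr A g) \<cdot> (g \<cdot> f) = idn A a"
    using i cmp_extend1[OF i(19)] by simp
  show "(g \<cdot> f) \<cdot> (inv_arr A f \<cdot> inv_arr A g) = idn A c"
    using i cmp_extend1[OF i(10)] by simp
qed (use iso_facts[OF assms(1)] iso_facts[OF assms(2)] in simp_all)

lemma iso_inv: "f \<in> isos A a b \<Longrightarrow> inv_arr A f \<in> isos A b a"
  using iso_facts[of f a b] by (intro isosI(1)[of _ f]) auto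

lemma idn_iso: "a \<in> obj A \<Longrightarrow> idn A a \<in> isos A a a"
  by (rule isosI(1)[of _ "idn A a"]) auto

end

section \<open>Arrows of a symmetric monoidal category\<close>

context symm_mon_category begin

lemma ten_obj [simp]: "a \<in> obj A \<Longrightarrow> b \<in> obj A \<Longrightarrow> a \<otimes> b \<in> obj A"
  using ten_PiE by (meson PiE_mem)

lemma tena_hom:
  "f \<in> arr A \<Longrightarrow> g \<in> arr A \<Longrightarrow> f \<boxtimes> g \<in> hom A (src A f \<otimes> src A g) (tgt A f \<otimes> tgt A g)"
  using tena_PiE by (meson PiE_mem)

lemma tena_arr [simp]: "f \<in> arr A \<Longrightarrow> g \<in> arr A \<Longrightarrow> f \<boxtimes> g \<in> arr A"
  and tena_src [simp]: "f \<in> arr A \<Longrightarrow> g \<in> arr A \<Longrightarrow> src A (f \<boxtimes> g) = src A f \<otimes> src A g"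
  and tena_tgt [simp]: "f \<in> arr A \<Longrightarrow> g \<in> arr A \<Longrightarrow> tgt A (f \<boxtimes> g) = tgt A f \<otimes> tgt A g"
  using tena_hom by (auto simp: hom_def)

lemmas un_obj' [simp] = un_obj
lemmas tena_idn' [simp] = tena_idn

lemma ass_iso: "a \<in> obj A \<Longrightarrow> b \<in> obj A \<Longrightarrow> c \<in> obj A \<Longrightarrow>
    ass A a b c \<in> isos A (a \<otimes> (b \<otimes> c)) ((a \<otimes> b) \<otimes> c)"
  using ass_PiE by (meson PiE_mem)

lemma run_iso: "a \<in> obj A \<Longrightarrow> run A a \<in> isos A (a \<otimes> un A) a"
  using run_PiE by (meson PiE_mem)

lemma lun_iso: "a \<in> obj A \<Longrightarrow> lun A a \<in> isos A (un A \<otimes> a) a"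
  using lun_PiE by (meson PiE_mem)

lemma swp_iso: "a \<in> obj A \<Longrightarrow> b \<in> obj A \<Longrightarrow> swp A a b \<in> isos A (a \<otimes> b) (b \<otimes> a)"
  using swp_PiE by (meson PiE_mem)

lemmas ass_facts [simp] = iso_facts(1-3,6-10)[OF ass_iso]
lemmas run_facts [simp] = iso_facts(1-3,6-10)[OF run_iso]
lemmas lun_facts [simp] = iso_facts(1-3,6-10)[OF lun_iso]
lemmas swp_facts [simp] = iso_facts(1-3,6-10)[OF swp_iso]

lemma tena_fold:
  "f \<in> arr A \<Longrightarrow> g \<in> arr A \<Longrightarrow> f' \<in> arr A \<Longrightarrow> g' \<in> arr A \<Longrightarrow> src A g = tgt A f \<Longrightarrow> src A g' = tgt A f' \<Longrightarrow>
   (g \<boxtimes> g') \<cdot> (f \<boxtimes> f') = (g \<cdot> f) \<boxtimes> (g' \<cdot> f')"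
  using tena_cmp[of f "src A f" "tgt A f" g "tgt A g" f' "src A f'" "tgt A f'" g' "tgt A g'"]
  by (simp add: hom_def)

lemma tena_fold2:
  "f \<in> arr A \<Longrightarrow> g \<in> arr A \<Longrightarrow> f' \<in> arr A \<Longrightarrow> g' \<in> arr A \<Longrightarrow> src A g = tgt A f \<Longrightarrow> src A g' = tgt A f' \<Longrightarrow>
   h \<in> arr A \<Longrightarrow> tgt A h = src A f \<otimes> src A f' \<Longrightarrow>
   (g \<boxtimes> g') \<cdot> (f \<boxtimes> f') \<cdot> h = ((g \<cdot> f) \<boxtimes> (g' \<cdot> f')) \<cdot> h"
  by (rule cmp_extend1[OF tena_fold]) auto

lemma tena_iso:
  assumes "f \<in> isos A a b" "g \<in> isos A c d"
  shows "f \<boxtimes> g \<in> isos A (a \<otimes> c) (b \<otimes> d)"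
  by (rule isosI(1)[of _ "inv_arr A f \<boxtimes> inv_arr A g"])
    (use iso_facts[OF assms(1)] iso_facts[OF assms(2)] in \<open>auto simp: tena_fold\<close>)

lemma ass_nat:
  "f \<in> arr A \<Longrightarrow> g \<in> arr A \<Longrightarrow> h \<in> arr A \<Longrightarrow>
   ass A (tgt A f) (tgt A g) (tgt A h) \<cdot> (f \<boxtimes> (g \<boxtimes> h)) =
   ((f \<boxtimes> g) \<boxtimes> h) \<cdot> ass A (src A f) (src A g) (src A h)"
  by (rule ass_natural) (auto simp: hom_def)

abbreviation "asi a b c \<equiv> inv_arr A (ass A a b c)"

lemma asi_nat:
  assumes "f \<in> arr A" "g \<in> arr A" "h \<in> arr A"
  shows "asi (tgt A f) (tgt A g) (tgt A h) \<cdot> ((f \<boxtimes> g) \<boxtimes> h) =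
    (f \<boxtimes> (g \<boxtimes> h)) \<cdot> asi (src A f) (src A g) (src A h)"
proof (rule iso_cancel_left[OF ass_iso])
  let ?a = "ass A (tgt A f) (tgt A g) (tgt A h)"
  have "?a \<cdot> (f \<boxtimes> (g \<boxtimes> h)) \<cdot> asi (src A f) (src A g) (src A h) =
    ((f \<boxtimes> g) \<boxtimes> h) \<cdot> ass A (src A f) (src A g) (src A h) \<cdot> asi (src A f) (src A g) (src A h)"
    by (rule cmp_extend[OF ass_nat]) (use assms in auto)
  also have "\<dots> = ?a \<cdot> asi (tgt A f) (tgt A g) (tgt A h) \<cdot> ((f \<boxtimes> g) \<boxtimes> h)"
    using assms by (simp flip: assoc)
  finally show "?a \<cdot> asi (tgt A f) (tgt A g) (tgt A h) \<cdot> ((f \<boxtimes> g) \<boxtimes> h) =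
     ?a \<cdot> (f \<boxtimes> (g \<boxtimes> h)) \<cdot> asi (src A f) (src A g) (src A h)" by simp
qed (use assms in auto)

lemma lun_nat: "f \<in> arr A \<Longrightarrow> lun A (tgt A f) \<cdot> (idn A (un A) \<boxtimes> f) = f \<cdot> lun A (src A f)"
  by (rule lun_natural) (auto simp: hom_def)

lemma run_nat: "f \<in> arr A \<Longrightarrow> run A (tgt A f) \<cdot> (f \<boxtimes> idn A (un A)) = f \<cdot> run A (src A f)"
  by (rule run_natural) (auto simp: hom_def)

lemma swp_nat:
  "f \<in> arr A \<Longrightarrow> g \<in> arr A \<Longrightarrow>
   swp A (tgt A f) (tgt A g) \<cdot> (f \<boxtimes> g) = (g \<boxtimes> f) \<cdot> swp A (src A f) (src A g)"
  by (rule swp_natural) (auto simp: hom_def)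

lemma run_faithful:
  assumes "f \<boxtimes> idn A (un A) = g \<boxtimes> idn A (un A)" "f \<in> arr A" "g \<in> arr A"
    "src A f = src A g" "tgt A f = tgt A g"
  shows "f = g"
  by (rule iso_cancel_right[OF run_iso[of "src A f"]]) (use assms run_nat[of f] run_nat[of g] in auto)

lemma lun_faithful:
  assumes "idn A (un A) \<boxtimes> f = idn A (un A) \<boxtimes> g" "f \<in> arr A" "g \<in> arr A"
    "src A f = src A g" "tgt A f = tgt A g"
  shows "f = g"
  by (rule iso_cancel_right[OF lun_iso[of "src A f"]]) (use assms lun_nat[of f] lun_nat[of g] in auto)

text \<open>Kelly's argument. Tensoring with the unit on the left is faithful, so it suffices to compare the
  two sides after that; there the pentagon at \<open>I, I, a, b\<close> and the triangle identify them.\<close>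

lemma lun_ten:
  assumes [simp]: "a \<in> obj A" "b \<in> obj A"
  shows "(lun A a \<boxtimes> idn A b) \<cdot> ass A (un A) a b = lun A (a \<otimes> b)"
proof (rule lun_faithful)
  let ?I = "un A"
  let ?k = "(run A ?I \<boxtimes> idn A a) \<boxtimes> idn A b"
  have t: "(run A x \<boxtimes> idn A y) \<cdot> ass A x ?I y = idn A x \<boxtimes> lun A y"
    if "x \<in> obj A" "y \<in> obj A" for x y using triangle that by auto
  have p: "ass A (?I \<otimes> ?I) a b \<cdot> ass A ?I ?I (a \<otimes> b) =
    (ass A ?I ?I a \<boxtimes> idn A b) \<cdot> ass A ?I (?I \<otimes> a) b \<cdot> (idn A ?I \<boxtimes> ass A ?I a b)"
    by (rule pentagon) auto
  have "ass A ?I a b \<cdot> (idn A ?I \<boxtimes> lun A (a \<otimes> b)) =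
      ass A ?I a b \<cdot> (run A ?I \<boxtimes> (idn A a \<boxtimes> idn A b)) \<cdot> ass A ?I ?I (a \<otimes> b)"
    by (simp flip: t)
  also have "\<dots> = ?k \<cdot> ass A (?I \<otimes> ?I) a b \<cdot> ass A ?I ?I (a \<otimes> b)"
    using cmp_extend[OF ass_nat[of "run A ?I" "idn A a" "idn A b"], of "ass A ?I ?I (a \<otimes> b)"] by simp
  also have "\<dots> = (((run A ?I \<boxtimes> idn A a) \<cdot> ass A ?I ?I a) \<boxtimes> idn A b)
      \<cdot> ass A ?I (?I \<otimes> a) b \<cdot> (idn A ?I \<boxtimes> ass A ?I a b)"
    unfolding p by (simp add: tena_fold2)
  also have "\<dots> = ((idn A ?I \<boxtimes> lun A a) \<boxtimes> idn A b)
      \<cdot> ass A ?I (?I \<otimes> a) b \<cdot> (idn A ?I \<boxtimes> ass A ?I a b)"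
    by (simp add: t)
  also have "\<dots> = ass A ?I a b \<cdot> (idn A ?I \<boxtimes> (lun A a \<boxtimes> idn A b)) \<cdot> (idn A ?I \<boxtimes> ass A ?I a b)"
    using cmp_extend[OF ass_nat[of "idn A ?I" "lun A a" "idn A b", symmetric], of "idn A ?I \<boxtimes> ass A ?I a b"]
    by simp
  also have "\<dots> = ass A ?I a b \<cdot> (idn A ?I \<boxtimes> ((lun A a \<boxtimes> idn A b) \<cdot> ass A ?I a b))"
    by (simp add: tena_fold)
  finally have e: "ass A ?I a b \<cdot> (idn A ?I \<boxtimes> lun A (a \<otimes> b)) =
      ass A ?I a b \<cdot> (idn A ?I \<boxtimes> ((lun A a \<boxtimes> idn A b) \<cdot> ass A ?I a b))" .
  show "idn A ?I \<boxtimes> ((lun A a \<boxtimes> idn A b) \<cdot> ass A ?I a b) = idn A ?I \<boxtimes> lun A (a \<otimes> b)"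
    by (rule iso_cancel_left[OF ass_iso e[symmetric]]) auto
qed auto

lemma pentagon_inv:
  assumes [simp]: "a \<in> obj A" "b \<in> obj A" "c \<in> obj A" "d \<in> obj A"
  shows "asi a b (c \<otimes> d) \<cdot> asi (a \<otimes> b) c d \<cdot> (ass A a b c \<boxtimes> idn A d) =
    (idn A a \<boxtimes> asi b c d) \<cdot> asi a (b \<otimes> c) d"
proof -
  have i: "ass A a (b \<otimes> c) d \<cdot> (idn A a \<boxtimes> ass A b c d) \<in> isos A (a \<otimes> (b \<otimes> (c \<otimes> d))) ((a \<otimes> (b \<otimes> c)) \<otimes> d)"
    by (rule iso_cmp[OF tena_iso[OF idn_iso ass_iso] ass_iso]) auto
  show ?thesis
  proof (rule iso_cancel_right[OF i])
    have "(asi a b (c \<otimes> d) \<cdot> asi (a \<otimes> b) c d \<cdot> (ass A a b c \<boxtimes> idn A d)) \<cdot> (ass A a (b \<otimes> c) d \<cdot> (idn A a \<boxtimes> ass A b c d))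
      = asi a b (c \<otimes> d) \<cdot> asi (a \<otimes> b) c d \<cdot> ass A (a \<otimes> b) c d \<cdot> ass A a b (c \<otimes> d)"
      by (simp add: pentagon)
    also have "\<dots> = idn A (a \<otimes> (b \<otimes> (c \<otimes> d)))"
      using cmp_extend1[of "asi (a \<otimes> b) c d" "ass A (a \<otimes> b) c d" _ "ass A a b (c \<otimes> d)"] by simp
    also have "\<dots> = ((idn A a \<boxtimes> asi b c d) \<cdot> asi a (b \<otimes> c) d) \<cdot> (ass A a (b \<otimes> c) d \<cdot> (idn A a \<boxtimes> ass A b c d))"
      using cmp_extend1[of "asi a (b \<otimes> c) d" "ass A a (b \<otimes> c) d" _ "idn A a \<boxtimes> ass A b c d"] by (simp add: tena_fold)
    finally show "(asi a b (c \<otimes> d) \<cdot> asi (a \<otimes> b) c d \<cdot> (ass A a b c \<boxtimes> idn A d)) \<cdot> (ass A a (b \<otimes> c) d \<cdot> (idn A a \<boxtimes> ass A b c d)) = ((idn A a \<boxtimes> asi b c d) \<cdot> asi a (b \<otimes> c) d) \<cdot> (ass A a (b \<otimes> c) d \<cdot> (idn A a \<boxtimes> ass A b c d))" .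
  qed auto
qed

end

section \<open>Words of objects and their action\<close>

text \<open>A word is a bracketing of a list of objects, possibly with units. It keeps apart the different
  ways in which one and the same object may arise as a product.\<close>

datatype 'o word = Atom 'o | Unit | Node "'o word" "'o word"

context symm_mon_category begin

text \<open>The symmetry of two neighbouring factors of a right-nested product, with the rest \<open>d\<close> of the
  product behind them. The interchange is such a transposition up to associativity.\<close>

definition mid :: "'o \<Rightarrow> 'o \<Rightarrow> 'o \<Rightarrow> 'm" where
  "mid b c d = asi c b d \<cdot> (swp A b c \<boxtimes> idn A d) \<cdot> ass A b c d"

lemma mid_facts [simp]:
  assumes "b \<in> obj A" "c \<in> obj A" "d \<in> obj A"
  shows "mid b c d \<in> arr A" "src A (mid b c d) = b \<otimes> (c \<otimes> d)" "tgt A (mid b c d) = c \<otimes> (b \<otimes> d)"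
  using assms by (simp_all add: mid_def)

lemma mid_nat:
  assumes "f \<in> arr A" "g \<in> arr A" "h \<in> arr A"
  shows "mid (tgt A f) (tgt A g) (tgt A h) \<cdot> (f \<boxtimes> (g \<boxtimes> h)) =
    (g \<boxtimes> (f \<boxtimes> h)) \<cdot> mid (src A f) (src A g) (src A h)"
proof -
  let ?x = "src A f" and ?y = "src A g" and ?z = "src A h"
  let ?x' = "tgt A f" and ?y' = "tgt A g" and ?z' = "tgt A h"
  have "mid ?x' ?y' ?z' \<cdot> (f \<boxtimes> (g \<boxtimes> h)) =
    asi ?y' ?x' ?z' \<cdot> (swp A ?x' ?y' \<boxtimes> idn A ?z') \<cdot> ((f \<boxtimes> g) \<boxtimes> h) \<cdot> ass A ?x ?y ?z"
    unfolding mid_def using assms ass_nat by simp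
  also have "\<dots> = asi ?y' ?x' ?z' \<cdot> ((g \<boxtimes> f) \<boxtimes> h) \<cdot> (swp A ?x ?y \<boxtimes> idn A ?z) \<cdot> ass A ?x ?y ?z"
    using assms by (simp add: tena_fold2 swp_nat)
  also have "\<dots> = (g \<boxtimes> (f \<boxtimes> h)) \<cdot> asi ?y ?x ?z \<cdot> (swp A ?x ?y \<boxtimes> idn A ?z) \<cdot> ass A ?x ?y ?z"
    by (rule cmp_extend[OF asi_nat]) (use assms in auto)
  finally show ?thesis by (simp add: mid_def)
qed

lemma mid_mid:
  assumes [simp]: "b \<in> obj A" "c \<in> obj A" "d \<in> obj A"
  shows "mid c b d \<cdot> mid b c d = idn A (b \<otimes> (c \<otimes> d))"
proof -
  have "mid c b d \<cdot> mid b c d =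
    asi b c d \<cdot> (swp A c b \<boxtimes> idn A d) \<cdot> (ass A c b d \<cdot> asi c b d \<cdot> (swp A b c \<boxtimes> idn A d) \<cdot> ass A b c d)"
    by (simp add: mid_def)
  also have "ass A c b d \<cdot> asi c b d \<cdot> (swp A b c \<boxtimes> idn A d) \<cdot> ass A b c d = (swp A b c \<boxtimes> idn A d) \<cdot> ass A b c d"
    using cmp_extend1[of "ass A c b d" "asi c b d" _ "(swp A b c \<boxtimes> idn A d) \<cdot> ass A b c d"] by simp
  finally show ?thesis by (simp add: tena_fold2 swp_swp)
qed

lemma interchange_mid:
  assumes "a \<in> obj A" "b \<in> obj A" "c \<in> obj A" "d \<in> obj A"
  shows "interchange A a b c d = ass A a c (b \<otimes> d) \<cdot> (idn A a \<boxtimes> mid b c d) \<cdot> asi a b (c \<otimes> d)"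
  unfolding interchange_def mid_def using assms by (simp add: tena_fold2)

lemma interchange_facts [simp]:
  assumes "a \<in> obj A" "b \<in> obj A" "c \<in> obj A" "d \<in> obj A"
  shows "interchange A a b c d \<in> arr A"
    "src A (interchange A a b c d) = (a \<otimes> b) \<otimes> (c \<otimes> d)"
    "tgt A (interchange A a b c d) = (a \<otimes> c) \<otimes> (b \<otimes> d)"
  using assms by (simp_all add: interchange_mid)

lemma interchange_nat:
  assumes "f \<in> arr A" "g \<in> arr A" "h \<in> arr A" "k \<in> arr A"
  shows "interchange A (tgt A f) (tgt A g) (tgt A h) (tgt A k) \<cdot> ((f \<boxtimes> g) \<boxtimes> (h \<boxtimes> k)) =
    ((f \<boxtimes> h) \<boxtimes> (g \<boxtimes> k)) \<cdot> interchange A (src A f) (src A g) (src A h) (src A k)"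
    (is "?l = ?r")
proof -
  let ?x = "src A f" and ?y = "src A g" and ?z = "src A h" and ?w = "src A k"
  let ?x' = "tgt A f" and ?y' = "tgt A g" and ?z' = "tgt A h" and ?w' = "tgt A k"
  have "?l = ass A ?x' ?z' (?y' \<otimes> ?w') \<cdot> (idn A ?x' \<boxtimes> mid ?y' ?z' ?w') \<cdot> (f \<boxtimes> (g \<boxtimes> (h \<boxtimes> k))) \<cdot> asi ?x ?y (?z \<otimes> ?w)"
    using assms asi_nat[of f g "h \<boxtimes> k"] by (simp add: interchange_mid)
  also have "\<dots> = ass A ?x' ?z' (?y' \<otimes> ?w') \<cdot> (f \<boxtimes> (h \<boxtimes> (g \<boxtimes> k))) \<cdot> (idn A ?x \<boxtimes> mid ?y ?z ?w) \<cdot> asi ?x ?y (?z \<otimes> ?w)"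
    using assms by (simp add: tena_fold2 mid_nat)
  also have "\<dots> = ((f \<boxtimes> h) \<boxtimes> (g \<boxtimes> k)) \<cdot> ass A ?x ?z (?y \<otimes> ?w) \<cdot> (idn A ?x \<boxtimes> mid ?y ?z ?w) \<cdot> asi ?x ?y (?z \<otimes> ?w)"
    using cmp_extend[OF ass_nat[of f h "g \<boxtimes> k"], of "(idn A ?x \<boxtimes> mid ?y ?z ?w) \<cdot> asi ?x ?y (?z \<otimes> ?w)"] assms by simp
  finally show ?thesis using assms by (simp add: interchange_mid)
qed

text \<open>A word \<open>t\<close> with factors \<open>a\<^sub>1, \<dots>, a\<^sub>n\<close> acts on objects by \<open>z \<mapsto> a\<^sub>1 \<otimes> (\<dots> \<otimes> (a\<^sub>n \<otimes> z))\<close>. This depends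
  only on the list of its factors, and the isomorphism \<open>flatten t z\<close> compares it with tensoring by
  the product of the word.\<close>

primrec word_obj :: "'o word \<Rightarrow> 'o" where
  "word_obj (Atom a) = a"
| "word_obj Unit = un A"
| "word_obj (Node t u) = word_obj t \<otimes> word_obj u"

primrec act_obj :: "'o word \<Rightarrow> 'o \<Rightarrow> 'o" where
  "act_obj (Atom a) z = a \<otimes> z"
| "act_obj Unit z = z"
| "act_obj (Node t u) z = act_obj t (act_obj u z)"

primrec act_arr :: "'o word \<Rightarrow> 'm \<Rightarrow> 'm" where
  "act_arr (Atom a) h = idn A a \<boxtimes> h"
| "act_arr Unit h = h"
| "act_arr (Node t u) h = act_arr t (act_arr u h)"

primrec flatten :: "'o word \<Rightarrow> 'o \<Rightarrow> 'm" where
  "flatten (Atom a) z = idn A (a \<otimes> z)"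
| "flatten Unit z = lun A z"
| "flatten (Node t u) z = flatten t (act_obj u z) \<cdot> (idn A (word_obj t) \<boxtimes> flatten u z) \<cdot> asi (word_obj t) (word_obj u) z"

abbreviation "over t \<equiv> set_word t \<subseteq> obj A"

lemma word_obj_obj [simp]: "over t \<Longrightarrow> word_obj t \<in> obj A"
  by (induction t) auto

lemma act_obj_obj [simp]: "over t \<Longrightarrow> z \<in> obj A \<Longrightarrow> act_obj t z \<in> obj A"
  by (induction t arbitrary: z) auto

lemma act_arr_facts [simp]:
  "over t \<Longrightarrow> h \<in> arr A \<Longrightarrow> act_arr t h \<in> arr A"
  "over t \<Longrightarrow> h \<in> arr A \<Longrightarrow> src A (act_arr t h) = act_obj t (src A h)"
  "over t \<Longrightarrow> h \<in> arr A \<Longrightarrow> tgt A (act_arr t h) = act_obj t (tgt A h)"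
  by (induction t arbitrary: h) auto

lemma act_arr_idn [simp]: "over t \<Longrightarrow> z \<in> obj A \<Longrightarrow> act_arr t (idn A z) = idn A (act_obj t z)"
  by (induction t arbitrary: z) auto

lemma flatten_iso: "over t \<Longrightarrow> z \<in> obj A \<Longrightarrow> flatten t z \<in> isos A (word_obj t \<otimes> z) (act_obj t z)"
proof (induction t arbitrary: z)
  case (Node t u)
  then show ?case
    by (auto intro!: iso_cmp[OF iso_cmp[OF iso_inv[OF ass_iso] tena_iso[OF idn_iso]], simplified] simp del: assoc)
qed (auto intro: idn_iso lun_iso)

lemmas flatten_facts [simp] = iso_facts(1-3,6-10)[OF flatten_iso]

lemma flatten_nat:
  "over t \<Longrightarrow> h \<in> arr A \<Longrightarrow>
    flatten t (tgt A h) \<cdot> (idn A (word_obj t) \<boxtimes> h) = act_arr t h \<cdot> flatten t (src A h)"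
proof (induction t arbitrary: h)
  case (Node t u)
  have [simp]: "over t" "over u" "h \<in> arr A" using Node.prems by auto
  let ?x = "src A h" and ?y = "tgt A h" and ?a = "asi (word_obj t) (word_obj u) (src A h)"
  have "flatten (Node t u) ?y \<cdot> (idn A (word_obj (Node t u)) \<boxtimes> h) =
      flatten t (act_obj u ?y) \<cdot> (idn A (word_obj t) \<boxtimes> flatten u ?y) \<cdot> (idn A (word_obj t) \<boxtimes> (idn A (word_obj u) \<boxtimes> h)) \<cdot> ?a"
    using asi_nat[of "idn A (word_obj t)" "idn A (word_obj u)" h] by simp
  also have "\<dots> = flatten t (act_obj u ?y) \<cdot> (idn A (word_obj t) \<boxtimes> act_arr u h) \<cdot> (idn A (word_obj t) \<boxtimes> flatten u ?x) \<cdot> ?a"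
    by (simp add: tena_fold2 Node.IH)
  also have "\<dots> = act_arr t (act_arr u h) \<cdot> flatten t (act_obj u ?x) \<cdot> (idn A (word_obj t) \<boxtimes> flatten u ?x) \<cdot> ?a"
    using cmp_extend[OF Node.IH(1)[of "act_arr u h"], of "(idn A (word_obj t) \<boxtimes> flatten u ?x) \<cdot> ?a"] by simp
  finally show ?case by simp
qed (auto simp: lun_nat)

text \<open>The arrow \<open>f\<close> between the products of two words is represented by the family \<open>g\<close> if \<open>f \<otimes> z\<close> becomes
  \<open>g z\<close> after both sides are flattened. The family lives in a strict setting:
  rebracketing and unit arrows are represented by identities.\<close>

definition acts :: "'o word \<Rightarrow> 'o word \<Rightarrow> 'm \<Rightarrow> ('o \<Rightarrow> 'm) \<Rightarrow> bool" where
  "acts t u f g \<longleftrightarrow> over t \<and> over u \<and> f \<in> hom A (word_obj t) (word_obj u) \<and>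
     (\<forall>z\<in>obj A. g z \<in> hom A (act_obj t z) (act_obj u z) \<and> flatten u z \<cdot> (f \<boxtimes> idn A z) = g z \<cdot> flatten t z)"

lemma actsD:
  assumes "acts t u f g"
  shows "over t" "over u" "f \<in> arr A" "src A f = word_obj t" "tgt A f = word_obj u"
    "z \<in> obj A \<Longrightarrow> g z \<in> arr A" "z \<in> obj A \<Longrightarrow> src A (g z) = act_obj t z" "z \<in> obj A \<Longrightarrow> tgt A (g z) = act_obj u z"
    "z \<in> obj A \<Longrightarrow> flatten u z \<cdot> (f \<boxtimes> idn A z) = g z \<cdot> flatten t z"
  using assms by (auto simp: acts_def hom_def)

lemma actsI:
  assumes "over t" "over u" "f \<in> arr A" "src A f = word_obj t" "tgt A f = word_obj u"
    "\<And>z. z \<in> obj A \<Longrightarrow> g z \<in> arr A \<and> src A (g z) = act_obj t z \<and> tgt A (g z) = act_obj u z"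
    "\<And>z. z \<in> obj A \<Longrightarrow> flatten u z \<cdot> (f \<boxtimes> idn A z) = g z \<cdot> flatten t z"
  shows "acts t u f g"
  using assms by (auto simp: acts_def hom_def)

text \<open>Tensoring with the unit on the right is faithful and flattening is invertible, so the value of the
  representing family at the unit determines the arrow. This reduces an equation between canonical
  arrows to an equation between composites of transpositions.\<close>

lemma acts_unique:
  assumes "acts t u f g" "acts t u f' g'" "g (un A) = g' (un A)"
  shows "f = f'"
proof (rule run_faithful)
  note d = actsD[OF assms(1)] actsD[OF assms(2)]
  show "f \<boxtimes> idn A (un A) = f' \<boxtimes> idn A (un A)"
    by (rule iso_cancel_left[OF flatten_iso[of u "un A"]]) (use d assms(3) in auto)
qed (use actsD[OF assms(1)] actsD[OF assms(2)] in auto)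

lemma acts_cong:
  assumes "acts t u f g" "\<And>z. z \<in> obj A \<Longrightarrow> g z = g' z"
  shows "acts t u f g'"
  using assms by (auto simp: acts_def)

lemma acts_idn: "over t \<Longrightarrow> acts t t (idn A (word_obj t)) (\<lambda>z. idn A (act_obj t z))"
  by (rule actsI) auto

lemma acts_cmp:
  assumes "acts t u f g" "acts u v f' g'"
  shows "acts t v (f' \<cdot> f) (\<lambda>z. g' z \<cdot> g z)"
proof (rule actsI)
  note d [simp] = actsD[OF assms(1)] actsD[OF assms(2)]
  fix z assume [simp]: "z \<in> obj A"
  have "flatten v z \<cdot> ((f' \<cdot> f) \<boxtimes> idn A z) = flatten v z \<cdot> (f' \<boxtimes> idn A z) \<cdot> (f \<boxtimes> idn A z)"
    by (simp add: tena_fold)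
  also have "\<dots> = g' z \<cdot> flatten u z \<cdot> (f \<boxtimes> idn A z)"
    by (rule cmp_extend) auto
  finally show "flatten v z \<cdot> ((f' \<cdot> f) \<boxtimes> idn A z) = (g' z \<cdot> g z) \<cdot> flatten t z" by simp
qed (use actsD[OF assms(1)] actsD[OF assms(2)] in auto)

text \<open>A tensor product acts in two stages: the second factor acts first, below the factors of
  the first word, and the first factor then acts on the result.\<close>

lemma acts_tena:
  assumes "acts t u f g" "acts t' u' f' g'"
  shows "acts (Node t t') (Node u u') (f \<boxtimes> f') (\<lambda>z. g (act_obj u' z) \<cdot> act_arr t (g' z))"
proof (rule actsI)
  note d [simp] = actsD(1-8)[OF assms(1)] actsD(1-8)[OF assms(2)]
  fix z assume [simp]: "z \<in> obj A"
  let ?a = "asi (word_obj t) (word_obj t') z"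
  have "flatten (Node u u') z \<cdot> ((f \<boxtimes> f') \<boxtimes> idn A z) =
    flatten u (act_obj u' z) \<cdot> (idn A (word_obj u) \<boxtimes> flatten u' z) \<cdot> (f \<boxtimes> (f' \<boxtimes> idn A z)) \<cdot> ?a"
    using asi_nat[of f f' "idn A z"] by simp
  also have "\<dots> = flatten u (act_obj u' z) \<cdot> (f \<boxtimes> idn A (act_obj u' z)) \<cdot> (idn A (word_obj t) \<boxtimes> (g' z \<cdot> flatten t' z)) \<cdot> ?a"
    using actsD(9)[OF assms(2), of z] by (simp add: tena_fold2)
  also have "\<dots> = g (act_obj u' z) \<cdot> flatten t (act_obj u' z) \<cdot> (idn A (word_obj t) \<boxtimes> (g' z \<cdot> flatten t' z)) \<cdot> ?a"
    by (rule cmp_extend[OF actsD(9)[OF assms(1)]]) auto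
  also have "\<dots> = g (act_obj u' z) \<cdot> flatten t (act_obj u' z) \<cdot> (idn A (word_obj t) \<boxtimes> g' z) \<cdot> (idn A (word_obj t) \<boxtimes> flatten t' z) \<cdot> ?a"
    by (simp add: tena_fold2)
  also have "flatten t (act_obj u' z) \<cdot> (idn A (word_obj t) \<boxtimes> g' z) \<cdot> (idn A (word_obj t) \<boxtimes> flatten t' z) \<cdot> ?a =
     act_arr t (g' z) \<cdot> flatten t (act_obj t' z) \<cdot> (idn A (word_obj t) \<boxtimes> flatten t' z) \<cdot> ?a"
    using cmp_extend[OF flatten_nat[of t "g' z"], of "(idn A (word_obj t) \<boxtimes> flatten t' z) \<cdot> ?a"] by simp
  finally show "flatten (Node u u') z \<cdot> ((f \<boxtimes> f') \<boxtimes> idn A z) =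
    (g (act_obj u' z) \<cdot> act_arr t (g' z)) \<cdot> flatten (Node t t') z" by simp
qed (use actsD(1-8)[OF assms(1)] actsD(1-8)[OF assms(2)] in auto)

lemma acts_inv:
  assumes "acts t u f g" "f \<in> isos A (word_obj t) (word_obj u)"
    "\<And>z. z \<in> obj A \<Longrightarrow> g' z \<in> arr A \<and> src A (g' z) = act_obj u z \<and> tgt A (g' z) = act_obj t z \<and>
       g' z \<cdot> g z = idn A (act_obj t z)"
  shows "acts u t (inv_arr A f) g'"
proof (rule actsI)
  note d [simp] = actsD(1-8)[OF assms(1)] and i [simp] = iso_facts[OF assms(2)]
  fix z assume z [simp]: "z \<in> obj A"
  note g [simp] = assms(3)[OF z]
  let ?k = "inv_arr A f \<boxtimes> idn A z"
  have "g' z \<cdot> flatten u z = g' z \<cdot> flatten u z \<cdot> (f \<boxtimes> idn A z) \<cdot> ?k" by (simp add: tena_fold)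
  also have "flatten u z \<cdot> (f \<boxtimes> idn A z) \<cdot> ?k = g z \<cdot> flatten t z \<cdot> ?k"
    by (rule cmp_extend[OF actsD(9)[OF assms(1)]]) auto
  also have "g' z \<cdot> g z \<cdot> flatten t z \<cdot> ?k = flatten t z \<cdot> ?k"
    using cmp_extend1[of "g' z" "g z" _ "flatten t z \<cdot> ?k"] by simp
  finally show "flatten t z \<cdot> ?k = g' z \<cdot> flatten u z" by simp
qed (use actsD[OF assms(1)] iso_facts[OF assms(2)] assms(3) in auto)

text \<open>This is the pentagon, read as compatibility of flattening with rebracketing.\<close>

lemma acts_ass:
  assumes [simp]: "over t" "over u" "over v"
  shows "acts (Node t (Node u v)) (Node (Node t u) v) (ass A (word_obj t) (word_obj u) (word_obj v))
    (\<lambda>z. idn A (act_obj t (act_obj u (act_obj v z))))"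
proof (rule actsI)
  fix z assume [simp]: "z \<in> obj A"
  let ?t = "word_obj t" and ?u = "word_obj u" and ?v = "word_obj v"
  let ?V = "act_obj v z" and ?U = "act_obj u (act_obj v z)"
  have "flatten (Node (Node t u) v) z \<cdot> (ass A ?t ?u ?v \<boxtimes> idn A z) =
     flatten t ?U \<cdot> (idn A ?t \<boxtimes> flatten u ?V) \<cdot> (asi ?t ?u ?V \<cdot> ((idn A ?t \<boxtimes> idn A ?u) \<boxtimes> flatten v z)
      \<cdot> asi (?t \<otimes> ?u) ?v z \<cdot> (ass A ?t ?u ?v \<boxtimes> idn A z))"
    by simp
  also have "asi ?t ?u ?V \<cdot> ((idn A ?t \<boxtimes> idn A ?u) \<boxtimes> flatten v z) \<cdot> asi (?t \<otimes> ?u) ?v z \<cdot> (ass A ?t ?u ?v \<boxtimes> idn A z)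
    = (idn A ?t \<boxtimes> (idn A ?u \<boxtimes> flatten v z)) \<cdot> asi ?t ?u (?v \<otimes> z) \<cdot> asi (?t \<otimes> ?u) ?v z \<cdot> (ass A ?t ?u ?v \<boxtimes> idn A z)"
    using cmp_extend[OF asi_nat[of "idn A ?t" "idn A ?u" "flatten v z"],
        of "asi (?t \<otimes> ?u) ?v z \<cdot> (ass A ?t ?u ?v \<boxtimes> idn A z)"] by simp
  also have "asi ?t ?u (?v \<otimes> z) \<cdot> asi (?t \<otimes> ?u) ?v z \<cdot> (ass A ?t ?u ?v \<boxtimes> idn A z) =
     (idn A ?t \<boxtimes> asi ?u ?v z) \<cdot> asi ?t (?u \<otimes> ?v) z"
    by (rule pentagon_inv) auto
  finally show "flatten (Node (Node t u) v) z \<cdot> (ass A ?t ?u ?v \<boxtimes> idn A z) =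
      idn A (act_obj t (act_obj u (act_obj v z))) \<cdot> flatten (Node t (Node u v)) z"
    by (simp add: tena_fold2)
qed auto

text \<open>For the left unit this is Kelly's lemma; for the right unit below it is the triangle.\<close>

lemma acts_lun:
  assumes [simp]: "over t"
  shows "acts (Node Unit t) t (lun A (word_obj t)) (\<lambda>z. idn A (act_obj t z))"
proof (rule actsI)
  fix z assume [simp]: "z \<in> obj A"
  have "flatten (Node Unit t) z = flatten t z \<cdot> lun A (word_obj t \<otimes> z) \<cdot> asi (un A) (word_obj t) z"
    using cmp_extend[OF lun_nat[of "flatten t z"], of "asi (un A) (word_obj t) z"] by simp
  also have "lun A (word_obj t \<otimes> z) \<cdot> asi (un A) (word_obj t) z = lun A (word_obj t) \<boxtimes> idn A z"
    by (simp flip: lun_ten)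
  finally show "flatten t z \<cdot> (lun A (word_obj t) \<boxtimes> idn A z) = idn A (act_obj t z) \<cdot> flatten (Node Unit t) z"
    by simp
qed auto

lemma acts_run:
  assumes [simp]: "over t"
  shows "acts (Node t Unit) t (run A (word_obj t)) (\<lambda>z. idn A (act_obj t z))"
proof (rule actsI)
  fix z assume [simp]: "z \<in> obj A"
  have "(idn A (word_obj t) \<boxtimes> lun A z) \<cdot> asi (word_obj t) (un A) z = run A (word_obj t) \<boxtimes> idn A z"
    by (simp flip: triangle)
  then show "flatten t z \<cdot> (run A (word_obj t) \<boxtimes> idn A z) = idn A (act_obj t z) \<cdot> flatten (Node t Unit) z"
    by simp
qed auto

lemma acts_swp_atoms:
  assumes [simp]: "a \<in> obj A" "b \<in> obj A"
  shows "acts (Node (Atom a) (Atom b)) (Node (Atom b) (Atom a)) (swp A a b) (mid a b)"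
  by (rule actsI) (auto simp: mid_def)

lemma swp_inv: "a \<in> obj A \<Longrightarrow> b \<in> obj A \<Longrightarrow> inv_arr A (swp A a b) = swp A b a"
  by (rule isosI(2)) (auto simp: swp_swp)

lemma acts_swp_sym:
  assumes "acts (Node t u) (Node u t) (swp A (word_obj t) (word_obj u)) g"
    "\<And>z. z \<in> obj A \<Longrightarrow> g' z \<in> arr A \<and> src A (g' z) = act_obj u (act_obj t z) \<and> tgt A (g' z) = act_obj t (act_obj u z) \<and>
       g' z \<cdot> g z = idn A (act_obj t (act_obj u z))"
  shows "acts (Node u t) (Node t u) (swp A (word_obj u) (word_obj t)) g'"
proof -
  have "over t" "over u" using actsD(1)[OF assms(1)] by auto
  then show ?thesis using acts_inv[OF assms(1), of g'] assms(2) by (simp add: swp_iso swp_inv)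
qed

lemma acts_asi:
  assumes [simp]: "over t" "over u" "over v"
  shows "acts (Node (Node t u) v) (Node t (Node u v)) (asi (word_obj t) (word_obj u) (word_obj v))
    (\<lambda>z. idn A (act_obj t (act_obj u (act_obj v z))))"
  by (rule acts_inv[OF acts_ass]) (auto intro: ass_iso)

lemma swp_ten_left:
  assumes [simp]: "a \<in> obj A" "b \<in> obj A" "c \<in> obj A"
  shows "swp A (a \<otimes> b) c =
    asi c a b \<cdot> ((swp A a c \<boxtimes> idn A b) \<cdot> ass A a c b \<cdot> (idn A a \<boxtimes> swp A b c)) \<cdot> asi a b c"
proof -
  have "asi c a b \<cdot> ((swp A a c \<boxtimes> idn A b) \<cdot> ass A a c b \<cdot> (idn A a \<boxtimes> swp A b c)) \<cdot> asi a b c =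
    asi c a b \<cdot> (ass A c a b \<cdot> swp A (a \<otimes> b) c \<cdot> ass A a b c) \<cdot> asi a b c"
    by (simp only: hexagon assms)
  also have "\<dots> = swp A (a \<otimes> b) c"
    using cmp_extend1[of "asi c a b" "ass A c a b" _ "swp A (a \<otimes> b) c"] by simp
  finally show ?thesis by simp
qed

text \<open>The hexagon: a product is moved past \<open>v\<close> one factor at a time, the last factor first.\<close>

lemma acts_swp_ten:
  assumes s: "acts (Node t v) (Node v t) (swp A (word_obj t) (word_obj v)) g"
    and s': "acts (Node u v) (Node v u) (swp A (word_obj u) (word_obj v)) h"
  shows "acts (Node (Node t u) v) (Node v (Node t u)) (swp A (word_obj t \<otimes> word_obj u) (word_obj v))
     (\<lambda>z. g (act_obj u z) \<cdot> act_arr t (h z))"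
proof -
  have o [simp]: "over t" "over u" "over v" using actsD(1)[OF s] actsD(1)[OF s'] by auto
  note d [simp] = actsD(6-8)[OF s] actsD(6-8)[OF s']
  show ?thesis unfolding swp_ten_left[OF word_obj_obj[OF o(1)] word_obj_obj[OF o(2)] word_obj_obj[OF o(3)]]
    by (rule acts_cong[OF acts_cmp[OF acts_cmp[OF acts_asi acts_cmp[OF acts_cmp[OF
          acts_tena[OF acts_idn s'] acts_ass] acts_tena[OF s acts_idn]]] acts_asi]])
      auto
qed

lemma acts_swp_ten_atoms:
  assumes [simp]: "a \<in> obj A" "b \<in> obj A" "c \<in> obj A"
  shows "acts (Node (Node (Atom a) (Atom b)) (Atom c)) (Node (Atom c) (Node (Atom a) (Atom b)))
     (swp A (a \<otimes> b) c) (\<lambda>z. mid a c (b \<otimes> z) \<cdot> (idn A a \<boxtimes> mid b c z))"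
  using acts_swp_ten[of "Atom a" "Atom c" "mid a c" "Atom b" "mid b c"] acts_swp_atoms by simp

lemma acts_swp_atoms_ten:
  assumes [simp]: "a \<in> obj A" "b \<in> obj A" "c \<in> obj A"
  shows "acts (Node (Atom c) (Node (Atom a) (Atom b))) (Node (Node (Atom a) (Atom b)) (Atom c))
     (swp A c (a \<otimes> b)) (\<lambda>z. (idn A a \<boxtimes> mid c b z) \<cdot> mid c a (b \<otimes> z))"
proof -
  have "((idn A a \<boxtimes> mid c b z) \<cdot> mid c a (b \<otimes> z)) \<cdot> (mid a c (b \<otimes> z) \<cdot> (idn A a \<boxtimes> mid b c z)) =
     idn A (a \<otimes> (b \<otimes> (c \<otimes> z)))" if [simp]: "z \<in> obj A" for z
    using cmp_extend1[OF mid_mid[of a c "b \<otimes> z"], of "idn A a \<boxtimes> mid b c z"] by (simp add: tena_fold mid_mid)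
  then show ?thesis
    using acts_swp_sym[of "Node (Atom a) (Atom b)" "Atom c" _
        "\<lambda>z. (idn A a \<boxtimes> mid c b z) \<cdot> mid c a (b \<otimes> z)"] acts_swp_ten_atoms[of a b c] by simp
qed

lemma acts_lun_inv:
  "over t \<Longrightarrow> acts t (Node Unit t) (inv_arr A (lun A (word_obj t))) (\<lambda>z. idn A (act_obj t z))"
  by (rule acts_inv[OF acts_lun]) (auto intro: lun_iso)

text \<open>Moving a unit past a word leaves the list of factors unchanged, and the axiom relating the
  symmetry to the two unit arrows says that it also acts trivially.\<close>

lemma acts_swp_unit:
  assumes [simp]: "over t"
  shows "acts (Node t Unit) (Node Unit t) (swp A (word_obj t) (un A)) (\<lambda>z. idn A (act_obj t z))"
proof -
  have "swp A (word_obj t) (un A) = inv_arr A (lun A (word_obj t)) \<cdot> run A (word_obj t)"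
    using cmp_extend1[of "inv_arr A (lun A (word_obj t))" "lun A (word_obj t)" _ "swp A (word_obj t) (un A)"]
    by (simp flip: lun_swp)
  then show ?thesis
    using acts_cong[OF acts_cmp[OF acts_run acts_lun_inv, OF assms assms], of "\<lambda>z. idn A (act_obj t z)"]
    by simp
qed

lemma acts_unit_swp:
  assumes [simp]: "over t"
  shows "acts (Node Unit t) (Node t Unit) (swp A (un A) (word_obj t)) (\<lambda>z. idn A (act_obj t z))"
  using acts_swp_sym[OF acts_swp_unit[OF assms, unfolded word_obj.simps(2)[symmetric]], of "\<lambda>z. idn A (act_obj t z)"] by simp

text \<open>Among the five arrows that make up the interchange only the symmetry in the middle acts
  nontrivially.\<close>

lemma acts_interchange:
  assumes [simp]: "over t" "over w" and s: "acts (Node u v) (Node v u) (swp A (word_obj u) (word_obj v)) g"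
  shows "acts (Node (Node t u) (Node v w)) (Node (Node t v) (Node u w))
    (interchange A (word_obj t) (word_obj u) (word_obj v) (word_obj w)) (\<lambda>z. act_arr t (g (act_obj w z)))"
proof -
  have o [simp]: "over u" "over v" using actsD(1)[OF s] by auto
  note d [simp] = actsD(6-8)[OF s]
  show ?thesis unfolding interchange_def
    by (rule acts_cong[OF acts_cmp[OF acts_cmp[OF acts_cmp[OF acts_cmp[OF
        acts_asi[of t u "Node v w", unfolded word_obj.simps] acts_tena[OF acts_idn acts_ass]] acts_tena[OF acts_idn acts_tena[OF s acts_idn]]]
        acts_tena[OF acts_idn acts_asi]] acts_ass[of t v "Node u w", unfolded word_obj.simps]]])
      auto
qed

section \<open>Coherence of the interchange\<close>

text \<open>In an equation between arrows the objects are not literally products of words. The following forms of the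
  representation rules therefore leave the recognition of objects as products of words to separate
  equations, so that the rules can be chained by resolution: the source word is
  known, and each rule determines the word reached next.\<close>

lemma acts_idn_at: "over t \<Longrightarrow> x = word_obj t \<Longrightarrow> acts t t (idn A x) (\<lambda>z. idn A (act_obj t z))"
  using acts_idn by auto

lemma acts_ass_at:
  "over t \<Longrightarrow> over u \<Longrightarrow> over v \<Longrightarrow> x = word_obj t \<Longrightarrow> y = word_obj u \<Longrightarrow> w = word_obj v \<Longrightarrow>
   acts (Node t (Node u v)) (Node (Node t u) v) (ass A x y w) (\<lambda>z. idn A (act_obj t (act_obj u (act_obj v z))))"
  using acts_ass by auto

lemma acts_lun_at: "over t \<Longrightarrow> x = word_obj t \<Longrightarrow> acts (Node Unit t) t (lun A x) (\<lambda>z. idn A (act_obj t z))"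
  using acts_lun by auto

lemma acts_lun_inv_at:
  "over t \<Longrightarrow> x = word_obj t \<Longrightarrow> acts t (Node Unit t) (inv_arr A (lun A x)) (\<lambda>z. idn A (act_obj t z))"
  using acts_lun_inv by auto

lemma acts_run_at: "over t \<Longrightarrow> x = word_obj t \<Longrightarrow> acts (Node t Unit) t (run A x) (\<lambda>z. idn A (act_obj t z))"
  using acts_run by auto

lemma acts_swp_unit_at:
  "over t \<Longrightarrow> x = word_obj t \<Longrightarrow> acts (Node t Unit) (Node Unit t) (swp A x (un A)) (\<lambda>z. idn A (act_obj t z))"
  using acts_swp_unit by auto

lemma acts_unit_swp_at:
  "over t \<Longrightarrow> x = word_obj t \<Longrightarrow> acts (Node Unit t) (Node t Unit) (swp A (un A) x) (\<lambda>z. idn A (act_obj t z))"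
  using acts_unit_swp by auto

lemma acts_swp_ten_ten:
  assumes [simp]: "a \<in> obj A" "b \<in> obj A" "c \<in> obj A" "d \<in> obj A"
  shows "acts (Node (Node (Atom a) (Atom b)) (Node (Atom c) (Atom d)))
     (Node (Node (Atom c) (Atom d)) (Node (Atom a) (Atom b))) (swp A (a \<otimes> b) (c \<otimes> d))
     (\<lambda>z. ((idn A c \<boxtimes> mid a d (b \<otimes> z)) \<cdot> mid a c (d \<otimes> (b \<otimes> z))) \<cdot>
        (idn A a \<boxtimes> ((idn A c \<boxtimes> mid b d z) \<cdot> mid b c (d \<otimes> z))))"
  using acts_swp_ten[of "Atom a" "Node (Atom c) (Atom d)" "\<lambda>z. (idn A c \<boxtimes> mid a d z) \<cdot> mid a c (d \<otimes> z)"
     "Atom b" "\<lambda>z. (idn A c \<boxtimes> mid b d z) \<cdot> mid b c (d \<otimes> z)"]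
     acts_swp_atoms_ten[of c d a] acts_swp_atoms_ten[of c d b] by simp

lemma acts_interchange_at:
  assumes "acts (Node u v) (Node v u) (swp A x y) g" "over t" "over w"
    "a = word_obj t" "x = word_obj u" "y = word_obj v" "b = word_obj w"
  shows "acts (Node (Node t u) (Node v w)) (Node (Node t v) (Node u w))
    (interchange A a x y b) (\<lambda>z. act_arr t (g (act_obj w z)))"
  using acts_interchange assms by auto

lemmas acts_rules =
  acts_cmp acts_tena acts_idn_at acts_ass_at acts_lun_at acts_lun_inv_at acts_run_at acts_interchange_at
  acts_swp_unit_at acts_unit_swp_at acts_swp_ten_ten acts_swp_atoms_ten acts_swp_ten_atoms acts_swp_atoms

lemma mid_mid_cmp:
  "b \<in> obj A \<Longrightarrow> c \<in> obj A \<Longrightarrow> d \<in> obj A \<Longrightarrow> h \<in> arr A \<Longrightarrow> tgt A h = b \<otimes> (c \<otimes> d) \<Longrightarrow>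
   mid c b d \<cdot> mid b c d \<cdot> h = h"
  using cmp_extend1[OF mid_mid, of b c d h] by simp

text \<open>The four equations that make a pointwise product of lax functors a symmetric lax functor: the
  interchange is compatible with associativity, units and symmetry across the pairs. In the
  first one the two sides perform the same three transpositions, in an order that differs by
  one use of naturality.\<close>

lemma interchange_ass:
  assumes [simp]: "a \<in> obj A" "b \<in> obj A" "c \<in> obj A" "d \<in> obj A" "e \<in> obj A" "f \<in> obj A"
  shows "interchange A (a \<otimes> c) (b \<otimes> d) e f \<cdot> (interchange A a b c d \<boxtimes> idn A (e \<otimes> f)) \<cdot> ass A (a \<otimes> b) (c \<otimes> d) (e \<otimes> f)
    = (ass A a c e \<boxtimes> ass A b d f) \<cdot> interchange A a b (c \<otimes> e) (d \<otimes> f) \<cdot> (idn A (a \<otimes> b) \<boxtimes> interchange A c d e f)"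
  by (rule acts_unique[where t="Node (Node (Atom a) (Atom b)) (Node (Node (Atom c) (Atom d)) (Node (Atom e) (Atom f)))"
      and u="Node (Node (Node (Atom a) (Atom c)) (Atom e)) (Node (Node (Atom b) (Atom d)) (Atom f))"],
      (rule acts_rules; (simp; fail)?)+)
    \<comment> \<open>The transpositions of \<open>b, c\<close> and of \<open>d, e\<close> occur in different orders on the two sides.\<close>
    (simp add: tena_fold tena_fold2 mid_nat[of "idn A b" "idn A c" "mid d e (f \<otimes> un A)", simplified])

lemma interchange_run:
  assumes [simp]: "a \<in> obj A" "b \<in> obj A"
  shows "(run A a \<boxtimes> run A b) \<cdot> interchange A a b (un A) (un A) \<cdot> (idn A (a \<otimes> b) \<boxtimes> inv_arr A (lun A (un A)))
    = run A (a \<otimes> b)"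
  by (rule acts_unique[where t="Node (Node (Atom a) (Atom b)) Unit" and u="Node (Atom a) (Atom b)"],
      (rule acts_rules; (simp; fail)?)+)
    (simp add: tena_fold)

lemma interchange_lun:
  assumes [simp]: "a \<in> obj A" "b \<in> obj A"
  shows "(lun A a \<boxtimes> lun A b) \<cdot> interchange A (un A) (un A) a b \<cdot> (inv_arr A (lun A (un A)) \<boxtimes> idn A (a \<otimes> b))
    = lun A (a \<otimes> b)"
  by (rule acts_unique[where t="Node Unit (Node (Atom a) (Atom b))" and u="Node (Atom a) (Atom b)"],
      (rule acts_rules; (simp; fail)?)+)
    (simp add: tena_fold)

lemma interchange_swp:
  assumes [simp]: "a \<in> obj A" "b \<in> obj A" "c \<in> obj A" "d \<in> obj A"
  shows "interchange A c d a b \<cdot> swp A (a \<otimes> b) (c \<otimes> d) = (swp A a c \<boxtimes> swp A b d) \<cdot> interchange A a b c d"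
  by (rule acts_unique[where t="Node (Node (Atom a) (Atom b)) (Node (Atom c) (Atom d))"
      and u="Node (Node (Atom c) (Atom a)) (Node (Atom d) (Atom b))"],
      (rule acts_rules; (simp; fail)?)+)
    (simp add: tena_fold tena_fold2 mid_mid)

text \<open>The equations that make the structural arrows monoidal transformations: the interchange is
  compatible with associativity, units and symmetry inside the pairs. The two further equations
  at the unit are the corresponding conditions on the arrows out of the unit.\<close>

lemma ass_interchange:
  assumes [simp]: "a \<in> obj A" "b \<in> obj A" "c \<in> obj A" "d \<in> obj A" "e \<in> obj A" "f \<in> obj A"
  shows "ass A (a \<otimes> d) (b \<otimes> e) (c \<otimes> f) \<cdot> (idn A (a \<otimes> d) \<boxtimes> interchange A b c e f) \<cdot> interchange A a (b \<otimes> c) d (e \<otimes> f)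
    = (interchange A a b d e \<boxtimes> idn A (c \<otimes> f)) \<cdot> interchange A (a \<otimes> b) c (d \<otimes> e) f \<cdot> (ass A a b c \<boxtimes> ass A d e f)"
  by (rule acts_unique[where t="Node (Node (Atom a) (Node (Atom b) (Atom c))) (Node (Atom d) (Node (Atom e) (Atom f)))"
      and u="Node (Node (Node (Atom a) (Atom d)) (Node (Atom b) (Atom e))) (Node (Atom c) (Atom f))"],
      (rule acts_rules; (simp; fail)?)+)
    \<comment> \<open>The transpositions of \<open>b, d\<close> and of \<open>c, e\<close> occur in different orders on the two sides.\<close>
    (use cmp_extend[OF mid_nat[of "idn A b" "idn A d" "mid c e (f \<otimes> un A)"], of "idn A b \<boxtimes> mid c d (e \<otimes> (f \<otimes> un A))"] in
      \<open>simp add: tena_fold tena_fold2\<close>)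

lemma run_interchange:
  assumes [simp]: "a \<in> obj A" "b \<in> obj A"
  shows "run A (a \<otimes> b) \<cdot> (idn A (a \<otimes> b) \<boxtimes> lun A (un A)) \<cdot> interchange A a (un A) b (un A) = run A a \<boxtimes> run A b"
  by (rule acts_unique[where t="Node (Node (Atom a) Unit) (Node (Atom b) Unit)" and u="Node (Atom a) (Atom b)"],
      (rule acts_rules; (simp; fail)?)+)
    (simp add: tena_fold)

lemma lun_interchange:
  assumes [simp]: "a \<in> obj A" "b \<in> obj A"
  shows "lun A (a \<otimes> b) \<cdot> (lun A (un A) \<boxtimes> idn A (a \<otimes> b)) \<cdot> interchange A (un A) a (un A) b = lun A a \<boxtimes> lun A b"
  by (rule acts_unique[where t="Node (Node Unit (Atom a)) (Node Unit (Atom b))" and u="Node (Atom a) (Atom b)"],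
      (rule acts_rules; (simp; fail)?)+)
    (simp add: tena_fold)

lemma swp_interchange:
  assumes [simp]: "a \<in> obj A" "b \<in> obj A" "c \<in> obj A" "d \<in> obj A"
  shows "swp A (a \<otimes> c) (b \<otimes> d) \<cdot> interchange A a b c d = interchange A b a d c \<cdot> (swp A a b \<boxtimes> swp A c d)"
  by (rule acts_unique[where t="Node (Node (Atom a) (Atom b)) (Node (Atom c) (Atom d))"
      and u="Node (Node (Atom b) (Atom d)) (Node (Atom a) (Atom c))"],
      (rule acts_rules; (simp; fail)?)+)
    (simp add: tena_fold tena_fold2 mid_mid mid_mid_cmp)

lemma ass_un:
  "ass A (un A) (un A) (un A) \<cdot> (idn A (un A) \<boxtimes> inv_arr A (lun A (un A))) \<cdot> inv_arr A (lun A (un A)) =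
   (inv_arr A (lun A (un A)) \<boxtimes> idn A (un A)) \<cdot> inv_arr A (lun A (un A))"
  by (rule acts_unique[where t="Unit" and u="Node (Node Unit Unit) Unit"],
      (rule acts_rules; (simp; fail)?)+)
    (simp add: tena_fold)

lemma swp_un: "swp A (un A) (un A) \<cdot> inv_arr A (lun A (un A)) = inv_arr A (lun A (un A))"
  by (rule acts_unique[where t="Unit" and u="Node Unit Unit"],
      (rule acts_rules; (simp; fail)?)+)
    (simp add: tena_fold)

end

section \<open>Symmetric monoidal functors\<close>

sublocale symm_mon_functor \<subseteq> dom: symm_mon_category A + cod: symm_mon_category B
  using smc_dom smc_cod by auto

context symm_mon_functor begin

lemmas fdom' [simp] = fdom
lemmas fcod' [simp] = fcod

lemma fobj_obj [simp]: "a \<in> obj A \<Longrightarrow> fobj F a \<in> obj B"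
  using fobj_PiE by auto

lemma farr_facts [simp]:
  assumes "f \<in> arr A"
  shows "farr F f \<in> arr B" "src B (farr F f) = fobj F (src A f)" "tgt B (farr F f) = fobj F (tgt A f)"
  using PiE_mem[OF farr_PiE assms] by (auto simp: hom_def)

lemmas farr_idn' [simp] = farr_idn

lemma farr_comp [simp]:
  "f \<in> arr A \<Longrightarrow> g \<in> arr A \<Longrightarrow> src A g = tgt A f \<Longrightarrow> farr F (g \<cdot>\<^bsub>A\<^esub> f) = farr F g \<cdot>\<^bsub>B\<^esub> farr F f"
  by (rule farr_cmp) (auto simp: hom_def)

lemma fzero_facts [simp]: "fzero F \<in> arr B" "src B (fzero F) = un B" "tgt B (fzero F) = fobj F (un A)"
  using fzero_hom by (auto simp: hom_def)

lemma ftwo_facts [simp]: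
  assumes "a \<in> obj A" "b \<in> obj A"
  shows "ftwo F a b \<in> arr B" "src B (ftwo F a b) = fobj F a \<otimes>\<^bsub>B\<^esub> fobj F b"
    "tgt B (ftwo F a b) = fobj F (a \<otimes>\<^bsub>A\<^esub> b)"
  using PiE_mem[OF PiE_mem[OF ftwo_PiE assms(1)] assms(2)] by (auto simp: hom_def)

lemma ftwo_nat:
  "f \<in> arr A \<Longrightarrow> g \<in> arr A \<Longrightarrow>
   ftwo F (tgt A f) (tgt A g) \<cdot>\<^bsub>B\<^esub> (farr F f \<boxtimes>\<^bsub>B\<^esub> farr F g) =
   farr F (f \<boxtimes>\<^bsub>A\<^esub> g) \<cdot>\<^bsub>B\<^esub> ftwo F (src A f) (src A g)"
  by (rule ftwo_natural) (auto simp: hom_def)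

lemma smf_ext:
  "fobj F \<in> extensional (obj A)" "farr F \<in> extensional (arr A)" "ftwo F \<in> extensional (obj A)"
  "a \<in> obj A \<Longrightarrow> ftwo F a \<in> extensional (obj A)"
  using fobj_PiE farr_PiE ftwo_PiE PiE_mem[OF ftwo_PiE, of a] by (auto simp: PiE_def)

end

lemma symm_mon_functorI:
  assumes "fdom F = A" "symm_mon_category A" "fcod F = B" "symm_mon_category B"
    and ext: "fobj F \<in> extensional (obj A)" "farr F \<in> extensional (arr A)" "ftwo F \<in> extensional (obj A)"
      "\<And>a. a \<in> obj A \<Longrightarrow> ftwo F a \<in> extensional (obj A)"
    and "\<And>a. a \<in> obj A \<Longrightarrow> fobj F a \<in> obj B"
    and "\<And>f. f \<in> arr A \<Longrightarrow> farr F f \<in> arr B \<and> src B (farr F f) = fobj F (src A f) \<and> tgt B (farr F f) = fobj F (tgt A f)"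
    and "\<And>a. a \<in> obj A \<Longrightarrow> farr F (idn A a) = idn B (fobj F a)"
    and "\<And>f g. f \<in> arr A \<Longrightarrow> g \<in> arr A \<Longrightarrow> src A g = tgt A f \<Longrightarrow> farr F (g \<cdot>\<^bsub>A\<^esub> f) = farr F g \<cdot>\<^bsub>B\<^esub> farr F f"
    and "fzero F \<in> arr B \<and> src B (fzero F) = un B \<and> tgt B (fzero F) = fobj F (un A)"
    and "\<And>a b. a \<in> obj A \<Longrightarrow> b \<in> obj A \<Longrightarrow>
      ftwo F a b \<in> arr B \<and> src B (ftwo F a b) = fobj F a \<otimes>\<^bsub>B\<^esub> fobj F b \<and> tgt B (ftwo F a b) = fobj F (a \<otimes>\<^bsub>A\<^esub> b)"
    and "\<And>f g. f \<in> arr A \<Longrightarrow> g \<in> arr A \<Longrightarrow>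
      ftwo F (tgt A f) (tgt A g) \<cdot>\<^bsub>B\<^esub> (farr F f \<boxtimes>\<^bsub>B\<^esub> farr F g) =
      farr F (f \<boxtimes>\<^bsub>A\<^esub> g) \<cdot>\<^bsub>B\<^esub> ftwo F (src A f) (src A g)"
    and "\<And>a b c. a \<in> obj A \<Longrightarrow> b \<in> obj A \<Longrightarrow> c \<in> obj A \<Longrightarrow>
      ftwo F (a \<otimes>\<^bsub>A\<^esub> b) c \<cdot>\<^bsub>B\<^esub> (ftwo F a b \<boxtimes>\<^bsub>B\<^esub> idn B (fobj F c)) \<cdot>\<^bsub>B\<^esub> ass B (fobj F a) (fobj F b) (fobj F c) =
      farr F (ass A a b c) \<cdot>\<^bsub>B\<^esub> ftwo F a (b \<otimes>\<^bsub>A\<^esub> c) \<cdot>\<^bsub>B\<^esub> (idn B (fobj F a) \<boxtimes>\<^bsub>B\<^esub> ftwo F b c)"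
    and "\<And>a. a \<in> obj A \<Longrightarrow>
      farr F (run A a) \<cdot>\<^bsub>B\<^esub> ftwo F a (un A) \<cdot>\<^bsub>B\<^esub> (idn B (fobj F a) \<boxtimes>\<^bsub>B\<^esub> fzero F) = run B (fobj F a)"
    and "\<And>a. a \<in> obj A \<Longrightarrow>
      farr F (lun A a) \<cdot>\<^bsub>B\<^esub> ftwo F (un A) a \<cdot>\<^bsub>B\<^esub> (fzero F \<boxtimes>\<^bsub>B\<^esub> idn B (fobj F a)) = lun B (fobj F a)"
    and "\<And>a b. a \<in> obj A \<Longrightarrow> b \<in> obj A \<Longrightarrow>
      ftwo F b a \<cdot>\<^bsub>B\<^esub> swp B (fobj F a) (fobj F b) = farr F (swp A a b) \<cdot>\<^bsub>B\<^esub> ftwo F a b"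
  shows "symm_mon_functor F A B"
proof (rule symm_mon_functor.intro)
  show "fobj F \<in> obj A \<rightarrow>\<^sub>E obj B" "farr F \<in> (\<Pi>\<^sub>E f\<in>arr A. hom B (fobj F (src A f)) (fobj F (tgt A f)))"
    "ftwo F \<in> (\<Pi>\<^sub>E a\<in>obj A. \<Pi>\<^sub>E b\<in>obj A. hom B (fobj F a \<otimes>\<^bsub>B\<^esub> fobj F b) (fobj F (a \<otimes>\<^bsub>A\<^esub> b)))"
    using assms by (auto simp: PiE_def hom_def)
qed (use assms in \<open>auto simp: hom_def\<close>)

lemma smf_eqI:
  assumes "symm_mon_functor F A B" "symm_mon_functor G A B"
    and "\<And>a. a \<in> obj A \<Longrightarrow> fobj F a = fobj G a" "\<And>f. f \<in> arr A \<Longrightarrow> farr F f = farr G f"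
    "fzero F = fzero G" "\<And>a b. a \<in> obj A \<Longrightarrow> b \<in> obj A \<Longrightarrow> ftwo F a b = ftwo G a b"
  shows "F = G"
proof -
  interpret F: symm_mon_functor F A B by fact
  interpret G: symm_mon_functor G A B by fact
  have "fobj F = fobj G" "farr F = farr G"
    using F.smf_ext G.smf_ext assms by (auto intro: extensionalityI)
  moreover have "ftwo F = ftwo G"
    using F.smf_ext(3) G.smf_ext(3)
  proof (rule extensionalityI)
    fix a assume a: "a \<in> obj A"
    show "ftwo F a = ftwo G a"
      using F.smf_ext(4)[OF a] G.smf_ext(4)[OF a] by (rule extensionalityI) (use a assms in auto)
  qed
  ultimately show ?thesis using assms(5) by (intro smfun.equality) auto
qed

lemma box_smf_simps [simp]:
  "fdom (F \<box> G) = fdom F" "fcod (F \<box> G) = fcod F"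
  "a \<in> obj (fdom F) \<Longrightarrow> fobj (F \<box> G) a = fobj F a \<otimes>\<^bsub>fcod F\<^esub> fobj G a"
  "f \<in> arr (fdom F) \<Longrightarrow> farr (F \<box> G) f = farr F f \<boxtimes>\<^bsub>fcod F\<^esub> farr G f"
  "fzero (F \<box> G) = (fzero F \<boxtimes>\<^bsub>fcod F\<^esub> fzero G) \<cdot>\<^bsub>fcod F\<^esub> inv_arr (fcod F) (lun (fcod F) (un (fcod F)))"
  "a \<in> obj (fdom F) \<Longrightarrow> b \<in> obj (fdom F) \<Longrightarrow> ftwo (F \<box> G) a b = (ftwo F a b \<boxtimes>\<^bsub>fcod F\<^esub> ftwo G a b)
       \<cdot>\<^bsub>fcod F\<^esub> interchange (fcod F) (fobj F a) (fobj G a) (fobj F b) (fobj G b)"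
  by (simp_all add: box_smf_def Let_def)

lemma comp_smf_simps [simp]:
  "fdom (G \<circ>\<^sub>F F) = fdom F" "fcod (G \<circ>\<^sub>F F) = fcod G"
  "a \<in> obj (fdom F) \<Longrightarrow> fobj (G \<circ>\<^sub>F F) a = fobj G (fobj F a)"
  "f \<in> arr (fdom F) \<Longrightarrow> farr (G \<circ>\<^sub>F F) f = farr G (farr F f)"
  "fzero (G \<circ>\<^sub>F F) = farr G (fzero F) \<cdot>\<^bsub>fcod G\<^esub> fzero G"
  "a \<in> obj (fdom F) \<Longrightarrow> b \<in> obj (fdom F) \<Longrightarrow>
    ftwo (G \<circ>\<^sub>F F) a b = farr G (ftwo F a b) \<cdot>\<^bsub>fcod G\<^esub> ftwo G (fobj F a) (fobj F b)"
  by (simp_all add: comp_smf_def Let_def)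

lemma id_smf_simps [simp]:
  "fdom (id_smf A) = A" "fcod (id_smf A) = A" "a \<in> obj A \<Longrightarrow> fobj (id_smf A) a = a"
  "f \<in> arr A \<Longrightarrow> farr (id_smf A) f = f" "fzero (id_smf A) = idn A (un A)"
  "a \<in> obj A \<Longrightarrow> b \<in> obj A \<Longrightarrow> ftwo (id_smf A) a b = idn A (a \<otimes>\<^bsub>A\<^esub> b)"
  by (simp_all add: id_smf_def)

lemma unit_smf_simps [simp]:
  "fdom (unit_smf A B) = A" "fcod (unit_smf A B) = B" "a \<in> obj A \<Longrightarrow> fobj (unit_smf A B) a = un B"
  "f \<in> arr A \<Longrightarrow> farr (unit_smf A B) f = idn B (un B)" "fzero (unit_smf A B) = idn B (un B)"
  "a \<in> obj A \<Longrightarrow> b \<in> obj A \<Longrightarrow> ftwo (unit_smf A B) a b = lun B (un B)"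
  by (simp_all add: unit_smf_def)

lemma id_smf_functor: "symm_mon_category A \<Longrightarrow> symm_mon_functor (id_smf A) A A"
proof -
  assume "symm_mon_category A"
  then interpret symm_mon_category A .
  show ?thesis
    by (rule symm_mon_functorI) (use \<open>symm_mon_category A\<close> in \<open>simp_all add: id_smf_def\<close>)
qed

lemma unit_smf_functor:
  assumes "symm_mon_category A" "symm_mon_category B"
  shows "symm_mon_functor (unit_smf A B) A B"
proof -
  interpret A: symm_mon_category A by fact
  interpret B: symm_mon_category B by fact
  have "(lun B (un B) \<boxtimes>\<^bsub>B\<^esub> idn B (un B)) \<cdot>\<^bsub>B\<^esub> ass B (un B) (un B) (un B) = idn B (un B) \<boxtimes>\<^bsub>B\<^esub> lun B (un B)"
    using B.triangle[of "un B" "un B"] B.lun_run_un by simp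
  moreover have "lun B (un B) \<cdot>\<^bsub>B\<^esub> swp B (un B) (un B) = lun B (un B)"
    using B.lun_swp[of "un B"] B.lun_run_un by simp
  ultimately show ?thesis
    by (intro symm_mon_functorI) (use assms B.lun_run_un in \<open>simp_all add: unit_smf_def\<close>)
qed

lemma comp_smf_functor:
  assumes "symm_mon_functor F A B" "symm_mon_functor G B C"
  shows "symm_mon_functor (G \<circ>\<^sub>F F) A C"
proof -
  interpret F: symm_mon_functor F A B by fact
  interpret G: symm_mon_functor G B C by fact
  note [simp] = F.fobj_obj G.fobj_obj
  show ?thesis
  proof (rule symm_mon_functorI)
    fix f g assume [simp]: "f \<in> arr A" "g \<in> arr A"
    have "farr G (ftwo F (tgt A f) (tgt A g)) \<cdot>\<^bsub>C\<^esub> ftwo G (fobj F (tgt A f)) (fobj F (tgt A g)) \<cdot>\<^bsub>C\<^esub>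
        (farr G (farr F f) \<boxtimes>\<^bsub>C\<^esub> farr G (farr F g)) =
      farr G (ftwo F (tgt A f) (tgt A g) \<cdot>\<^bsub>B\<^esub> (farr F f \<boxtimes>\<^bsub>B\<^esub> farr F g)) \<cdot>\<^bsub>C\<^esub> ftwo G (fobj F (src A f)) (fobj F (src A g))"
      using G.ftwo_nat[of "farr F f" "farr F g"] by simp
    then show "ftwo (G \<circ>\<^sub>F F) (tgt A f) (tgt A g) \<cdot>\<^bsub>C\<^esub> (farr (G \<circ>\<^sub>F F) f \<boxtimes>\<^bsub>C\<^esub> farr (G \<circ>\<^sub>F F) g) =
      farr (G \<circ>\<^sub>F F) (f \<boxtimes>\<^bsub>A\<^esub> g) \<cdot>\<^bsub>C\<^esub> ftwo (G \<circ>\<^sub>F F) (src A f) (src A g)"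
      by (simp add: F.ftwo_nat)
  next
    fix a b c assume [simp]: "a \<in> obj A" "b \<in> obj A" "c \<in> obj A"
    let ?a = "fobj F a" and ?b = "fobj F b" and ?c = "fobj F c" and ?ab = "fobj F (a \<otimes>\<^bsub>A\<^esub> b)"
      and ?bc = "fobj F (b \<otimes>\<^bsub>A\<^esub> c)"
    let ?g = "\<lambda>x. idn C (fobj G x)"
    have "ftwo G ?ab ?c \<cdot>\<^bsub>C\<^esub> ((farr G (ftwo F a b) \<cdot>\<^bsub>C\<^esub> ftwo G ?a ?b) \<boxtimes>\<^bsub>C\<^esub> ?g ?c) \<cdot>\<^bsub>C\<^esub> ass C (fobj G ?a) (fobj G ?b) (fobj G ?c)
      = ftwo G ?ab ?c \<cdot>\<^bsub>C\<^esub> (farr G (ftwo F a b) \<boxtimes>\<^bsub>C\<^esub> ?g ?c) \<cdot>\<^bsub>C\<^esub> (ftwo G ?a ?b \<boxtimes>\<^bsub>C\<^esub> ?g ?c) \<cdot>\<^bsub>C\<^esub> ass C (fobj G ?a) (fobj G ?b) (fobj G ?c)"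
      by (simp add: G.cod.tena_fold2)
    also have "\<dots> = farr G (ftwo F a b \<boxtimes>\<^bsub>B\<^esub> idn B ?c) \<cdot>\<^bsub>C\<^esub> ftwo G (?a \<otimes>\<^bsub>B\<^esub> ?b) ?c \<cdot>\<^bsub>C\<^esub> (ftwo G ?a ?b \<boxtimes>\<^bsub>C\<^esub> ?g ?c) \<cdot>\<^bsub>C\<^esub> ass C (fobj G ?a) (fobj G ?b) (fobj G ?c)"
      using G.cod.cmp_extend[OF G.ftwo_nat[of "ftwo F a b" "idn B ?c"],
        of "(ftwo G ?a ?b \<boxtimes>\<^bsub>C\<^esub> ?g ?c) \<cdot>\<^bsub>C\<^esub> ass C (fobj G ?a) (fobj G ?b) (fobj G ?c)"] by simp
    also have "\<dots> = farr G (ftwo F a b \<boxtimes>\<^bsub>B\<^esub> idn B ?c) \<cdot>\<^bsub>C\<^esub> farr G (ass B ?a ?b ?c) \<cdot>\<^bsub>C\<^esub> ftwo G ?a (?b \<otimes>\<^bsub>B\<^esub> ?c) \<cdot>\<^bsub>C\<^esub> (?g ?a \<boxtimes>\<^bsub>C\<^esub> ftwo G ?b ?c)"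
      by (simp add: G.ftwo_ass)
    finally have 1: "ftwo G ?ab ?c \<cdot>\<^bsub>C\<^esub> ((farr G (ftwo F a b) \<cdot>\<^bsub>C\<^esub> ftwo G ?a ?b) \<boxtimes>\<^bsub>C\<^esub> ?g ?c) \<cdot>\<^bsub>C\<^esub> ass C (fobj G ?a) (fobj G ?b) (fobj G ?c) = \<dots>" .
    have "farr G (ftwo F (a \<otimes>\<^bsub>A\<^esub> b) c) \<cdot>\<^bsub>C\<^esub> farr G (ftwo F a b \<boxtimes>\<^bsub>B\<^esub> idn B ?c) \<cdot>\<^bsub>C\<^esub> farr G (ass B ?a ?b ?c) =
      farr G (farr F (ass A a b c) \<cdot>\<^bsub>B\<^esub> ftwo F a (b \<otimes>\<^bsub>A\<^esub> c) \<cdot>\<^bsub>B\<^esub> (idn B ?a \<boxtimes>\<^bsub>B\<^esub> ftwo F b c))"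
      by (simp flip: F.ftwo_ass)
    then have "farr G (ftwo F (a \<otimes>\<^bsub>A\<^esub> b) c) \<cdot>\<^bsub>C\<^esub> farr G (ftwo F a b \<boxtimes>\<^bsub>B\<^esub> idn B ?c) \<cdot>\<^bsub>C\<^esub> farr G (ass B ?a ?b ?c) \<cdot>\<^bsub>C\<^esub> 
        (ftwo G ?a (?b \<otimes>\<^bsub>B\<^esub> ?c) \<cdot>\<^bsub>C\<^esub> (?g ?a \<boxtimes>\<^bsub>C\<^esub> ftwo G ?b ?c)) = farr G (farr F (ass A a b c)) \<cdot>\<^bsub>C\<^esub> farr G (ftwo F a (b \<otimes>\<^bsub>A\<^esub> c)) \<cdot>\<^bsub>C\<^esub> 
         farr G (idn B ?a \<boxtimes>\<^bsub>B\<^esub> ftwo F b c) \<cdot>\<^bsub>C\<^esub> (ftwo G ?a (?b \<otimes>\<^bsub>B\<^esub> ?c) \<cdot>\<^bsub>C\<^esub> (?g ?a \<boxtimes>\<^bsub>C\<^esub> ftwo G ?b ?c))"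
      using G.cod.cmp_extend1[of "farr G (ftwo F (a \<otimes>\<^bsub>A\<^esub> b) c)" "farr G (ftwo F a b \<boxtimes>\<^bsub>B\<^esub> idn B ?c) \<cdot>\<^bsub>C\<^esub> farr G (ass B ?a ?b ?c)" _
       "ftwo G ?a (?b \<otimes>\<^bsub>B\<^esub> ?c) \<cdot>\<^bsub>C\<^esub> (?g ?a \<boxtimes>\<^bsub>C\<^esub> ftwo G ?b ?c)"] by simp
    also have "farr G (idn B ?a \<boxtimes>\<^bsub>B\<^esub> ftwo F b c) \<cdot>\<^bsub>C\<^esub> (ftwo G ?a (?b \<otimes>\<^bsub>B\<^esub> ?c) \<cdot>\<^bsub>C\<^esub> (?g ?a \<boxtimes>\<^bsub>C\<^esub> ftwo G ?b ?c)) =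
      ftwo G ?a ?bc \<cdot>\<^bsub>C\<^esub> (?g ?a \<boxtimes>\<^bsub>C\<^esub> (farr G (ftwo F b c) \<cdot>\<^bsub>C\<^esub> ftwo G ?b ?c))"
      using G.cod.cmp_extend[OF G.ftwo_nat[of "idn B ?a" "ftwo F b c"], of "?g ?a \<boxtimes>\<^bsub>C\<^esub> ftwo G ?b ?c"]
      by (simp add: G.cod.tena_fold)
    finally show "ftwo (G \<circ>\<^sub>F F) (a \<otimes>\<^bsub>A\<^esub> b) c \<cdot>\<^bsub>C\<^esub> (ftwo (G \<circ>\<^sub>F F) a b \<boxtimes>\<^bsub>C\<^esub> idn C (fobj (G \<circ>\<^sub>F F) c)) \<cdot>\<^bsub>C\<^esub>
         ass C (fobj (G \<circ>\<^sub>F F) a) (fobj (G \<circ>\<^sub>F F) b) (fobj (G \<circ>\<^sub>F F) c) =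
      farr (G \<circ>\<^sub>F F) (ass A a b c) \<cdot>\<^bsub>C\<^esub> ftwo (G \<circ>\<^sub>F F) a (b \<otimes>\<^bsub>A\<^esub> c) \<cdot>\<^bsub>C\<^esub> (idn C (fobj (G \<circ>\<^sub>F F) a) \<boxtimes>\<^bsub>C\<^esub> ftwo (G \<circ>\<^sub>F F) b c)"
      by (simp add: 1)
  next
    fix a assume [simp]: "a \<in> obj A"
    let ?a = "fobj F a" and ?u = "fobj F (un A)"
    have "ftwo G ?a ?u \<cdot>\<^bsub>C\<^esub> (idn C (fobj G ?a) \<boxtimes>\<^bsub>C\<^esub> (farr G (fzero F) \<cdot>\<^bsub>C\<^esub> fzero G)) =
      farr G (idn B ?a \<boxtimes>\<^bsub>B\<^esub> fzero F) \<cdot>\<^bsub>C\<^esub> ftwo G ?a (un B) \<cdot>\<^bsub>C\<^esub> (idn C (fobj G ?a) \<boxtimes>\<^bsub>C\<^esub> fzero G)"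
      using G.cod.cmp_extend[OF G.ftwo_nat[of "idn B ?a" "fzero F"], of "idn C (fobj G ?a) \<boxtimes>\<^bsub>C\<^esub> fzero G"]
      by (simp add: G.cod.tena_fold)
    moreover have "farr G (farr F (run A a)) \<cdot>\<^bsub>C\<^esub> farr G (ftwo F a (un A)) \<cdot>\<^bsub>C\<^esub> farr G (idn B ?a \<boxtimes>\<^bsub>B\<^esub> fzero F)
      = farr G (run B ?a)"
      by (simp flip: F.ftwo_run)
    ultimately show "farr (G \<circ>\<^sub>F F) (run A a) \<cdot>\<^bsub>C\<^esub> ftwo (G \<circ>\<^sub>F F) a (un A) \<cdot>\<^bsub>C\<^esub> (idn C (fobj (G \<circ>\<^sub>F F) a) \<boxtimes>\<^bsub>C\<^esub> fzero (G \<circ>\<^sub>F F)) =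
      run C (fobj (G \<circ>\<^sub>F F) a)"
      using G.cod.cmp_extend1[of "farr G (farr F (run A a))" "farr G (ftwo F a (un A)) \<cdot>\<^bsub>C\<^esub> farr G (idn B ?a \<boxtimes>\<^bsub>B\<^esub> fzero F)" _
        "ftwo G ?a (un B) \<cdot>\<^bsub>C\<^esub> (idn C (fobj G ?a) \<boxtimes>\<^bsub>C\<^esub> fzero G)"] G.ftwo_run[of ?a] by simp
    have "ftwo G ?u ?a \<cdot>\<^bsub>C\<^esub> ((farr G (fzero F) \<cdot>\<^bsub>C\<^esub> fzero G) \<boxtimes>\<^bsub>C\<^esub> idn C (fobj G ?a)) =
      farr G (fzero F \<boxtimes>\<^bsub>B\<^esub> idn B ?a) \<cdot>\<^bsub>C\<^esub> ftwo G (un B) ?a \<cdot>\<^bsub>C\<^esub> (fzero G \<boxtimes>\<^bsub>C\<^esub> idn C (fobj G ?a))"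
      using G.cod.cmp_extend[OF G.ftwo_nat[of "fzero F" "idn B ?a"], of "fzero G \<boxtimes>\<^bsub>C\<^esub> idn C (fobj G ?a)"]
      by (simp add: G.cod.tena_fold)
    moreover have "farr G (farr F (lun A a)) \<cdot>\<^bsub>C\<^esub> farr G (ftwo F (un A) a) \<cdot>\<^bsub>C\<^esub> farr G (fzero F \<boxtimes>\<^bsub>B\<^esub> idn B ?a)
      = farr G (lun B ?a)"
      by (simp flip: F.ftwo_lun)
    ultimately show "farr (G \<circ>\<^sub>F F) (lun A a) \<cdot>\<^bsub>C\<^esub> ftwo (G \<circ>\<^sub>F F) (un A) a \<cdot>\<^bsub>C\<^esub> (fzero (G \<circ>\<^sub>F F) \<boxtimes>\<^bsub>C\<^esub> idn C (fobj (G \<circ>\<^sub>F F) a)) =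
      lun C (fobj (G \<circ>\<^sub>F F) a)"
      using G.cod.cmp_extend1[of "farr G (farr F (lun A a))" "farr G (ftwo F (un A) a) \<cdot>\<^bsub>C\<^esub> farr G (fzero F \<boxtimes>\<^bsub>B\<^esub> idn B ?a)" _
        "ftwo G (un B) ?a \<cdot>\<^bsub>C\<^esub> (fzero G \<boxtimes>\<^bsub>C\<^esub> idn C (fobj G ?a))"] G.ftwo_lun[of ?a] by simp
  next
    fix a b assume [simp]: "a \<in> obj A" "b \<in> obj A"
    have "farr G (ftwo F b a) \<cdot>\<^bsub>C\<^esub> farr G (swp B (fobj F a) (fobj F b)) = farr G (farr F (swp A a b)) \<cdot>\<^bsub>C\<^esub> farr G (ftwo F a b)"
      by (simp add: F.ftwo_swp flip: G.farr_comp)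
    then show "ftwo (G \<circ>\<^sub>F F) b a \<cdot>\<^bsub>C\<^esub> swp C (fobj (G \<circ>\<^sub>F F) a) (fobj (G \<circ>\<^sub>F F) b) =
      farr (G \<circ>\<^sub>F F) (swp A a b) \<cdot>\<^bsub>C\<^esub> ftwo (G \<circ>\<^sub>F F) a b"
      using G.cod.cmp_extend[of "farr G (ftwo F b a)" "farr G (swp B (fobj F a) (fobj F b))" _ _ "ftwo G (fobj F a) (fobj F b)"]
      by (simp add: G.ftwo_swp)
  qed (use F.smc_dom G.smc_cod in \<open>auto simp: comp_smf_def Let_def\<close>)
qed

text \<open>Naturality of the interchange reduces each axiom to the axioms of the two functors, joined by
  the matching coherence equation of the interchange.\<close>

lemma box_smf_functor:
  assumes "symm_mon_functor F A B" "symm_mon_functor G A B"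
  shows "symm_mon_functor (F \<box> G) A B"
proof -
  interpret B: symm_mon_category B by (rule symm_mon_functor.smc_cod) fact
  interpret F: symm_mon_functor F A B by fact
  interpret G: symm_mon_functor G A B by fact
  let ?I = "interchange B"
  show ?thesis
  proof (rule symm_mon_functorI)
    fix f g assume [simp]: "f \<in> arr A" "g \<in> arr A" "src A g = tgt A f"
    show "farr (F \<box> G) (g \<cdot>\<^bsub>A\<^esub> f) = farr (F \<box> G) g \<cdot>\<^bsub>B\<^esub> farr (F \<box> G) f"
      by (simp add: B.tena_fold)
  next
    fix f g assume [simp]: "f \<in> arr A" "g \<in> arr A"
    show "ftwo (F \<box> G) (tgt A f) (tgt A g) \<cdot>\<^bsub>B\<^esub> (farr (F \<box> G) f \<boxtimes>\<^bsub>B\<^esub> farr (F \<box> G) g) =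
      farr (F \<box> G) (f \<boxtimes>\<^bsub>A\<^esub> g) \<cdot>\<^bsub>B\<^esub> ftwo (F \<box> G) (src A f) (src A g)"
      using B.interchange_nat[of "farr F f" "farr G f" "farr F g" "farr G g"]
      by (simp add: B.tena_fold2 F.ftwo_nat G.ftwo_nat)
  next
    fix a b c assume [simp]: "a \<in> obj A" "b \<in> obj A" "c \<in> obj A"
    let ?a = "fobj F a" and ?b = "fobj F b" and ?c = "fobj F c" and ?ab = "fobj F (a \<otimes>\<^bsub>A\<^esub> b)"
    let ?a' = "fobj G a" and ?b' = "fobj G b" and ?c' = "fobj G c" and ?ab' = "fobj G (a \<otimes>\<^bsub>A\<^esub> b)"
    let ?l = "(?I ?a ?a' ?b ?b' \<boxtimes>\<^bsub>B\<^esub> idn B (?c \<otimes>\<^bsub>B\<^esub> ?c')) \<cdot>\<^bsub>B\<^esub> ass B (?a \<otimes>\<^bsub>B\<^esub> ?a') (?b \<otimes>\<^bsub>B\<^esub> ?b') (?c \<otimes>\<^bsub>B\<^esub> ?c')"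
    let ?r = "idn B (?a \<otimes>\<^bsub>B\<^esub> ?a') \<boxtimes>\<^bsub>B\<^esub> ?I ?b ?b' ?c ?c'"
    have "?I ?ab ?ab' ?c ?c' \<cdot>\<^bsub>B\<^esub> (((ftwo F a b \<boxtimes>\<^bsub>B\<^esub> ftwo G a b) \<cdot>\<^bsub>B\<^esub> ?I ?a ?a' ?b ?b') \<boxtimes>\<^bsub>B\<^esub> idn B (?c \<otimes>\<^bsub>B\<^esub> ?c')) \<cdot>\<^bsub>B\<^esub> ass B (?a \<otimes>\<^bsub>B\<^esub> ?a') (?b \<otimes>\<^bsub>B\<^esub> ?b') (?c \<otimes>\<^bsub>B\<^esub> ?c')
      = ?I ?ab ?ab' ?c ?c' \<cdot>\<^bsub>B\<^esub> ((ftwo F a b \<boxtimes>\<^bsub>B\<^esub> ftwo G a b) \<boxtimes>\<^bsub>B\<^esub> (idn B ?c \<boxtimes>\<^bsub>B\<^esub> idn B ?c')) \<cdot>\<^bsub>B\<^esub> ?l"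
      by (simp add: B.tena_fold2)
    also have "\<dots> = ((ftwo F a b \<boxtimes>\<^bsub>B\<^esub> idn B ?c) \<boxtimes>\<^bsub>B\<^esub> (ftwo G a b \<boxtimes>\<^bsub>B\<^esub> idn B ?c')) \<cdot>\<^bsub>B\<^esub> ?I (?a \<otimes>\<^bsub>B\<^esub> ?b) (?a' \<otimes>\<^bsub>B\<^esub> ?b') ?c ?c' \<cdot>\<^bsub>B\<^esub> ?l"
      using B.cmp_extend[OF B.interchange_nat[of "ftwo F a b" "ftwo G a b" "idn B ?c" "idn B ?c'"], of ?l] by simp
    also have "?I (?a \<otimes>\<^bsub>B\<^esub> ?b) (?a' \<otimes>\<^bsub>B\<^esub> ?b') ?c ?c' \<cdot>\<^bsub>B\<^esub> ?l = (ass B ?a ?b ?c \<boxtimes>\<^bsub>B\<^esub> ass B ?a' ?b' ?c') \<cdot>\<^bsub>B\<^esub>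
        ?I ?a ?a' (?b \<otimes>\<^bsub>B\<^esub> ?c) (?b' \<otimes>\<^bsub>B\<^esub> ?c') \<cdot>\<^bsub>B\<^esub> ?r"
      by (rule B.interchange_ass) auto
    finally have 1: "?I ?ab ?ab' ?c ?c' \<cdot>\<^bsub>B\<^esub> (((ftwo F a b \<boxtimes>\<^bsub>B\<^esub> ftwo G a b) \<cdot>\<^bsub>B\<^esub> ?I ?a ?a' ?b ?b') \<boxtimes>\<^bsub>B\<^esub> idn B (?c \<otimes>\<^bsub>B\<^esub> ?c')) \<cdot>\<^bsub>B\<^esub> ass B (?a \<otimes>\<^bsub>B\<^esub> ?a') (?b \<otimes>\<^bsub>B\<^esub> ?b') (?c \<otimes>\<^bsub>B\<^esub> ?c')
      = ((ftwo F a b \<boxtimes>\<^bsub>B\<^esub> idn B ?c) \<boxtimes>\<^bsub>B\<^esub> (ftwo G a b \<boxtimes>\<^bsub>B\<^esub> idn B ?c')) \<cdot>\<^bsub>B\<^esub> (ass B ?a ?b ?c \<boxtimes>\<^bsub>B\<^esub> ass B ?a' ?b' ?c') \<cdot>\<^bsub>B\<^esub>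
        ?I ?a ?a' (?b \<otimes>\<^bsub>B\<^esub> ?c) (?b' \<otimes>\<^bsub>B\<^esub> ?c') \<cdot>\<^bsub>B\<^esub> ?r" .
    have 2: "?I ?a ?a' (fobj F (b \<otimes>\<^bsub>A\<^esub> c)) (fobj G (b \<otimes>\<^bsub>A\<^esub> c)) \<cdot>\<^bsub>B\<^esub> (idn B (?a \<otimes>\<^bsub>B\<^esub> ?a') \<boxtimes>\<^bsub>B\<^esub> (ftwo F b c \<boxtimes>\<^bsub>B\<^esub> ftwo G b c)) \<cdot>\<^bsub>B\<^esub> ?r
      = ((idn B ?a \<boxtimes>\<^bsub>B\<^esub> ftwo F b c) \<boxtimes>\<^bsub>B\<^esub> (idn B ?a' \<boxtimes>\<^bsub>B\<^esub> ftwo G b c)) \<cdot>\<^bsub>B\<^esub> ?I ?a ?a' (?b \<otimes>\<^bsub>B\<^esub> ?c) (?b' \<otimes>\<^bsub>B\<^esub> ?c') \<cdot>\<^bsub>B\<^esub> ?r"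
      using B.cmp_extend[OF B.interchange_nat[of "idn B ?a" "idn B ?a'" "ftwo F b c" "ftwo G b c"], of ?r] by simp
    then show "ftwo (F \<box> G) (a \<otimes>\<^bsub>A\<^esub> b) c \<cdot>\<^bsub>B\<^esub> (ftwo (F \<box> G) a b \<boxtimes>\<^bsub>B\<^esub> idn B (fobj (F \<box> G) c)) \<cdot>\<^bsub>B\<^esub>
         ass B (fobj (F \<box> G) a) (fobj (F \<box> G) b) (fobj (F \<box> G) c) =
      farr (F \<box> G) (ass A a b c) \<cdot>\<^bsub>B\<^esub> ftwo (F \<box> G) a (b \<otimes>\<^bsub>A\<^esub> c) \<cdot>\<^bsub>B\<^esub> (idn B (fobj (F \<box> G) a) \<boxtimes>\<^bsub>B\<^esub> ftwo (F \<box> G) b c)"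
      by (simp add: 1 B.tena_fold B.tena_fold2 F.ftwo_ass G.ftwo_ass)
  next
    fix a assume [simp]: "a \<in> obj A"
    let ?a = "fobj F a" and ?a' = "fobj G a" and ?u = "un B" and ?k = "inv_arr B (lun B (un B))"
    have "?I ?a ?a' (fobj F (un A)) (fobj G (un A)) \<cdot>\<^bsub>B\<^esub> (idn B (?a \<otimes>\<^bsub>B\<^esub> ?a') \<boxtimes>\<^bsub>B\<^esub> ((fzero F \<boxtimes>\<^bsub>B\<^esub> fzero G) \<cdot>\<^bsub>B\<^esub> ?k)) =
      ((idn B ?a \<boxtimes>\<^bsub>B\<^esub> fzero F) \<boxtimes>\<^bsub>B\<^esub> (idn B ?a' \<boxtimes>\<^bsub>B\<^esub> fzero G)) \<cdot>\<^bsub>B\<^esub> ?I ?a ?a' ?u ?u \<cdot>\<^bsub>B\<^esub> (idn B (?a \<otimes>\<^bsub>B\<^esub> ?a') \<boxtimes>\<^bsub>B\<^esub> ?k)"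
      using B.cmp_extend[OF B.interchange_nat[of "idn B ?a" "idn B ?a'" "fzero F" "fzero G"], of "idn B (?a \<otimes>\<^bsub>B\<^esub> ?a') \<boxtimes>\<^bsub>B\<^esub> ?k"]
      by (simp add: B.tena_fold)
    then show "farr (F \<box> G) (run A a) \<cdot>\<^bsub>B\<^esub> ftwo (F \<box> G) a (un A) \<cdot>\<^bsub>B\<^esub> (idn B (fobj (F \<box> G) a) \<boxtimes>\<^bsub>B\<^esub> fzero (F \<box> G)) =
      run B (fobj (F \<box> G) a)"
      by (simp add: B.tena_fold2 F.ftwo_run G.ftwo_run B.interchange_run)
    have "?I (fobj F (un A)) (fobj G (un A)) ?a ?a' \<cdot>\<^bsub>B\<^esub> (((fzero F \<boxtimes>\<^bsub>B\<^esub> fzero G) \<cdot>\<^bsub>B\<^esub> ?k) \<boxtimes>\<^bsub>B\<^esub> idn B (?a \<otimes>\<^bsub>B\<^esub> ?a')) =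
      ((fzero F \<boxtimes>\<^bsub>B\<^esub> idn B ?a) \<boxtimes>\<^bsub>B\<^esub> (fzero G \<boxtimes>\<^bsub>B\<^esub> idn B ?a')) \<cdot>\<^bsub>B\<^esub> ?I ?u ?u ?a ?a' \<cdot>\<^bsub>B\<^esub> (?k \<boxtimes>\<^bsub>B\<^esub> idn B (?a \<otimes>\<^bsub>B\<^esub> ?a'))"
      using B.cmp_extend[OF B.interchange_nat[of "fzero F" "fzero G" "idn B ?a" "idn B ?a'"], of "?k \<boxtimes>\<^bsub>B\<^esub> idn B (?a \<otimes>\<^bsub>B\<^esub> ?a')"]
      by (simp add: B.tena_fold)
    then show "farr (F \<box> G) (lun A a) \<cdot>\<^bsub>B\<^esub> ftwo (F \<box> G) (un A) a \<cdot>\<^bsub>B\<^esub> (fzero (F \<box> G) \<boxtimes>\<^bsub>B\<^esub> idn B (fobj (F \<box> G) a)) =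
      lun B (fobj (F \<box> G) a)"
      by (simp add: B.tena_fold2 F.ftwo_lun G.ftwo_lun B.interchange_lun)
  next
    fix a b assume [simp]: "a \<in> obj A" "b \<in> obj A"
    show "ftwo (F \<box> G) b a \<cdot>\<^bsub>B\<^esub> swp B (fobj (F \<box> G) a) (fobj (F \<box> G) b) =
      farr (F \<box> G) (swp A a b) \<cdot>\<^bsub>B\<^esub> ftwo (F \<box> G) a b"
      by (simp add: B.interchange_swp B.tena_fold2 F.ftwo_swp G.ftwo_swp)
  qed (use F.smc_dom F.smc_cod in \<open>auto simp: box_smf_def Let_def\<close>)
qed

section \<open>Monoidal natural transformations\<close>

sublocale mon_nat_trans \<subseteq> F: symm_mon_functor F A B + G: symm_mon_functor G A B
  using smf_src smf_tgt by auto

context mon_nat_trans begin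

lemmas nsrc' [simp] = nsrc
lemmas ntgt' [simp] = ntgt

lemma ncmp_facts [simp]:
  assumes "a \<in> obj A"
  shows "ncmp t a \<in> arr B" "src B (ncmp t a) = fobj F a" "tgt B (ncmp t a) = fobj G a"
  using PiE_mem[OF ncmp_PiE assms] by (auto simp: hom_def)

lemma ncmp_nat: "f \<in> arr A \<Longrightarrow> ncmp t (tgt A f) \<cdot>\<^bsub>B\<^esub> farr F f = farr G f \<cdot>\<^bsub>B\<^esub> ncmp t (src A f)"
  by (rule ncmp_natural) (auto simp: hom_def)

lemma ncmp_ext [simp]: "ncmp t \<in> extensional (obj A)"
  using ncmp_PiE by (auto simp: PiE_def)

end

lemma mon_nat_transI:
  assumes "nsrc t = F" "ntgt t = G" "symm_mon_functor F A B" "symm_mon_functor G A B"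
    "ncmp t \<in> extensional (obj A)"
    "\<And>a. a \<in> obj A \<Longrightarrow> ncmp t a \<in> arr B \<and> src B (ncmp t a) = fobj F a \<and> tgt B (ncmp t a) = fobj G a"
    "\<And>f. f \<in> arr A \<Longrightarrow> ncmp t (tgt A f) \<cdot>\<^bsub>B\<^esub> farr F f = farr G f \<cdot>\<^bsub>B\<^esub> ncmp t (src A f)"
    "ncmp t (un A) \<cdot>\<^bsub>B\<^esub> fzero F = fzero G"
    "\<And>a b. a \<in> obj A \<Longrightarrow> b \<in> obj A \<Longrightarrow>
      ncmp t (a \<otimes>\<^bsub>A\<^esub> b) \<cdot>\<^bsub>B\<^esub> ftwo F a b = ftwo G a b \<cdot>\<^bsub>B\<^esub> (ncmp t a \<boxtimes>\<^bsub>B\<^esub> ncmp t b)"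
  shows "mon_nat_trans t F G A B"
  by (rule mon_nat_trans.intro) (use assms in \<open>auto simp: hom_def PiE_def\<close>)

lemma nt_eqI:
  fixes s t :: "('o, 'm, 'p, 'n) nattr"
  assumes "nsrc s = nsrc t" "ntgt s = ntgt t" "ncmp s \<in> extensional A" "ncmp t \<in> extensional A"
    "\<And>a. a \<in> A \<Longrightarrow> ncmp s a = ncmp t a"
  shows "s = t"
  using assms by (intro nattr.equality) (auto intro: extensionalityI)

lemma id_nt_simps [simp]:
  "nsrc (id_nt F) = F" "ntgt (id_nt F) = F" "obj (fdom F) = X \<Longrightarrow> ncmp (id_nt F) \<in> extensional X"
  "a \<in> obj (fdom F) \<Longrightarrow> ncmp (id_nt F) a = idn (fcod F) (fobj F a)"
  by (auto simp: id_nt_def)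

lemma vcomp_nt_simps [simp]:
  "nsrc (vcomp_nt t s) = nsrc s" "ntgt (vcomp_nt t s) = ntgt t"
  "obj (fdom (nsrc s)) = X \<Longrightarrow> ncmp (vcomp_nt t s) \<in> extensional X"
  "a \<in> obj (fdom (nsrc s)) \<Longrightarrow> ncmp (vcomp_nt t s) a = ncmp t a \<cdot>\<^bsub>fcod (nsrc s)\<^esub> ncmp s a"
  by (auto simp: vcomp_nt_def)

lemma hcomp_nt_simps [simp]:
  "nsrc (t *\<^sub>N s) = nsrc t \<circ>\<^sub>F nsrc s" "ntgt (t *\<^sub>N s) = ntgt t \<circ>\<^sub>F ntgt s"
  "obj (fdom (nsrc s)) = X \<Longrightarrow> ncmp (t *\<^sub>N s) \<in> extensional X"
  "a \<in> obj (fdom (nsrc s)) \<Longrightarrow>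
     ncmp (t *\<^sub>N s) a = ncmp t (fobj (ntgt s) a) \<cdot>\<^bsub>fcod (nsrc t)\<^esub> farr (nsrc t) (ncmp s a)"
  by (auto simp: hcomp_nt_def)

lemma box_nt_simps [simp]:
  "nsrc (box_nt s t) = nsrc s \<box> nsrc t" "ntgt (box_nt s t) = ntgt s \<box> ntgt t"
  "obj (fdom (nsrc s)) = X \<Longrightarrow> ncmp (box_nt s t) \<in> extensional X"
  "a \<in> obj (fdom (nsrc s)) \<Longrightarrow> ncmp (box_nt s t) a = ncmp s a \<boxtimes>\<^bsub>fcod (nsrc s)\<^esub> ncmp t a"
  by (auto simp: box_nt_def)

lemma id_nt_trans:
  assumes "symm_mon_functor F A B"
  shows "mon_nat_trans (id_nt F) F F A B"
proof -
  interpret F: symm_mon_functor F A B by fact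
  show ?thesis by (rule mon_nat_transI) (use assms in \<open>auto simp: id_nt_def\<close>)
qed

lemma vcomp_nt_trans:
  assumes "mon_nat_trans s F G A B" "mon_nat_trans t G H A B"
  shows "mon_nat_trans (vcomp_nt t s) F H A B"
proof -
  interpret F: symm_mon_functor F A B by (rule mon_nat_trans.smf_src) fact
  interpret B: symm_mon_category B by (rule F.smc_cod)
  interpret s: mon_nat_trans s F G A B by fact
  interpret t: mon_nat_trans t G H A B by fact
  show ?thesis
  proof (rule mon_nat_transI)
    fix f assume [simp]: "f \<in> arr A"
    show "ncmp (vcomp_nt t s) (tgt A f) \<cdot>\<^bsub>B\<^esub> farr F f = farr H f \<cdot>\<^bsub>B\<^esub> ncmp (vcomp_nt t s) (src A f)"
      using F.cod.cmp_extend[OF t.ncmp_nat[of f], of "ncmp s (src A f)"] by (simp add: s.ncmp_nat)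
  next
    show "ncmp (vcomp_nt t s) (un A) \<cdot>\<^bsub>B\<^esub> fzero F = fzero H"
      by (simp add: s.ncmp_zero t.ncmp_zero)
  next
    fix a b assume [simp]: "a \<in> obj A" "b \<in> obj A"
    show "ncmp (vcomp_nt t s) (a \<otimes>\<^bsub>A\<^esub> b) \<cdot>\<^bsub>B\<^esub> ftwo F a b =
      ftwo H a b \<cdot>\<^bsub>B\<^esub> (ncmp (vcomp_nt t s) a \<boxtimes>\<^bsub>B\<^esub> ncmp (vcomp_nt t s) b)"
      using F.cod.cmp_extend[OF t.ncmp_two[of a b], of "ncmp s a \<boxtimes>\<^bsub>B\<^esub> ncmp s b"]
      by (simp add: s.ncmp_two F.cod.tena_fold)
  qed (auto simp: s.smf_src t.smf_tgt vcomp_nt_def)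
qed

lemma hcomp_nt_trans:
  assumes "mon_nat_trans s F F' A B" "mon_nat_trans t G G' B C"
  shows "mon_nat_trans (t *\<^sub>N s) (G \<circ>\<^sub>F F) (G' \<circ>\<^sub>F F') A C"
proof -
  interpret C: symm_mon_category C by (rule symm_mon_functor.smc_cod[OF mon_nat_trans.smf_src]) fact
  interpret s: mon_nat_trans s F F' A B by fact
  interpret t: mon_nat_trans t G G' B C by fact
  show ?thesis
  proof (rule mon_nat_transI)
    show "symm_mon_functor (G \<circ>\<^sub>F F) A C" "symm_mon_functor (G' \<circ>\<^sub>F F') A C"
      using comp_smf_functor s.smf_src s.smf_tgt t.smf_src t.smf_tgt by blast+
  next
    fix f assume [simp]: "f \<in> arr A"
    have "ncmp t (fobj F' (tgt A f)) \<cdot>\<^bsub>C\<^esub> farr G (ncmp s (tgt A f)) \<cdot>\<^bsub>C\<^esub> farr G (farr F f) =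
      ncmp t (fobj F' (tgt A f)) \<cdot>\<^bsub>C\<^esub> farr G (farr F' f) \<cdot>\<^bsub>C\<^esub> farr G (ncmp s (src A f))"
      by (simp add: s.ncmp_nat flip: t.F.farr_comp)
    also have "\<dots> = farr G' (farr F' f) \<cdot>\<^bsub>C\<^esub> ncmp t (fobj F' (src A f)) \<cdot>\<^bsub>C\<^esub> farr G (ncmp s (src A f))"
      using C.cmp_extend[OF t.ncmp_nat[of "farr F' f"], of "farr G (ncmp s (src A f))"] by simp
    finally show "ncmp (t *\<^sub>N s) (tgt A f) \<cdot>\<^bsub>C\<^esub> farr (G \<circ>\<^sub>F F) f = farr (G' \<circ>\<^sub>F F') f \<cdot>\<^bsub>C\<^esub> ncmp (t *\<^sub>N s) (src A f)"
      by simp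
  next
    have "farr G (ncmp s (un A)) \<cdot>\<^bsub>C\<^esub> farr G (fzero F) = farr G (fzero F')"
      by (simp add: s.ncmp_zero flip: t.F.farr_comp)
    then show "ncmp (t *\<^sub>N s) (un A) \<cdot>\<^bsub>C\<^esub> fzero (G \<circ>\<^sub>F F) = fzero (G' \<circ>\<^sub>F F')"
      using C.cmp_extend1[of "farr G (ncmp s (un A))" "farr G (fzero F)" _ "fzero G"]
        C.cmp_extend[OF t.ncmp_nat[of "fzero F'"], of "fzero G"]
      by (simp add: t.ncmp_zero)
  next
    fix a b assume [simp]: "a \<in> obj A" "b \<in> obj A"
    let ?ab = "a \<otimes>\<^bsub>A\<^esub> b" and ?g = "ftwo G (fobj F a) (fobj F b)" and ?s = "ncmp s a \<boxtimes>\<^bsub>B\<^esub> ncmp s b"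
    have "farr G (ncmp s ?ab) \<cdot>\<^bsub>C\<^esub> farr G (ftwo F a b) = farr G (ftwo F' a b) \<cdot>\<^bsub>C\<^esub> farr G ?s"
      by (simp add: s.ncmp_two flip: t.F.farr_comp)
    then have "ncmp t (fobj F' ?ab) \<cdot>\<^bsub>C\<^esub> farr G (ncmp s ?ab) \<cdot>\<^bsub>C\<^esub> farr G (ftwo F a b) \<cdot>\<^bsub>C\<^esub> ?g =
      ncmp t (fobj F' ?ab) \<cdot>\<^bsub>C\<^esub> farr G (ftwo F' a b) \<cdot>\<^bsub>C\<^esub> farr G ?s \<cdot>\<^bsub>C\<^esub> ?g"
      using C.cmp_extend[of "farr G (ncmp s ?ab)" "farr G (ftwo F a b)" "farr G (ftwo F' a b)" "farr G ?s" ?g] by simp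
    also have "\<dots> = farr G' (ftwo F' a b) \<cdot>\<^bsub>C\<^esub> ncmp t (fobj F' a \<otimes>\<^bsub>B\<^esub> fobj F' b) \<cdot>\<^bsub>C\<^esub> farr G ?s \<cdot>\<^bsub>C\<^esub> ?g"
      using C.cmp_extend[OF t.ncmp_nat[of "ftwo F' a b"], of "farr G ?s \<cdot>\<^bsub>C\<^esub> ?g"] by simp
    also have "farr G ?s \<cdot>\<^bsub>C\<^esub> ?g = ftwo G (fobj F' a) (fobj F' b) \<cdot>\<^bsub>C\<^esub> (farr G (ncmp s a) \<boxtimes>\<^bsub>C\<^esub> farr G (ncmp s b))"
      using t.F.ftwo_nat[of "ncmp s a" "ncmp s b"] by simp
    also have "ncmp t (fobj F' a \<otimes>\<^bsub>B\<^esub> fobj F' b) \<cdot>\<^bsub>C\<^esub> ftwo G (fobj F' a) (fobj F' b) \<cdot>\<^bsub>C\<^esub> (farr G (ncmp s a) \<boxtimes>\<^bsub>C\<^esub> farr G (ncmp s b))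
      = ftwo G' (fobj F' a) (fobj F' b) \<cdot>\<^bsub>C\<^esub> (ncmp t (fobj F' a) \<boxtimes>\<^bsub>C\<^esub> ncmp t (fobj F' b)) \<cdot>\<^bsub>C\<^esub> (farr G (ncmp s a) \<boxtimes>\<^bsub>C\<^esub> farr G (ncmp s b))"
      by (rule C.cmp_extend[OF t.ncmp_two]) auto
    finally show "ncmp (t *\<^sub>N s) ?ab \<cdot>\<^bsub>C\<^esub> ftwo (G \<circ>\<^sub>F F) a b =
      ftwo (G' \<circ>\<^sub>F F') a b \<cdot>\<^bsub>C\<^esub> (ncmp (t *\<^sub>N s) a \<boxtimes>\<^bsub>C\<^esub> ncmp (t *\<^sub>N s) b)"
      by (simp add: C.tena_fold)
  qed (auto simp: hcomp_nt_def)
qed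

lemma box_nt_trans:
  assumes "mon_nat_trans s F F' A B" "mon_nat_trans t G G' A B"
  shows "mon_nat_trans (box_nt s t) (F \<box> G) (F' \<box> G') A B"
proof -
  interpret B: symm_mon_category B by (rule symm_mon_functor.smc_cod[OF mon_nat_trans.smf_src]) fact
  interpret s: mon_nat_trans s F F' A B by fact
  interpret t: mon_nat_trans t G G' A B by fact
  show ?thesis
  proof (rule mon_nat_transI)
    show "symm_mon_functor (F \<box> G) A B" "symm_mon_functor (F' \<box> G') A B"
      using box_smf_functor s.smf_src s.smf_tgt t.smf_src t.smf_tgt by blast+
  next
    fix a b assume [simp]: "a \<in> obj A" "b \<in> obj A"
    show "ncmp (box_nt s t) (a \<otimes>\<^bsub>A\<^esub> b) \<cdot>\<^bsub>B\<^esub> ftwo (F \<box> G) a b =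
      ftwo (F' \<box> G') a b \<cdot>\<^bsub>B\<^esub> (ncmp (box_nt s t) a \<boxtimes>\<^bsub>B\<^esub> ncmp (box_nt s t) b)"
      using B.interchange_nat[of "ncmp s a" "ncmp t a" "ncmp s b" "ncmp t b"]
      by (simp add: B.tena_fold2 s.ncmp_two t.ncmp_two)
  qed (auto simp: box_nt_def B.tena_fold B.tena_fold2 s.ncmp_nat t.ncmp_nat s.ncmp_zero t.ncmp_zero)
qed

lemma ass_nt_trans:
  assumes "symm_mon_functor F A B" "symm_mon_functor G A B" "symm_mon_functor H A B"
  shows "mon_nat_trans \<lparr>nsrc = F \<box> (G \<box> H), ntgt = (F \<box> G) \<box> H,
       ncmp = (\<lambda>a\<in>obj A. ass B (fobj F a) (fobj G a) (fobj H a))\<rparr> (F \<box> (G \<box> H)) ((F \<box> G) \<box> H) A B"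
proof -
  interpret B: symm_mon_category B by (rule symm_mon_functor.smc_cod) fact
  interpret F: symm_mon_functor F A B by fact
  interpret G: symm_mon_functor G A B by fact
  interpret H: symm_mon_functor H A B by fact
  show ?thesis
  proof (rule mon_nat_transI; (simp add: assms box_smf_functor)?)
    fix f assume [simp]: "f \<in> arr A"
    show "ass B (fobj F (tgt A f)) (fobj G (tgt A f)) (fobj H (tgt A f)) \<cdot>\<^bsub>B\<^esub> (farr F f \<boxtimes>\<^bsub>B\<^esub> (farr G f \<boxtimes>\<^bsub>B\<^esub> farr H f)) =
      ((farr F f \<boxtimes>\<^bsub>B\<^esub> farr G f) \<boxtimes>\<^bsub>B\<^esub> farr H f) \<cdot>\<^bsub>B\<^esub> ass B (fobj F (src A f)) (fobj G (src A f)) (fobj H (src A f))"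
      using B.ass_nat[of "farr F f" "farr G f" "farr H f"] by simp
  next
    let ?u = "un B" and ?k = "inv_arr B (lun B (un B))"
    have "ass B (fobj F (un A)) (fobj G (un A)) (fobj H (un A)) \<cdot>\<^bsub>B\<^esub>
        (fzero F \<boxtimes>\<^bsub>B\<^esub> ((fzero G \<boxtimes>\<^bsub>B\<^esub> fzero H) \<cdot>\<^bsub>B\<^esub> ?k)) \<cdot>\<^bsub>B\<^esub> ?k =
      ass B (fobj F (un A)) (fobj G (un A)) (fobj H (un A)) \<cdot>\<^bsub>B\<^esub>
        (fzero F \<boxtimes>\<^bsub>B\<^esub> (fzero G \<boxtimes>\<^bsub>B\<^esub> fzero H)) \<cdot>\<^bsub>B\<^esub> (idn B ?u \<boxtimes>\<^bsub>B\<^esub> ?k) \<cdot>\<^bsub>B\<^esub> ?k"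
      by (simp add: B.tena_fold2)
    also have "\<dots> = ((fzero F \<boxtimes>\<^bsub>B\<^esub> fzero G) \<boxtimes>\<^bsub>B\<^esub> fzero H) \<cdot>\<^bsub>B\<^esub> ass B ?u ?u ?u \<cdot>\<^bsub>B\<^esub> (idn B ?u \<boxtimes>\<^bsub>B\<^esub> ?k) \<cdot>\<^bsub>B\<^esub> ?k"
      using B.cmp_extend[OF B.ass_nat[of "fzero F" "fzero G" "fzero H"], of "(idn B ?u \<boxtimes>\<^bsub>B\<^esub> ?k) \<cdot>\<^bsub>B\<^esub> ?k"] by simp
    also have "\<dots> = (((fzero F \<boxtimes>\<^bsub>B\<^esub> fzero G) \<cdot>\<^bsub>B\<^esub> ?k) \<boxtimes>\<^bsub>B\<^esub> fzero H) \<cdot>\<^bsub>B\<^esub> ?k"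
      by (simp add: B.ass_un B.tena_fold2)
    finally show "ass B (fobj F (un A)) (fobj G (un A)) (fobj H (un A)) \<cdot>\<^bsub>B\<^esub>
        (fzero F \<boxtimes>\<^bsub>B\<^esub> ((fzero G \<boxtimes>\<^bsub>B\<^esub> fzero H) \<cdot>\<^bsub>B\<^esub> ?k)) \<cdot>\<^bsub>B\<^esub> ?k = (((fzero F \<boxtimes>\<^bsub>B\<^esub> fzero G) \<cdot>\<^bsub>B\<^esub> ?k) \<boxtimes>\<^bsub>B\<^esub> fzero H) \<cdot>\<^bsub>B\<^esub> ?k" .
  next
    fix x y assume [simp]: "x \<in> obj A" "y \<in> obj A"
    let ?I = "interchange B"
    let ?a = "fobj F x" and ?b = "fobj G x" and ?c = "fobj H x"
    let ?d = "fobj F y" and ?e = "fobj G y" and ?f = "fobj H y"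
    let ?xy = "x \<otimes>\<^bsub>A\<^esub> y"
    let ?i = "?I ?a (?b \<otimes>\<^bsub>B\<^esub> ?c) ?d (?e \<otimes>\<^bsub>B\<^esub> ?f)"
    have "ass B (fobj F ?xy) (fobj G ?xy) (fobj H ?xy) \<cdot>\<^bsub>B\<^esub>
       (ftwo F x y \<boxtimes>\<^bsub>B\<^esub> ((ftwo G x y \<boxtimes>\<^bsub>B\<^esub> ftwo H x y) \<cdot>\<^bsub>B\<^esub> ?I ?b ?c ?e ?f)) \<cdot>\<^bsub>B\<^esub> ?i =
     ass B (fobj F ?xy) (fobj G ?xy) (fobj H ?xy) \<cdot>\<^bsub>B\<^esub>
       (ftwo F x y \<boxtimes>\<^bsub>B\<^esub> (ftwo G x y \<boxtimes>\<^bsub>B\<^esub> ftwo H x y)) \<cdot>\<^bsub>B\<^esub> (idn B (?a \<otimes>\<^bsub>B\<^esub> ?d) \<boxtimes>\<^bsub>B\<^esub> ?I ?b ?c ?e ?f) \<cdot>\<^bsub>B\<^esub> ?i"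
      by (simp add: B.tena_fold2)
    also have "\<dots> = ((ftwo F x y \<boxtimes>\<^bsub>B\<^esub> ftwo G x y) \<boxtimes>\<^bsub>B\<^esub> ftwo H x y) \<cdot>\<^bsub>B\<^esub> ass B (?a \<otimes>\<^bsub>B\<^esub> ?d) (?b \<otimes>\<^bsub>B\<^esub> ?e) (?c \<otimes>\<^bsub>B\<^esub> ?f) \<cdot>\<^bsub>B\<^esub>
        (idn B (?a \<otimes>\<^bsub>B\<^esub> ?d) \<boxtimes>\<^bsub>B\<^esub> ?I ?b ?c ?e ?f) \<cdot>\<^bsub>B\<^esub> ?i"
      using B.cmp_extend[OF B.ass_nat[of "ftwo F x y" "ftwo G x y" "ftwo H x y"],
          of "(idn B (?a \<otimes>\<^bsub>B\<^esub> ?d) \<boxtimes>\<^bsub>B\<^esub> ?I ?b ?c ?e ?f) \<cdot>\<^bsub>B\<^esub> ?i"] by simp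
    also have "ass B (?a \<otimes>\<^bsub>B\<^esub> ?d) (?b \<otimes>\<^bsub>B\<^esub> ?e) (?c \<otimes>\<^bsub>B\<^esub> ?f) \<cdot>\<^bsub>B\<^esub> (idn B (?a \<otimes>\<^bsub>B\<^esub> ?d) \<boxtimes>\<^bsub>B\<^esub> ?I ?b ?c ?e ?f) \<cdot>\<^bsub>B\<^esub> ?i =
       (?I ?a ?b ?d ?e \<boxtimes>\<^bsub>B\<^esub> idn B (?c \<otimes>\<^bsub>B\<^esub> ?f)) \<cdot>\<^bsub>B\<^esub> ?I (?a \<otimes>\<^bsub>B\<^esub> ?b) ?c (?d \<otimes>\<^bsub>B\<^esub> ?e) ?f \<cdot>\<^bsub>B\<^esub> (ass B ?a ?b ?c \<boxtimes>\<^bsub>B\<^esub> ass B ?d ?e ?f)"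
      by (rule B.ass_interchange) auto
    finally show "ass B (fobj F ?xy) (fobj G ?xy) (fobj H ?xy) \<cdot>\<^bsub>B\<^esub>
       (ftwo F x y \<boxtimes>\<^bsub>B\<^esub> ((ftwo G x y \<boxtimes>\<^bsub>B\<^esub> ftwo H x y) \<cdot>\<^bsub>B\<^esub> ?I ?b ?c ?e ?f)) \<cdot>\<^bsub>B\<^esub> ?i =
      (((ftwo F x y \<boxtimes>\<^bsub>B\<^esub> ftwo G x y) \<cdot>\<^bsub>B\<^esub> ?I ?a ?b ?d ?e) \<boxtimes>\<^bsub>B\<^esub> ftwo H x y) \<cdot>\<^bsub>B\<^esub>
       ?I (?a \<otimes>\<^bsub>B\<^esub> ?b) ?c (?d \<otimes>\<^bsub>B\<^esub> ?e) ?f \<cdot>\<^bsub>B\<^esub> (ass B ?a ?b ?c \<boxtimes>\<^bsub>B\<^esub> ass B ?d ?e ?f)"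
      by (simp add: B.tena_fold2)
  qed
qed

lemma run_nt_trans:
  assumes "symm_mon_functor F A B"
  shows "mon_nat_trans \<lparr>nsrc = F \<box> unit_smf A B, ntgt = F, ncmp = (\<lambda>a\<in>obj A. run B (fobj F a))\<rparr>
     (F \<box> unit_smf A B) F A B"
proof -
  interpret F: symm_mon_functor F A B by fact
  note U = unit_smf_functor[OF F.smc_dom F.smc_cod]
  show ?thesis
  proof (rule mon_nat_transI; (simp add: assms box_smf_functor U)?)
    fix f assume [simp]: "f \<in> arr A"
    show "run B (fobj F (tgt A f)) \<cdot>\<^bsub>B\<^esub> (farr F f \<boxtimes>\<^bsub>B\<^esub> idn B (un B)) = farr F f \<cdot>\<^bsub>B\<^esub> run B (fobj F (src A f))"
      using F.cod.run_nat[of "farr F f"] by simp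
  next
    have "run B (un B) \<cdot>\<^bsub>B\<^esub> inv_arr B (lun B (un B)) = idn B (un B)"
      by (simp flip: F.cod.lun_run_un)
    then show "run B (fobj F (un A)) \<cdot>\<^bsub>B\<^esub> (fzero F \<boxtimes>\<^bsub>B\<^esub> idn B (un B)) \<cdot>\<^bsub>B\<^esub> inv_arr B (lun B (un B)) = fzero F"
      using F.cod.cmp_extend[OF F.cod.run_nat[of "fzero F"], of "inv_arr B (lun B (un B))"] by simp
  next
    fix a b assume [simp]: "a \<in> obj A" "b \<in> obj A"
    let ?i = "interchange B (fobj F a) (un B) (fobj F b) (un B)"
    have "run B (fobj F (a \<otimes>\<^bsub>A\<^esub> b)) \<cdot>\<^bsub>B\<^esub> (ftwo F a b \<boxtimes>\<^bsub>B\<^esub> lun B (un B)) \<cdot>\<^bsub>B\<^esub> ?i =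
      run B (fobj F (a \<otimes>\<^bsub>A\<^esub> b)) \<cdot>\<^bsub>B\<^esub> (ftwo F a b \<boxtimes>\<^bsub>B\<^esub> idn B (un B)) \<cdot>\<^bsub>B\<^esub> (idn B (fobj F a \<otimes>\<^bsub>B\<^esub> fobj F b) \<boxtimes>\<^bsub>B\<^esub> lun B (un B)) \<cdot>\<^bsub>B\<^esub> ?i"
      by (simp add: F.cod.tena_fold2)
    also have "\<dots> = ftwo F a b \<cdot>\<^bsub>B\<^esub> (run B (fobj F a) \<boxtimes>\<^bsub>B\<^esub> run B (fobj F b))"
      using F.cod.cmp_extend[OF F.cod.run_nat[of "ftwo F a b"], of "(idn B (fobj F a \<otimes>\<^bsub>B\<^esub> fobj F b) \<boxtimes>\<^bsub>B\<^esub> lun B (un B)) \<cdot>\<^bsub>B\<^esub> ?i"]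
      by (simp add: F.cod.run_interchange)
    finally show "run B (fobj F (a \<otimes>\<^bsub>A\<^esub> b)) \<cdot>\<^bsub>B\<^esub> (ftwo F a b \<boxtimes>\<^bsub>B\<^esub> lun B (un B)) \<cdot>\<^bsub>B\<^esub> ?i = 
      ftwo F a b \<cdot>\<^bsub>B\<^esub> (run B (fobj F a) \<boxtimes>\<^bsub>B\<^esub> run B (fobj F b))" .
  qed
qed

lemma lun_nt_trans:
  assumes "symm_mon_functor F A B"
  shows "mon_nat_trans \<lparr>nsrc = unit_smf A B \<box> F, ntgt = F, ncmp = (\<lambda>a\<in>obj A. lun B (fobj F a))\<rparr>
     (unit_smf A B \<box> F) F A B"
proof -
  interpret F: symm_mon_functor F A B by fact
  note U = unit_smf_functor[OF F.smc_dom F.smc_cod]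
  show ?thesis
  proof (rule mon_nat_transI; (simp add: assms box_smf_functor U)?)
    fix f assume [simp]: "f \<in> arr A"
    show "lun B (fobj F (tgt A f)) \<cdot>\<^bsub>B\<^esub> (idn B (un B) \<boxtimes>\<^bsub>B\<^esub> farr F f) = farr F f \<cdot>\<^bsub>B\<^esub> lun B (fobj F (src A f))"
      using F.cod.lun_nat[of "farr F f"] by simp
  next
    show "lun B (fobj F (un A)) \<cdot>\<^bsub>B\<^esub> (idn B (un B) \<boxtimes>\<^bsub>B\<^esub> fzero F) \<cdot>\<^bsub>B\<^esub> inv_arr B (lun B (un B)) = fzero F"
      using F.cod.cmp_extend[OF F.cod.lun_nat[of "fzero F"], of "inv_arr B (lun B (un B))"] by simp
  next
    fix a b assume [simp]: "a \<in> obj A" "b \<in> obj A"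
    let ?i = "interchange B (un B) (fobj F a) (un B) (fobj F b)"
    have "lun B (fobj F (a \<otimes>\<^bsub>A\<^esub> b)) \<cdot>\<^bsub>B\<^esub> (lun B (un B) \<boxtimes>\<^bsub>B\<^esub> ftwo F a b) \<cdot>\<^bsub>B\<^esub> ?i =
      lun B (fobj F (a \<otimes>\<^bsub>A\<^esub> b)) \<cdot>\<^bsub>B\<^esub> (idn B (un B) \<boxtimes>\<^bsub>B\<^esub> ftwo F a b) \<cdot>\<^bsub>B\<^esub> (lun B (un B) \<boxtimes>\<^bsub>B\<^esub> idn B (fobj F a \<otimes>\<^bsub>B\<^esub> fobj F b)) \<cdot>\<^bsub>B\<^esub> ?i"
      by (simp add: F.cod.tena_fold2)
    also have "\<dots> = ftwo F a b \<cdot>\<^bsub>B\<^esub> (lun B (fobj F a) \<boxtimes>\<^bsub>B\<^esub> lun B (fobj F b))"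
      using F.cod.cmp_extend[OF F.cod.lun_nat[of "ftwo F a b"], of "(lun B (un B) \<boxtimes>\<^bsub>B\<^esub> idn B (fobj F a \<otimes>\<^bsub>B\<^esub> fobj F b)) \<cdot>\<^bsub>B\<^esub> ?i"]
      by (simp add: F.cod.lun_interchange)
    finally show "lun B (fobj F (a \<otimes>\<^bsub>A\<^esub> b)) \<cdot>\<^bsub>B\<^esub> (lun B (un B) \<boxtimes>\<^bsub>B\<^esub> ftwo F a b) \<cdot>\<^bsub>B\<^esub> ?i = 
      ftwo F a b \<cdot>\<^bsub>B\<^esub> (lun B (fobj F a) \<boxtimes>\<^bsub>B\<^esub> lun B (fobj F b))" .
  qed
qed

lemma swp_nt_trans:
  assumes "symm_mon_functor F A B" "symm_mon_functor G A B"
  shows "mon_nat_trans \<lparr>nsrc = F \<box> G, ntgt = G \<box> F, ncmp = (\<lambda>a\<in>obj A. swp B (fobj F a) (fobj G a))\<rparr>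
     (F \<box> G) (G \<box> F) A B"
proof -
  interpret B: symm_mon_category B by (rule symm_mon_functor.smc_cod) fact
  interpret F: symm_mon_functor F A B by fact
  interpret G: symm_mon_functor G A B by fact
  show ?thesis
  proof (rule mon_nat_transI; (simp add: assms box_smf_functor)?)
    fix f assume [simp]: "f \<in> arr A"
    show "swp B (fobj F (tgt A f)) (fobj G (tgt A f)) \<cdot>\<^bsub>B\<^esub> (farr F f \<boxtimes>\<^bsub>B\<^esub> farr G f) =
       (farr G f \<boxtimes>\<^bsub>B\<^esub> farr F f) \<cdot>\<^bsub>B\<^esub> swp B (fobj F (src A f)) (fobj G (src A f))"
      using B.swp_nat[of "farr F f" "farr G f"] by simp
  next
    show "swp B (fobj F (un A)) (fobj G (un A)) \<cdot>\<^bsub>B\<^esub> (fzero F \<boxtimes>\<^bsub>B\<^esub> fzero G) \<cdot>\<^bsub>B\<^esub> inv_arr B (lun B (un B)) =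
      (fzero G \<boxtimes>\<^bsub>B\<^esub> fzero F) \<cdot>\<^bsub>B\<^esub> inv_arr B (lun B (un B))"
      using B.cmp_extend[OF B.swp_nat[of "fzero F" "fzero G"], of "inv_arr B (lun B (un B))"] by (simp add: B.swp_un)
  next
    fix a b assume [simp]: "a \<in> obj A" "b \<in> obj A"
    show "swp B (fobj F (a \<otimes>\<^bsub>A\<^esub> b)) (fobj G (a \<otimes>\<^bsub>A\<^esub> b)) \<cdot>\<^bsub>B\<^esub> (ftwo F a b \<boxtimes>\<^bsub>B\<^esub> ftwo G a b) \<cdot>\<^bsub>B\<^esub>
       interchange B (fobj F a) (fobj G a) (fobj F b) (fobj G b) =
      (ftwo G a b \<boxtimes>\<^bsub>B\<^esub> ftwo F a b) \<cdot>\<^bsub>B\<^esub> interchange B (fobj G a) (fobj F a) (fobj G b) (fobj F b) \<cdot>\<^bsub>B\<^esub>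
        (swp B (fobj F a) (fobj G a) \<boxtimes>\<^bsub>B\<^esub> swp B (fobj F b) (fobj G b))"
      using B.cmp_extend[OF B.swp_nat[of "ftwo F a b" "ftwo G a b"], of "interchange B (fobj F a) (fobj G a) (fobj F b) (fobj G b)"]
      by (simp add: B.swp_interchange)
  qed
qed

section \<open>The symmetric monoidal category of functors\<close>

lemma hom_smc_obj [simp]: "F \<in> obj (hom_smc A B) \<longleftrightarrow> symm_mon_functor F A B"
  by (simp add: hom_smc_def Let_def)

lemma hom_smc_arr: "t \<in> arr (hom_smc A B) \<longleftrightarrow> mon_nat_trans t (nsrc t) (ntgt t) A B"
  by (auto simp: hom_smc_def Let_def mon_nat_trans.nsrc mon_nat_trans.ntgt)

lemma (in mon_nat_trans) in_arr [simp]: "t \<in> arr (hom_smc A B)"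
  using mon_nat_trans_axioms by (simp add: hom_smc_arr)

lemma hom_smc_src_tgt [simp]:
  assumes "t \<in> arr (hom_smc A B)"
  shows "src (hom_smc A B) t = nsrc t" "tgt (hom_smc A B) t = ntgt t"
    "symm_mon_functor (nsrc t) A B" "symm_mon_functor (ntgt t) A B"
proof -
  have t: "mon_nat_trans t (nsrc t) (ntgt t) A B" using assms by (simp only: hom_smc_arr)
  show "symm_mon_functor (nsrc t) A B" using t by (rule mon_nat_trans.smf_src)
  show "symm_mon_functor (ntgt t) A B" using t by (rule mon_nat_trans.smf_tgt)
  show "src (hom_smc A B) t = nsrc t" using assms by (simp add: hom_smc_def Let_def)
  show "tgt (hom_smc A B) t = ntgt t" using assms by (simp add: hom_smc_def Let_def)
qed

lemma hom_smc_hom: "t \<in> hom (hom_smc A B) F G \<longleftrightarrow> mon_nat_trans t F G A B"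
proof
  assume "t \<in> hom (hom_smc A B) F G"
  then have "t \<in> arr (hom_smc A B)" "nsrc t = F" "ntgt t = G" by (auto simp: hom_def)
  then show "mon_nat_trans t F G A B" by (simp only: hom_smc_arr)
next
  assume "mon_nat_trans t F G A B"
  then interpret mon_nat_trans t F G A B .
  show "t \<in> hom (hom_smc A B) F G" by (simp add: hom_def)
qed

lemma hom_smc_idn [simp]:
  "symm_mon_functor F A B \<Longrightarrow> idn (hom_smc A B) F = id_nt F"
  "symm_mon_functor F A B \<Longrightarrow> id_nt F \<in> arr (hom_smc A B)"
  using mon_nat_trans.in_arr[OF id_nt_trans] by (simp_all add: hom_smc_def Let_def)

lemma hom_smc_cmp [simp]:
  assumes "t \<in> arr (hom_smc A B)" "s \<in> arr (hom_smc A B)" "ntgt s = nsrc t"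
  shows "cmp (hom_smc A B) t s = vcomp_nt t s" "vcomp_nt t s \<in> arr (hom_smc A B)"
proof -
  show "cmp (hom_smc A B) t s = vcomp_nt t s"
    using assms by (simp add: hom_smc_def Let_def)
  show "vcomp_nt t s \<in> arr (hom_smc A B)"
    using assms vcomp_nt_trans[of s "nsrc s" "nsrc t" A B t "ntgt t"] by (simp add: hom_smc_arr)
qed

lemma hom_smc_ten [simp]:
  "symm_mon_functor F A B \<Longrightarrow> symm_mon_functor G A B \<Longrightarrow> ten (hom_smc A B) F G = F \<box> G"
  by (simp add: hom_smc_def Let_def)

lemmas [simp] = box_smf_functor unit_smf_functor

lemma hom_smc_tena [simp]:
  assumes "s \<in> arr (hom_smc A B)" "t \<in> arr (hom_smc A B)"
  shows "tena (hom_smc A B) s t = box_nt s t" "box_nt s t \<in> arr (hom_smc A B)"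
proof -
  show "tena (hom_smc A B) s t = box_nt s t"
    using assms by (simp add: hom_smc_def Let_def)
  show "box_nt s t \<in> arr (hom_smc A B)"
    using assms box_nt_trans[of s "nsrc s" "ntgt s" A B t "nsrc t" "ntgt t"] by (simp add: hom_smc_arr)
qed

lemma hom_smc_un [simp]: "un (hom_smc A B) = unit_smf A B"
  by (simp add: hom_smc_def Let_def)

lemma hom_smc_ass [simp]:
  assumes "symm_mon_functor F A B" "symm_mon_functor G A B" "symm_mon_functor H A B"
  shows "nsrc (ass (hom_smc A B) F G H) = F \<box> (G \<box> H)" "ntgt (ass (hom_smc A B) F G H) = (F \<box> G) \<box> H"
    "a \<in> obj A \<Longrightarrow> ncmp (ass (hom_smc A B) F G H) a = ass B (fobj F a) (fobj G a) (fobj H a)"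
    "ncmp (ass (hom_smc A B) F G H) \<in> extensional (obj A)" "ass (hom_smc A B) F G H \<in> arr (hom_smc A B)"
  using mon_nat_trans.in_arr[OF ass_nt_trans[OF assms]] assms by (auto simp: hom_smc_def Let_def)

lemma hom_smc_run [simp]:
  assumes "symm_mon_functor F A B"
  shows "nsrc (run (hom_smc A B) F) = F \<box> unit_smf A B" "ntgt (run (hom_smc A B) F) = F"
    "a \<in> obj A \<Longrightarrow> ncmp (run (hom_smc A B) F) a = run B (fobj F a)"
    "ncmp (run (hom_smc A B) F) \<in> extensional (obj A)" "run (hom_smc A B) F \<in> arr (hom_smc A B)"
  using mon_nat_trans.in_arr[OF run_nt_trans[OF assms]] assms by (auto simp: hom_smc_def Let_def)

lemma hom_smc_lun [simp]:
  assumes "symm_mon_functor F A B"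
  shows "nsrc (lun (hom_smc A B) F) = unit_smf A B \<box> F" "ntgt (lun (hom_smc A B) F) = F"
    "a \<in> obj A \<Longrightarrow> ncmp (lun (hom_smc A B) F) a = lun B (fobj F a)"
    "ncmp (lun (hom_smc A B) F) \<in> extensional (obj A)" "lun (hom_smc A B) F \<in> arr (hom_smc A B)"
  using mon_nat_trans.in_arr[OF lun_nt_trans[OF assms]] assms by (auto simp: hom_smc_def Let_def)

lemma hom_smc_swp [simp]:
  assumes "symm_mon_functor F A B" "symm_mon_functor G A B"
  shows "nsrc (swp (hom_smc A B) F G) = F \<box> G" "ntgt (swp (hom_smc A B) F G) = G \<box> F"
    "a \<in> obj A \<Longrightarrow> ncmp (swp (hom_smc A B) F G) a = swp B (fobj F a) (fobj G a)"
    "ncmp (swp (hom_smc A B) F G) \<in> extensional (obj A)" "swp (hom_smc A B) F G \<in> arr (hom_smc A B)"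
  using mon_nat_trans.in_arr[OF swp_nt_trans[OF assms]] assms by (auto simp: hom_smc_def Let_def)

text \<open>The inverse components are again natural and monoidal: each condition on them is the corresponding
  condition on \<open>t\<close>, composed with inverses of its components.\<close>

lemma pointwise_iso:
  assumes "mon_nat_trans t F G A B" "\<And>a. a \<in> obj A \<Longrightarrow> ncmp t a \<in> isos B (fobj F a) (fobj G a)"
  shows "t \<in> isos (hom_smc A B) F G"
proof -
  interpret B: symm_mon_category B by (rule symm_mon_functor.smc_cod[OF mon_nat_trans.smf_src]) fact
  interpret t: mon_nat_trans t F G A B by fact
  define u where "u = \<lparr>nsrc = G, ntgt = F, ncmp = (\<lambda>a\<in>obj A. inv_arr B (ncmp t a))\<rparr>"
  note i [simp] = B.iso_facts(6-)[OF assms(2)]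
  interpret u: mon_nat_trans u G F A B
  proof (rule mon_nat_transI)
    fix f assume [simp]: "f \<in> arr A"
    show "ncmp u (tgt A f) \<cdot>\<^bsub>B\<^esub> farr G f = farr F f \<cdot>\<^bsub>B\<^esub> ncmp u (src A f)"
    proof (rule B.iso_cancel_left[OF assms(2)[of "tgt A f"]])
      show "ncmp t (tgt A f) \<cdot>\<^bsub>B\<^esub> ncmp u (tgt A f) \<cdot>\<^bsub>B\<^esub> farr G f =
          ncmp t (tgt A f) \<cdot>\<^bsub>B\<^esub> farr F f \<cdot>\<^bsub>B\<^esub> ncmp u (src A f)"
        using B.cmp_extend1[of "ncmp t (tgt A f)" "inv_arr B (ncmp t (tgt A f))" _ "farr G f"]
          B.cmp_extend[OF t.ncmp_nat[of f], of "inv_arr B (ncmp t (src A f))"] by (simp add: u_def)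
    qed (auto simp: u_def)
  next
    show "ncmp u (un A) \<cdot>\<^bsub>B\<^esub> fzero G = fzero F"
      using B.cmp_extend1[of "inv_arr B (ncmp t (un A))" "ncmp t (un A)" _ "fzero F"]
      by (simp add: u_def flip: t.ncmp_zero)
  next
    fix a b assume [simp]: "a \<in> obj A" "b \<in> obj A"
    let ?ab = "a \<otimes>\<^bsub>A\<^esub> b"
    show "ncmp u ?ab \<cdot>\<^bsub>B\<^esub> ftwo G a b = ftwo F a b \<cdot>\<^bsub>B\<^esub> (ncmp u a \<boxtimes>\<^bsub>B\<^esub> ncmp u b)"
    proof (rule B.iso_cancel_left[OF assms(2)[of ?ab]])
      show "ncmp t ?ab \<cdot>\<^bsub>B\<^esub> ncmp u ?ab \<cdot>\<^bsub>B\<^esub> ftwo G a b =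
          ncmp t ?ab \<cdot>\<^bsub>B\<^esub> ftwo F a b \<cdot>\<^bsub>B\<^esub> (ncmp u a \<boxtimes>\<^bsub>B\<^esub> ncmp u b)"
        using B.cmp_extend1[of "ncmp t ?ab" "inv_arr B (ncmp t ?ab)" _ "ftwo G a b"]
          B.cmp_extend[OF t.ncmp_two[of a b], of "inv_arr B (ncmp t a) \<boxtimes>\<^bsub>B\<^esub> inv_arr B (ncmp t b)"]
        by (simp add: u_def B.tena_fold)
    qed (auto simp: u_def)
  qed (auto simp: u_def t.smf_src t.smf_tgt)
  have "vcomp_nt u t = id_nt F" "vcomp_nt t u = id_nt G"
    by (rule nt_eqI[of _ _ "obj A"]; simp add: u_def)+
  then have "inverse_pair (hom_smc A B) t u"
    unfolding inverse_pair_def hom_def by (simp add: t.smf_src t.smf_tgt)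
  then show ?thesis by (auto simp: isos_def hom_def)
qed

text \<open>Each axiom holds because it holds in \<open>B\<close> at every object of \<open>A\<close>. The closure of monoidal
  transformations under the operations carries the content.\<close>

lemma hom_smc_smc:
  assumes "symm_mon_category A" "symm_mon_category B"
  shows "symm_mon_category (hom_smc A B)" (is "symm_mon_category ?H")
proof -
  interpret A: symm_mon_category A by fact
  interpret B: symm_mon_category B by fact
  note [simp] = assms
  show ?thesis
  proof (intro symm_mon_category.intro category.intro symm_mon_category_axioms.intro)
    show "src ?H \<in> arr ?H \<rightarrow>\<^sub>E obj ?H" "tgt ?H \<in> arr ?H \<rightarrow>\<^sub>E obj ?H"
      by (auto simp: PiE_iff) (auto simp: hom_smc_def Let_def)
    show "idn ?H \<in> (\<Pi>\<^sub>E F\<in>obj ?H. hom ?H F F)"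
      by (auto simp: PiE_iff hom_smc_hom id_nt_trans) (auto simp: hom_smc_def Let_def)
    show "cmp ?H \<in> (\<Pi>\<^sub>E g\<in>arr ?H. \<Pi>\<^sub>E f\<in>{f \<in> arr ?H. tgt ?H f = src ?H g}. hom ?H (src ?H f) (tgt ?H g))"
      by (auto simp: PiE_iff hom_def) (auto simp: hom_smc_def Let_def extensional_def)
    show "ten ?H \<in> obj ?H \<rightarrow>\<^sub>E obj ?H \<rightarrow>\<^sub>E obj ?H"
      by (auto simp: PiE_iff) (auto simp: hom_smc_def Let_def)
    show "tena ?H \<in> (\<Pi>\<^sub>E f\<in>arr ?H. \<Pi>\<^sub>E g\<in>arr ?H. hom ?H (ten ?H (src ?H f) (src ?H g)) (ten ?H (tgt ?H f) (tgt ?H g)))"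
      by (auto simp: PiE_iff hom_def) (auto simp: hom_smc_def Let_def)
    show "un ?H \<in> obj ?H" by simp
    have ext: "ass ?H \<in> extensional (obj ?H)"
      "ass ?H F \<in> extensional (obj ?H)" "ass ?H F G \<in> extensional (obj ?H)"
      "run ?H \<in> extensional (obj ?H)" "lun ?H \<in> extensional (obj ?H)"
      "swp ?H \<in> extensional (obj ?H)" "swp ?H F \<in> extensional (obj ?H)"
      if "symm_mon_functor F A B" "symm_mon_functor G A B" for F G
      using that by (auto simp: hom_smc_def Let_def)
    have iso: "ass ?H F G K \<in> isos ?H (F \<box> (G \<box> K)) ((F \<box> G) \<box> K)"
      "run ?H F \<in> isos ?H (F \<box> unit_smf A B) F" "lun ?H F \<in> isos ?H (unit_smf A B \<box> F) F"
      "swp ?H F G \<in> isos ?H (F \<box> G) (G \<box> F)"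
      if F: "symm_mon_functor F A B" and G: "symm_mon_functor G A B" and K: "symm_mon_functor K A B" for F G K
    proof -
      interpret F: symm_mon_functor F A B by fact
      interpret G: symm_mon_functor G A B by fact
      interpret K: symm_mon_functor K A B by fact
      show "ass ?H F G K \<in> isos ?H (F \<box> (G \<box> K)) ((F \<box> G) \<box> K)"
        "run ?H F \<in> isos ?H (F \<box> unit_smf A B) F" "lun ?H F \<in> isos ?H (unit_smf A B \<box> F) F"
        "swp ?H F G \<in> isos ?H (F \<box> G) (G \<box> F)"
        using hom_smc_ass(5)[OF F G K] hom_smc_run(5)[OF F] hom_smc_lun(5)[OF F] hom_smc_swp(5)[OF F G]
        by (intro pointwise_iso; simp add: hom_smc_arr F G K B.ass_iso B.run_iso B.lun_iso B.swp_iso)+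
    qed
    show "ass ?H \<in> (\<Pi>\<^sub>E a\<in>obj ?H. \<Pi>\<^sub>E b\<in>obj ?H. \<Pi>\<^sub>E c\<in>obj ?H. isos ?H (ten ?H a (ten ?H b c)) (ten ?H (ten ?H a b) c))"
      "run ?H \<in> (\<Pi>\<^sub>E a\<in>obj ?H. isos ?H (ten ?H a (un ?H)) a)"
      "lun ?H \<in> (\<Pi>\<^sub>E a\<in>obj ?H. isos ?H (ten ?H (un ?H) a) a)"
      "swp ?H \<in> (\<Pi>\<^sub>E a\<in>obj ?H. \<Pi>\<^sub>E b\<in>obj ?H. isos ?H (ten ?H a b) (ten ?H b a))"
      using iso ext ext[OF unit_smf_functor[OF assms] unit_smf_functor[OF assms]] by (auto simp: PiE_iff)
  next
    fix f F G assume "f \<in> hom ?H F G"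
    then interpret f: mon_nat_trans f F G A B by (simp add: hom_smc_hom)
    note [simp] = f.smf_src f.smf_tgt
    have "run B (fobj G a) \<cdot>\<^bsub>B\<^esub> (ncmp f a \<boxtimes>\<^bsub>B\<^esub> idn B (un B)) = ncmp f a \<cdot>\<^bsub>B\<^esub> run B (fobj F a)"
      "lun B (fobj G a) \<cdot>\<^bsub>B\<^esub> (idn B (un B) \<boxtimes>\<^bsub>B\<^esub> ncmp f a) = ncmp f a \<cdot>\<^bsub>B\<^esub> lun B (fobj F a)"
      if "a \<in> obj A" for a
      using B.run_nat[of "ncmp f a"] B.lun_nat[of "ncmp f a"] that by simp_all
    then show "cmp ?H (idn ?H G) f = f" "cmp ?H f (idn ?H F) = f"
      "cmp ?H (run ?H G) (tena ?H f (idn ?H (un ?H))) = cmp ?H f (run ?H F)"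
      "cmp ?H (lun ?H G) (tena ?H (idn ?H (un ?H)) f) = cmp ?H f (lun ?H F)"
      by (auto intro!: nt_eqI[of _ _ "obj A"])
  next
    fix f F G g K h L assume "f \<in> hom ?H F G" "g \<in> hom ?H G K" "h \<in> hom ?H K L"
    then interpret f: mon_nat_trans f F G A B + g: mon_nat_trans g G K A B + h: mon_nat_trans h K L A B
      by (simp_all add: hom_smc_hom)
    note [simp] = f.smf_src f.smf_tgt g.smf_tgt h.smf_tgt
    show "cmp ?H (cmp ?H h g) f = cmp ?H h (cmp ?H g f)"
      by (rule nt_eqI[of _ _ "obj A"]) auto
  next
    fix F G assume "F \<in> obj ?H" "G \<in> obj ?H"
    then interpret F: symm_mon_functor F A B + G: symm_mon_functor G A B by simp_all
    note [simp] = F.symm_mon_functor_axioms G.symm_mon_functor_axioms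
    show "tena ?H (idn ?H F) (idn ?H G) = idn ?H (ten ?H F G)"
      "cmp ?H (tena ?H (run ?H F) (idn ?H G)) (ass ?H F (un ?H) G) = tena ?H (idn ?H F) (lun ?H G)"
      "cmp ?H (swp ?H G F) (swp ?H F G) = idn ?H (ten ?H F G)"
      "cmp ?H (lun ?H F) (swp ?H F (un ?H)) = run ?H F"
      by (auto intro!: nt_eqI[of _ _ "obj A"] simp: B.triangle B.swp_swp B.lun_swp)
  next
    show "lun ?H (un ?H) = run ?H (un ?H)"
      by (auto intro!: nt_eqI[of _ _ "obj A"] simp: B.lun_run_un)
  next
    fix f F G g K f' F' G' g' K'
    assume "f \<in> hom ?H F G" "g \<in> hom ?H G K" "f' \<in> hom ?H F' G'" "g' \<in> hom ?H G' K'"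
    then interpret f: mon_nat_trans f F G A B + g: mon_nat_trans g G K A B +
      f': mon_nat_trans f' F' G' A B + g': mon_nat_trans g' G' K' A B
      by (simp_all add: hom_smc_hom)
    show "tena ?H (cmp ?H g f) (cmp ?H g' f') = cmp ?H (tena ?H g g') (tena ?H f f')"
      by (auto intro!: nt_eqI[of _ _ "obj A"] simp: B.tena_fold)
  next
    fix f F F' g G G' h K K' assume "f \<in> hom ?H F F'" "g \<in> hom ?H G G'" "h \<in> hom ?H K K'"
    then interpret f: mon_nat_trans f F F' A B + g: mon_nat_trans g G G' A B + h: mon_nat_trans h K K' A B
      by (simp_all add: hom_smc_hom)
    note [simp] = f.smf_src f.smf_tgt g.smf_src g.smf_tgt h.smf_src h.smf_tgt
    have "ass B (fobj F' a) (fobj G' a) (fobj K' a) \<cdot>\<^bsub>B\<^esub> (ncmp f a \<boxtimes>\<^bsub>B\<^esub> (ncmp g a \<boxtimes>\<^bsub>B\<^esub> ncmp h a)) =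
      ((ncmp f a \<boxtimes>\<^bsub>B\<^esub> ncmp g a) \<boxtimes>\<^bsub>B\<^esub> ncmp h a) \<cdot>\<^bsub>B\<^esub> ass B (fobj F a) (fobj G a) (fobj K a)"
      if "a \<in> obj A" for a
      using B.ass_nat[of "ncmp f a" "ncmp g a" "ncmp h a"] that by simp
    then show "cmp ?H (ass ?H F' G' K') (tena ?H f (tena ?H g h)) = cmp ?H (tena ?H (tena ?H f g) h) (ass ?H F G K)"
      by (auto intro!: nt_eqI[of _ _ "obj A"])
  next
    fix f F F' g G G' assume "f \<in> hom ?H F F'" "g \<in> hom ?H G G'"
    then interpret f: mon_nat_trans f F F' A B + g: mon_nat_trans g G G' A B
      by (simp_all add: hom_smc_hom)
    note [simp] = f.smf_src f.smf_tgt g.smf_src g.smf_tgt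
    have "swp B (fobj F' a) (fobj G' a) \<cdot>\<^bsub>B\<^esub> (ncmp f a \<boxtimes>\<^bsub>B\<^esub> ncmp g a) =
      (ncmp g a \<boxtimes>\<^bsub>B\<^esub> ncmp f a) \<cdot>\<^bsub>B\<^esub> swp B (fobj F a) (fobj G a)" if "a \<in> obj A" for a
      using B.swp_nat[of "ncmp f a" "ncmp g a"] that by simp
    then show "cmp ?H (swp ?H F' G') (tena ?H f g) = cmp ?H (tena ?H g f) (swp ?H F G)"
      by (auto intro!: nt_eqI[of _ _ "obj A"])
  next
    fix F G K assume "F \<in> obj ?H" "G \<in> obj ?H" "K \<in> obj ?H"
    then interpret F: symm_mon_functor F A B + G: symm_mon_functor G A B + K: symm_mon_functor K A B by simp_all
    note [simp] = F.symm_mon_functor_axioms G.symm_mon_functor_axioms K.symm_mon_functor_axioms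
    show "cmp ?H (ass ?H K F G) (cmp ?H (swp ?H (ten ?H F G) K) (ass ?H F G K)) =
      cmp ?H (tena ?H (swp ?H F K) (idn ?H G)) (cmp ?H (ass ?H F K G) (tena ?H (idn ?H F) (swp ?H G K)))"
      by (auto intro!: nt_eqI[of _ _ "obj A"] simp: B.hexagon)
    fix L assume "L \<in> obj ?H"
    then interpret L: symm_mon_functor L A B by simp
    note [simp] = L.symm_mon_functor_axioms
    show "cmp ?H (ass ?H (ten ?H F G) K L) (ass ?H F G (ten ?H K L)) =
      cmp ?H (tena ?H (ass ?H F G K) (idn ?H L)) (cmp ?H (ass ?H F (ten ?H G K) L) (tena ?H (idn ?H F) (ass ?H G K L)))"
      by (auto intro!: nt_eqI[of _ _ "obj A"] simp: B.pentagon)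
  qed
qed

section \<open>Lax functors and the interchange\<close>

context symm_mon_functor begin

text \<open>Nested to the left, the composite of two instances of \<open>F\<^sup>2\<close> multiplies the first two factors first,
  where the symmetry axiom of \<open>F\<close> applies. The associativity axiom translates between the two nestings.\<close>

lemma lax_mid:
  assumes [simp]: "x \<in> obj A" "y \<in> obj A" "z \<in> obj A"
  shows "farr F (dom.mid x y z) \<cdot>\<^bsub>B\<^esub> ftwo F x (y \<otimes>\<^bsub>A\<^esub> z) \<cdot>\<^bsub>B\<^esub> (idn B (fobj F x) \<boxtimes>\<^bsub>B\<^esub> ftwo F y z) =
    ftwo F y (x \<otimes>\<^bsub>A\<^esub> z) \<cdot>\<^bsub>B\<^esub> (idn B (fobj F y) \<boxtimes>\<^bsub>B\<^esub> ftwo F x z) \<cdot>\<^bsub>B\<^esub> cod.mid (fobj F x) (fobj F y) (fobj F z)"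
proof -
  let ?x = "fobj F x" and ?y = "fobj F y" and ?z = "fobj F z"
  let ?s = "swp B ?x ?y \<boxtimes>\<^bsub>B\<^esub> idn B ?z"
  have "farr F (swp A x y \<boxtimes>\<^bsub>A\<^esub> idn A z) \<cdot>\<^bsub>B\<^esub> farr F (ass A x y z) \<cdot>\<^bsub>B\<^esub> ftwo F x (y \<otimes>\<^bsub>A\<^esub> z) \<cdot>\<^bsub>B\<^esub> (idn B ?x \<boxtimes>\<^bsub>B\<^esub> ftwo F y z)
     = farr F (swp A x y \<boxtimes>\<^bsub>A\<^esub> idn A z) \<cdot>\<^bsub>B\<^esub> ftwo F (x \<otimes>\<^bsub>A\<^esub> y) z \<cdot>\<^bsub>B\<^esub> (ftwo F x y \<boxtimes>\<^bsub>B\<^esub> idn B ?z) \<cdot>\<^bsub>B\<^esub> ass B ?x ?y ?z"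
    by (simp add: ftwo_ass)
  also have "\<dots> = ftwo F (y \<otimes>\<^bsub>A\<^esub> x) z \<cdot>\<^bsub>B\<^esub> (farr F (swp A x y) \<boxtimes>\<^bsub>B\<^esub> idn B ?z) \<cdot>\<^bsub>B\<^esub> (ftwo F x y \<boxtimes>\<^bsub>B\<^esub> idn B ?z) \<cdot>\<^bsub>B\<^esub> ass B ?x ?y ?z"
    using cod.cmp_extend[OF ftwo_nat[of "swp A x y" "idn A z"], of "(ftwo F x y \<boxtimes>\<^bsub>B\<^esub> idn B ?z) \<cdot>\<^bsub>B\<^esub> ass B ?x ?y ?z"] by simp
  also have "\<dots> = ftwo F (y \<otimes>\<^bsub>A\<^esub> x) z \<cdot>\<^bsub>B\<^esub> (ftwo F y x \<boxtimes>\<^bsub>B\<^esub> idn B ?z) \<cdot>\<^bsub>B\<^esub> ?s \<cdot>\<^bsub>B\<^esub> ass B ?x ?y ?z"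
    by (simp add: cod.tena_fold2 ftwo_swp)
  finally have 1: "farr F (swp A x y \<boxtimes>\<^bsub>A\<^esub> idn A z) \<cdot>\<^bsub>B\<^esub> farr F (ass A x y z) \<cdot>\<^bsub>B\<^esub> ftwo F x (y \<otimes>\<^bsub>A\<^esub> z) \<cdot>\<^bsub>B\<^esub> (idn B ?x \<boxtimes>\<^bsub>B\<^esub> ftwo F y z) = \<dots>" .
  have "ftwo F (y \<otimes>\<^bsub>A\<^esub> x) z \<cdot>\<^bsub>B\<^esub> (ftwo F y x \<boxtimes>\<^bsub>B\<^esub> idn B ?z) =
    (ftwo F (y \<otimes>\<^bsub>A\<^esub> x) z \<cdot>\<^bsub>B\<^esub> (ftwo F y x \<boxtimes>\<^bsub>B\<^esub> idn B ?z) \<cdot>\<^bsub>B\<^esub> ass B ?y ?x ?z) \<cdot>\<^bsub>B\<^esub> cod.asi ?y ?x ?z"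
    by simp
  also have "\<dots> = farr F (ass A y x z) \<cdot>\<^bsub>B\<^esub> ftwo F y (x \<otimes>\<^bsub>A\<^esub> z) \<cdot>\<^bsub>B\<^esub> (idn B ?y \<boxtimes>\<^bsub>B\<^esub> ftwo F x z) \<cdot>\<^bsub>B\<^esub> cod.asi ?y ?x ?z"
    by (simp only: ftwo_ass assms) simp
  finally have "farr F (dom.asi y x z) \<cdot>\<^bsub>B\<^esub> ftwo F (y \<otimes>\<^bsub>A\<^esub> x) z \<cdot>\<^bsub>B\<^esub> (ftwo F y x \<boxtimes>\<^bsub>B\<^esub> idn B ?z) =
    farr F (dom.asi y x z) \<cdot>\<^bsub>B\<^esub> farr F (ass A y x z) \<cdot>\<^bsub>B\<^esub> ftwo F y (x \<otimes>\<^bsub>A\<^esub> z) \<cdot>\<^bsub>B\<^esub> (idn B ?y \<boxtimes>\<^bsub>B\<^esub> ftwo F x z) \<cdot>\<^bsub>B\<^esub> cod.asi ?y ?x ?z"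
    by simp
  also have "\<dots> = ftwo F y (x \<otimes>\<^bsub>A\<^esub> z) \<cdot>\<^bsub>B\<^esub> (idn B ?y \<boxtimes>\<^bsub>B\<^esub> ftwo F x z) \<cdot>\<^bsub>B\<^esub> cod.asi ?y ?x ?z"
    by (subst cod.cmp_extend1[of _ _ "idn B (fobj F (y \<otimes>\<^bsub>A\<^esub> (x \<otimes>\<^bsub>A\<^esub> z)))"]) (simp_all flip: farr_comp)
  finally have 2: "farr F (dom.asi y x z) \<cdot>\<^bsub>B\<^esub> ftwo F (y \<otimes>\<^bsub>A\<^esub> x) z \<cdot>\<^bsub>B\<^esub> (ftwo F y x \<boxtimes>\<^bsub>B\<^esub> idn B ?z) = \<dots>" .
  show ?thesis
    using cod.cmp_extend1[of "farr F (dom.asi y x z)" "ftwo F (y \<otimes>\<^bsub>A\<^esub> x) z \<cdot>\<^bsub>B\<^esub> (ftwo F y x \<boxtimes>\<^bsub>B\<^esub> idn B ?z)" _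
        "?s \<cdot>\<^bsub>B\<^esub> ass B ?x ?y ?z", OF 2]
    by (simp add: dom.mid_def cod.mid_def 1)
qed

text \<open>Both \<open>F\<^sup>2 \<cdot> (F\<^sup>2 \<otimes> F\<^sup>2)\<close> and the right-nested composite of instances of \<open>F\<^sup>2\<close> multiply four factors, and
  \<open>F\<close> of an associativity arrow relates them. The interchange may thus be moved to right-nested
  products, where it is a transposition and \<open>lax_mid\<close> applies.\<close>

lemma lax_interchange:
  assumes [simp]: "a \<in> obj A" "b \<in> obj A" "c \<in> obj A" "d \<in> obj A"
  shows "ftwo F (a \<otimes>\<^bsub>A\<^esub> c) (b \<otimes>\<^bsub>A\<^esub> d) \<cdot>\<^bsub>B\<^esub> (ftwo F a c \<boxtimes>\<^bsub>B\<^esub> ftwo F b d) \<cdot>\<^bsub>B\<^esub>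
      interchange B (fobj F a) (fobj F b) (fobj F c) (fobj F d) =
    farr F (interchange A a b c d) \<cdot>\<^bsub>B\<^esub> ftwo F (a \<otimes>\<^bsub>A\<^esub> b) (c \<otimes>\<^bsub>A\<^esub> d) \<cdot>\<^bsub>B\<^esub> (ftwo F a b \<boxtimes>\<^bsub>B\<^esub> ftwo F c d)"
proof -
  let ?w = "\<lambda>x y u v. ftwo F x (y \<otimes>\<^bsub>A\<^esub> (u \<otimes>\<^bsub>A\<^esub> v)) \<cdot>\<^bsub>B\<^esub> (idn B (fobj F x) \<boxtimes>\<^bsub>B\<^esub> (ftwo F y (u \<otimes>\<^bsub>A\<^esub> v) \<cdot>\<^bsub>B\<^esub> (idn B (fobj F y) \<boxtimes>\<^bsub>B\<^esub> ftwo F u v)))"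
  let ?m = "\<lambda>x y u v. ftwo F (x \<otimes>\<^bsub>A\<^esub> y) (u \<otimes>\<^bsub>A\<^esub> v) \<cdot>\<^bsub>B\<^esub> (ftwo F x y \<boxtimes>\<^bsub>B\<^esub> ftwo F u v)"
  let ?A = "\<lambda>x y u v. ass B (fobj F x) (fobj F y) (fobj F u \<otimes>\<^bsub>B\<^esub> fobj F v)"
  have m: "?m x y u v \<cdot>\<^bsub>B\<^esub> ?A x y u v = farr F (ass A x y (u \<otimes>\<^bsub>A\<^esub> v)) \<cdot>\<^bsub>B\<^esub> ?w x y u v"
    if [simp]: "x \<in> obj A" "y \<in> obj A" "u \<in> obj A" "v \<in> obj A" for x y u v
  proof -
    let ?k = "idn B (fobj F x) \<boxtimes>\<^bsub>B\<^esub> (idn B (fobj F y) \<boxtimes>\<^bsub>B\<^esub> ftwo F u v)"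
    let ?uv = "u \<otimes>\<^bsub>A\<^esub> v"
    have "?m x y u v \<cdot>\<^bsub>B\<^esub> ?A x y u v = ftwo F (x \<otimes>\<^bsub>A\<^esub> y) ?uv \<cdot>\<^bsub>B\<^esub> (ftwo F x y \<boxtimes>\<^bsub>B\<^esub> idn B (fobj F ?uv)) \<cdot>\<^bsub>B\<^esub>
        ((idn B (fobj F x) \<boxtimes>\<^bsub>B\<^esub> idn B (fobj F y)) \<boxtimes>\<^bsub>B\<^esub> ftwo F u v) \<cdot>\<^bsub>B\<^esub> ?A x y u v"
      by (simp add: cod.tena_fold2)
    also have "\<dots> = (ftwo F (x \<otimes>\<^bsub>A\<^esub> y) ?uv \<cdot>\<^bsub>B\<^esub> (ftwo F x y \<boxtimes>\<^bsub>B\<^esub> idn B (fobj F ?uv)) \<cdot>\<^bsub>B\<^esub> ass B (fobj F x) (fobj F y) (fobj F ?uv)) \<cdot>\<^bsub>B\<^esub> ?k"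
      using cod.ass_nat[of "idn B (fobj F x)" "idn B (fobj F y)" "ftwo F u v"] by simp
    also have "\<dots> = farr F (ass A x y ?uv) \<cdot>\<^bsub>B\<^esub> ?w x y u v"
      by (simp only: ftwo_ass that dom.ten_obj) (simp add: cod.tena_fold)
    finally show ?thesis .
  qed
  have wi: "farr F (idn A a \<boxtimes>\<^bsub>A\<^esub> dom.mid b c d) \<cdot>\<^bsub>B\<^esub> ?w a b c d =
      ?w a c b d \<cdot>\<^bsub>B\<^esub> (idn B (fobj F a) \<boxtimes>\<^bsub>B\<^esub> cod.mid (fobj F b) (fobj F c) (fobj F d))"
    using cod.cmp_extend[OF ftwo_nat[of "idn A a" "dom.mid b c d"],
        of "idn B (fobj F a) \<boxtimes>\<^bsub>B\<^esub> (ftwo F b (c \<otimes>\<^bsub>A\<^esub> d) \<cdot>\<^bsub>B\<^esub> (idn B (fobj F b) \<boxtimes>\<^bsub>B\<^esub> ftwo F c d))"]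
    by (simp add: cod.tena_fold lax_mid)
  let ?K = "(idn B (fobj F a) \<boxtimes>\<^bsub>B\<^esub> cod.mid (fobj F b) (fobj F c) (fobj F d)) \<cdot>\<^bsub>B\<^esub> inv_arr B (?A a b c d)"
  have "?m a c b d \<cdot>\<^bsub>B\<^esub> interchange B (fobj F a) (fobj F b) (fobj F c) (fobj F d) = (?m a c b d \<cdot>\<^bsub>B\<^esub> ?A a c b d) \<cdot>\<^bsub>B\<^esub> ?K"
    by (simp add: cod.interchange_mid)
  also have "\<dots> = farr F (ass A a c (b \<otimes>\<^bsub>A\<^esub> d)) \<cdot>\<^bsub>B\<^esub> (?w a c b d \<cdot>\<^bsub>B\<^esub> (idn B (fobj F a) \<boxtimes>\<^bsub>B\<^esub> cod.mid (fobj F b) (fobj F c) (fobj F d))) \<cdot>\<^bsub>B\<^esub> inv_arr B (?A a b c d)"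
    unfolding m[OF assms(1,3,2,4)] by simp
  also have "\<dots> = farr F (ass A a c (b \<otimes>\<^bsub>A\<^esub> d)) \<cdot>\<^bsub>B\<^esub> farr F (idn A a \<boxtimes>\<^bsub>A\<^esub> dom.mid b c d) \<cdot>\<^bsub>B\<^esub> ?w a b c d \<cdot>\<^bsub>B\<^esub> inv_arr B (?A a b c d)"
    unfolding wi[symmetric] by simp
  also have "?w a b c d \<cdot>\<^bsub>B\<^esub> inv_arr B (?A a b c d) = farr F (dom.asi a b (c \<otimes>\<^bsub>A\<^esub> d)) \<cdot>\<^bsub>B\<^esub> ?m a b c d"
  proof -
    have i: "farr F (dom.asi a b (c \<otimes>\<^bsub>A\<^esub> d)) \<cdot>\<^bsub>B\<^esub> farr F (ass A a b (c \<otimes>\<^bsub>A\<^esub> d)) = idn B (fobj F (a \<otimes>\<^bsub>A\<^esub> (b \<otimes>\<^bsub>A\<^esub> (c \<otimes>\<^bsub>A\<^esub> d))))"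
      by (simp flip: farr_comp)
    have "farr F (dom.asi a b (c \<otimes>\<^bsub>A\<^esub> d)) \<cdot>\<^bsub>B\<^esub> ?m a b c d =
      farr F (dom.asi a b (c \<otimes>\<^bsub>A\<^esub> d)) \<cdot>\<^bsub>B\<^esub> (?m a b c d \<cdot>\<^bsub>B\<^esub> ?A a b c d) \<cdot>\<^bsub>B\<^esub> inv_arr B (?A a b c d)"
      by simp
    also have "\<dots> = ?w a b c d \<cdot>\<^bsub>B\<^esub> inv_arr B (?A a b c d)"
      unfolding m[OF assms] using cod.cmp_extend1[OF i, of "?w a b c d \<cdot>\<^bsub>B\<^esub> inv_arr B (?A a b c d)"] by simp
    finally show ?thesis by simp
  qed
  finally show ?thesis by (simp add: dom.interchange_mid)
qed

lemma lax_un: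
  "farr F (lun A (un A)) \<cdot>\<^bsub>B\<^esub> ftwo F (un A) (un A) \<cdot>\<^bsub>B\<^esub> (fzero F \<boxtimes>\<^bsub>B\<^esub> fzero F) = fzero F \<cdot>\<^bsub>B\<^esub> lun B (un B)"
proof -
  have "farr F (lun A (un A)) \<cdot>\<^bsub>B\<^esub> ftwo F (un A) (un A) \<cdot>\<^bsub>B\<^esub> (fzero F \<boxtimes>\<^bsub>B\<^esub> fzero F) =
    (farr F (lun A (un A)) \<cdot>\<^bsub>B\<^esub> ftwo F (un A) (un A) \<cdot>\<^bsub>B\<^esub> (fzero F \<boxtimes>\<^bsub>B\<^esub> idn B (fobj F (un A)))) \<cdot>\<^bsub>B\<^esub> (idn B (un B) \<boxtimes>\<^bsub>B\<^esub> fzero F)"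
    by (simp add: cod.tena_fold)
  also have "\<dots> = fzero F \<cdot>\<^bsub>B\<^esub> lun B (un B)"
    using cod.lun_nat[of "fzero F"] by (simp only: ftwo_lun dom.un_obj) simp
  finally show ?thesis .
qed

lemma lax_un_inv:
  "ftwo F (un A) (un A) \<cdot>\<^bsub>B\<^esub> (fzero F \<boxtimes>\<^bsub>B\<^esub> fzero F) \<cdot>\<^bsub>B\<^esub> inv_arr B (lun B (un B)) =
   farr F (inv_arr A (lun A (un A))) \<cdot>\<^bsub>B\<^esub> fzero F"
proof -
  let ?k = "inv_arr B (lun B (un B))" and ?l = "lun A (un A)" and ?m = "ftwo F (un A) (un A) \<cdot>\<^bsub>B\<^esub> (fzero F \<boxtimes>\<^bsub>B\<^esub> fzero F)"
  have i: "farr F (inv_arr A ?l) \<cdot>\<^bsub>B\<^esub> farr F ?l = idn B (fobj F (un A \<otimes>\<^bsub>A\<^esub> un A))"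
    by (simp flip: farr_comp)
  have "farr F (inv_arr A ?l) \<cdot>\<^bsub>B\<^esub> fzero F = farr F (inv_arr A ?l) \<cdot>\<^bsub>B\<^esub> (fzero F \<cdot>\<^bsub>B\<^esub> lun B (un B)) \<cdot>\<^bsub>B\<^esub> ?k"
    by simp
  also have "\<dots> = farr F (inv_arr A ?l) \<cdot>\<^bsub>B\<^esub> farr F ?l \<cdot>\<^bsub>B\<^esub> ?m \<cdot>\<^bsub>B\<^esub> ?k"
    unfolding lax_un[symmetric] by simp
  also have "\<dots> = ?m \<cdot>\<^bsub>B\<^esub> ?k"
    using cod.cmp_extend1[OF i, of "?m \<cdot>\<^bsub>B\<^esub> ?k"] by simp
  finally show ?thesis by simp
qed

end

lemma comp_smf_assoc:
  assumes "symm_mon_functor F A B" "symm_mon_functor G B C" "symm_mon_functor H C D"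
  shows "(H \<circ>\<^sub>F G) \<circ>\<^sub>F F = H \<circ>\<^sub>F (G \<circ>\<^sub>F F)"
proof -
  interpret F: symm_mon_functor F A B by fact
  interpret G: symm_mon_functor G B C by fact
  interpret H: symm_mon_functor H C D by fact
  show ?thesis
    by (rule smf_eqI[OF comp_smf_functor[OF assms(1) comp_smf_functor[OF assms(2,3)]]
          comp_smf_functor[OF comp_smf_functor[OF assms(1,2)] assms(3)]]) simp_all
qed

text \<open>Equality, and not just isomorphism: both sides have the same components because \<open>F\<close> is applied
  before the product is formed.\<close>

lemma box_comp:
  assumes "symm_mon_functor F C A" "symm_mon_functor H A B" "symm_mon_functor K A B"
  shows "(H \<box> K) \<circ>\<^sub>F F = (H \<circ>\<^sub>F F) \<box> (K \<circ>\<^sub>F F)"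
proof -
  interpret B: symm_mon_category B by (rule symm_mon_functor.smc_cod) fact
  interpret F: symm_mon_functor F C A by fact
  interpret H: symm_mon_functor H A B by fact
  interpret K: symm_mon_functor K A B by fact
  show ?thesis
    by (rule smf_eqI[OF comp_smf_functor[OF assms(1) box_smf_functor[OF assms(2,3)]]
          box_smf_functor[OF comp_smf_functor[OF assms(1,2)] comp_smf_functor[OF assms(1,3)]]])
      (simp_all add: B.tena_fold B.tena_fold2)
qed

lemma unit_comp:
  assumes "symm_mon_functor F C A" "symm_mon_category B"
  shows "unit_smf A B \<circ>\<^sub>F F = unit_smf C B"
proof -
  interpret F: symm_mon_functor F C A by fact
  interpret B: symm_mon_category B by fact
  show ?thesis
    by (rule smf_eqI[OF comp_smf_functor[OF assms(1) unit_smf_functor[OF F.smc_cod assms(2)]]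
          unit_smf_functor[OF F.smc_dom assms(2)]]) simp_all
qed

text \<open>Laxness of \<open>G\<close> is a monoidal transformation; the condition on \<open>ftwo\<close> is that \<open>G\<close> commutes with
  the interchange.\<close>

lemma comp_box_trans:
  assumes "symm_mon_functor P C B" "symm_mon_functor Q C B" "symm_mon_functor G B D"
  shows "mon_nat_trans \<lparr>nsrc = (G \<circ>\<^sub>F P) \<box> (G \<circ>\<^sub>F Q), ntgt = G \<circ>\<^sub>F (P \<box> Q),
     ncmp = (\<lambda>c\<in>obj C. ftwo G (fobj P c) (fobj Q c))\<rparr> ((G \<circ>\<^sub>F P) \<box> (G \<circ>\<^sub>F Q)) (G \<circ>\<^sub>F (P \<box> Q)) C D"
    (is "mon_nat_trans ?t ?S ?T C D")
proof -
  interpret D: symm_mon_category D by (rule symm_mon_functor.smc_cod) fact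
  interpret B: symm_mon_category B by (rule symm_mon_functor.smc_cod) fact
  interpret P: symm_mon_functor P C B by fact
  interpret Q: symm_mon_functor Q C B by fact
  interpret G: symm_mon_functor G B D by fact
  show ?thesis
  proof (rule mon_nat_transI)
    show "symm_mon_functor ((G \<circ>\<^sub>F P) \<box> (G \<circ>\<^sub>F Q)) C D" "symm_mon_functor (G \<circ>\<^sub>F (P \<box> Q)) C D"
      by (rule box_smf_functor[OF comp_smf_functor[OF assms(1,3)] comp_smf_functor[OF assms(2,3)]])
        (rule comp_smf_functor[OF box_smf_functor[OF assms(1,2)] assms(3)])
  next
    fix f
    assume "f \<in> arr C"
    then show "ncmp ?t (tgt C f) \<cdot>\<^bsub>D\<^esub> farr ?S f = farr ?T f \<cdot>\<^bsub>D\<^esub> ncmp ?t (src C f)"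
      using G.ftwo_nat[of "farr P f" "farr Q f"] by simp
  next
    let ?k = "inv_arr D (lun D (un D))"
    have "ftwo G (fobj P (un C)) (fobj Q (un C)) \<cdot>\<^bsub>D\<^esub> ((farr G (fzero P) \<cdot>\<^bsub>D\<^esub> fzero G) \<boxtimes>\<^bsub>D\<^esub> (farr G (fzero Q) \<cdot>\<^bsub>D\<^esub> fzero G)) \<cdot>\<^bsub>D\<^esub> ?k =
      ftwo G (fobj P (un C)) (fobj Q (un C)) \<cdot>\<^bsub>D\<^esub> (farr G (fzero P) \<boxtimes>\<^bsub>D\<^esub> farr G (fzero Q)) \<cdot>\<^bsub>D\<^esub> (fzero G \<boxtimes>\<^bsub>D\<^esub> fzero G) \<cdot>\<^bsub>D\<^esub> ?k"
      by (simp add: D.tena_fold2)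
    also have "\<dots> = farr G (fzero P \<boxtimes>\<^bsub>B\<^esub> fzero Q) \<cdot>\<^bsub>D\<^esub> farr G (inv_arr B (lun B (un B))) \<cdot>\<^bsub>D\<^esub> fzero G"
      using D.cmp_extend[OF G.ftwo_nat[of "fzero P" "fzero Q"], of "(fzero G \<boxtimes>\<^bsub>D\<^esub> fzero G) \<cdot>\<^bsub>D\<^esub> ?k"]
      by (simp add: G.lax_un_inv)
    finally show "ncmp ?t (un C) \<cdot>\<^bsub>D\<^esub> fzero ?S = fzero ?T" by simp
  next
    fix a b assume [simp]: "a \<in> obj C" "b \<in> obj C"
    let ?i = "interchange D (fobj G (fobj P a)) (fobj G (fobj Q a)) (fobj G (fobj P b)) (fobj G (fobj Q b))"
    let ?m = "(ftwo G (fobj P a) (fobj P b) \<boxtimes>\<^bsub>D\<^esub> ftwo G (fobj Q a) (fobj Q b)) \<cdot>\<^bsub>D\<^esub> ?i"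
    let ?ab = "a \<otimes>\<^bsub>C\<^esub> b"
    have "ftwo G (fobj P ?ab) (fobj Q ?ab) \<cdot>\<^bsub>D\<^esub>
        ((farr G (ftwo P a b) \<cdot>\<^bsub>D\<^esub> ftwo G (fobj P a) (fobj P b)) \<boxtimes>\<^bsub>D\<^esub> (farr G (ftwo Q a b) \<cdot>\<^bsub>D\<^esub> ftwo G (fobj Q a) (fobj Q b))) \<cdot>\<^bsub>D\<^esub> ?i
      = ftwo G (fobj P ?ab) (fobj Q ?ab) \<cdot>\<^bsub>D\<^esub> (farr G (ftwo P a b) \<boxtimes>\<^bsub>D\<^esub> farr G (ftwo Q a b)) \<cdot>\<^bsub>D\<^esub> ?m"
      by (simp add: D.tena_fold2)
    also have "\<dots> = farr G (ftwo P a b \<boxtimes>\<^bsub>B\<^esub> ftwo Q a b) \<cdot>\<^bsub>D\<^esub> ftwo G (fobj P a \<otimes>\<^bsub>B\<^esub> fobj P b) (fobj Q a \<otimes>\<^bsub>B\<^esub> fobj Q b) \<cdot>\<^bsub>D\<^esub> ?m"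
      using D.cmp_extend[OF G.ftwo_nat[of "ftwo P a b" "ftwo Q a b"], of ?m] by simp
    finally show "ncmp ?t (a \<otimes>\<^bsub>C\<^esub> b) \<cdot>\<^bsub>D\<^esub> ftwo ?S a b = ftwo ?T a b \<cdot>\<^bsub>D\<^esub> (ncmp ?t a \<boxtimes>\<^bsub>D\<^esub> ncmp ?t b)"
      by (simp add: G.lax_interchange)
  qed auto
qed

lemma unit_comp_trans:
  assumes "symm_mon_category C" "symm_mon_functor G B D"
  shows "mon_nat_trans \<lparr>nsrc = unit_smf C D, ntgt = G \<circ>\<^sub>F unit_smf C B, ncmp = (\<lambda>c\<in>obj C. fzero G)\<rparr>
     (unit_smf C D) (G \<circ>\<^sub>F unit_smf C B) C D"
proof -
  interpret C: symm_mon_category C by fact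
  interpret G: symm_mon_functor G B D by fact
  show ?thesis
  proof (rule mon_nat_transI)
    show "symm_mon_functor (unit_smf C D) C D" "symm_mon_functor (G \<circ>\<^sub>F unit_smf C B) C D"
      by (rule unit_smf_functor[OF assms(1) G.smc_cod])
        (rule comp_smf_functor[OF unit_smf_functor[OF assms(1) G.smc_dom] assms(2)])
  qed (simp_all add: G.lax_un)
qed

section \<open>Pre- and postcomposition\<close>

lemma hom_smf_simps [simp]:
  "fdom (hom_smf F G) = hom_smc (fcod F) (fdom G)" "fcod (hom_smf F G) = hom_smc (fdom F) (fcod G)"
  "symm_mon_functor H (fcod F) (fdom G) \<Longrightarrow> fobj (hom_smf F G) H = G \<circ>\<^sub>F H \<circ>\<^sub>F F"
  "t \<in> arr (hom_smc (fcod F) (fdom G)) \<Longrightarrow> farr (hom_smf F G) t = id_nt G *\<^sub>N t *\<^sub>N id_nt F"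
  "fzero (hom_smf F G) = \<lparr>nsrc = unit_smf (fdom F) (fcod G), ntgt = G \<circ>\<^sub>F unit_smf (fcod F) (fdom G) \<circ>\<^sub>F F,
     ncmp = (\<lambda>c\<in>obj (fdom F). fzero G)\<rparr>"
  "symm_mon_functor H (fcod F) (fdom G) \<Longrightarrow> symm_mon_functor K (fcod F) (fdom G) \<Longrightarrow>
   ftwo (hom_smf F G) H K = \<lparr>nsrc = (G \<circ>\<^sub>F H \<circ>\<^sub>F F) \<box> (G \<circ>\<^sub>F K \<circ>\<^sub>F F), ntgt = G \<circ>\<^sub>F (H \<box> K) \<circ>\<^sub>F F,
        ncmp = (\<lambda>c\<in>obj (fdom F). ftwo G (fobj H (fobj F c)) (fobj K (fobj F c)))\<rparr>"
  by (simp_all add: hom_smf_def Let_def)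

locale functor_pair = F: symm_mon_functor F C A + G: symm_mon_functor G B D
  for F :: "('q, 'k, 'o, 'm) smfun" and C A and G :: "('p, 'n, 'r, 'l) smfun" and B D
begin

lemma whisker_functor [simp]: "symm_mon_functor H A B \<Longrightarrow> symm_mon_functor (G \<circ>\<^sub>F H \<circ>\<^sub>F F) C D"
  by (rule comp_smf_functor[OF comp_smf_functor[OF F.symm_mon_functor_axioms] G.symm_mon_functor_axioms])

lemma whisker_trans:
  "mon_nat_trans t H K A B \<Longrightarrow> mon_nat_trans (id_nt G *\<^sub>N t *\<^sub>N id_nt F) (G \<circ>\<^sub>F H \<circ>\<^sub>F F) (G \<circ>\<^sub>F K \<circ>\<^sub>F F) C D"
  by (intro hcomp_nt_trans[of _ _ _ _ B] hcomp_nt_trans[of _ _ _ _ A] id_nt_trans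
      F.symm_mon_functor_axioms G.symm_mon_functor_axioms)

lemma whisker_facts [simp]:
  assumes "t \<in> arr (hom_smc A B)"
  shows "id_nt G *\<^sub>N t *\<^sub>N id_nt F \<in> arr (hom_smc C D)"
    "ncmp (id_nt G *\<^sub>N t *\<^sub>N id_nt F) \<in> extensional (obj C)"
    "c \<in> obj C \<Longrightarrow> ncmp (id_nt G *\<^sub>N t *\<^sub>N id_nt F) c = farr G (ncmp t (fobj F c))"
proof -
  obtain H K where t: "mon_nat_trans t H K A B"
    using assms by (simp only: hom_smc_arr)
  then interpret t: mon_nat_trans t H K A B .
  show "id_nt G *\<^sub>N t *\<^sub>N id_nt F \<in> arr (hom_smc C D)"
    using mon_nat_trans.in_arr[OF whisker_trans[OF t]] .
  show "ncmp (id_nt G *\<^sub>N t *\<^sub>N id_nt F) \<in> extensional (obj C)"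
    by simp
  show "ncmp (id_nt G *\<^sub>N t *\<^sub>N id_nt F) c = farr G (ncmp t (fobj F c))" if "c \<in> obj C"
    using that by simp
qed

text \<open>The arrows \<open>[F, G]\<^sup>0\<close> and, below, \<open>[F, G]\<^sup>2\<close> reduce to the case that \<open>F\<close> is an identity, because
  precomposition with \<open>F\<close> preserves the unit and the products of functors strictly.\<close>

lemma hom_zero_arr [simp]:
  "\<lparr>nsrc = unit_smf C D, ntgt = G \<circ>\<^sub>F unit_smf A B \<circ>\<^sub>F F, ncmp = (\<lambda>c\<in>obj C. fzero G)\<rparr> \<in> arr (hom_smc C D)"
  using mon_nat_trans.in_arr[OF unit_comp_trans[OF F.smc_dom G.symm_mon_functor_axioms]]
  by (simp only: unit_comp[OF F.symm_mon_functor_axioms G.smc_dom])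

lemma hom_two_arr [simp]:
  assumes "symm_mon_functor H A B" "symm_mon_functor K A B"
  shows "\<lparr>nsrc = (G \<circ>\<^sub>F H \<circ>\<^sub>F F) \<box> (G \<circ>\<^sub>F K \<circ>\<^sub>F F), ntgt = G \<circ>\<^sub>F (H \<box> K) \<circ>\<^sub>F F,
     ncmp = (\<lambda>c\<in>obj C. ftwo G (fobj H (fobj F c)) (fobj K (fobj F c)))\<rparr> \<in> arr (hom_smc C D)"
proof -
  note f = F.symm_mon_functor_axioms
  have "(\<lambda>c\<in>obj C. ftwo G (fobj (H \<circ>\<^sub>F F) c) (fobj (K \<circ>\<^sub>F F) c)) =
      (\<lambda>c\<in>obj C. ftwo G (fobj H (fobj F c)) (fobj K (fobj F c)))"
    by auto
  then show ?thesis
    using mon_nat_trans.in_arr[OF comp_box_trans[OF comp_smf_functor[OF f assms(1)] comp_smf_functor[OF f assms(2)]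
          G.symm_mon_functor_axioms]]
    by (simp only: box_comp[OF f assms])
qed

text \<open>At an object \<open>c\<close> every axiom is the axiom for \<open>G\<close> at the values of the functors and
  transformations at \<open>F c\<close>.\<close>

lemma hom_smf_functor: "symm_mon_functor (hom_smf F G) (hom_smc A B) (hom_smc C D)"
proof (rule symm_mon_functorI)
  note [simp] = F.smc_dom F.smc_cod G.smc_dom G.smc_cod
  let ?H = "hom_smc A B" and ?K = "hom_smc C D"
  show "fdom (hom_smf F G) = ?H" "fcod (hom_smf F G) = ?K" by simp_all
  show "symm_mon_category ?H" "symm_mon_category ?K" by (simp_all add: hom_smc_smc)
  show "fobj (hom_smf F G) \<in> extensional (obj ?H)" "farr (hom_smf F G) \<in> extensional (arr ?H)"
    "ftwo (hom_smf F G) \<in> extensional (obj ?H)"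
    "\<And>L. L \<in> obj ?H \<Longrightarrow> ftwo (hom_smf F G) L \<in> extensional (obj ?H)"
    by (auto simp: hom_smf_def Let_def)
  show "fzero (hom_smf F G) \<in> arr ?K \<and> src ?K (fzero (hom_smf F G)) = un ?K \<and>
    tgt ?K (fzero (hom_smf F G)) = fobj (hom_smf F G) (un ?H)"
    by simp
  {
    fix L assume "L \<in> obj ?H"
    then interpret L: symm_mon_functor L A B by simp
    note [simp] = L.symm_mon_functor_axioms
    show "fobj (hom_smf F G) L \<in> obj ?K" by simp
    show "farr (hom_smf F G) (idn ?H L) = idn ?K (fobj (hom_smf F G) L)"
      by (auto intro!: nt_eqI[of _ _ "obj C"])
    show "cmp ?K (farr (hom_smf F G) (run ?H L)) (cmp ?K (ftwo (hom_smf F G) L (un ?H))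
        (tena ?K (idn ?K (fobj (hom_smf F G) L)) (fzero (hom_smf F G)))) = run ?K (fobj (hom_smf F G) L)"
      by (auto intro!: nt_eqI[of _ _ "obj C"] simp: G.ftwo_run)
    show "cmp ?K (farr (hom_smf F G) (lun ?H L)) (cmp ?K (ftwo (hom_smf F G) (un ?H) L)
        (tena ?K (fzero (hom_smf F G)) (idn ?K (fobj (hom_smf F G) L)))) = lun ?K (fobj (hom_smf F G) L)"
      by (auto intro!: nt_eqI[of _ _ "obj C"] simp: G.ftwo_lun)
    fix M assume "M \<in> obj ?H"
    then interpret M: symm_mon_functor M A B by simp
    note [simp] = M.symm_mon_functor_axioms
    show "ftwo (hom_smf F G) L M \<in> arr ?K \<and>
      src ?K (ftwo (hom_smf F G) L M) = ten ?K (fobj (hom_smf F G) L) (fobj (hom_smf F G) M) \<and>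
      tgt ?K (ftwo (hom_smf F G) L M) = fobj (hom_smf F G) (ten ?H L M)"
      by simp
    show "cmp ?K (ftwo (hom_smf F G) M L) (swp ?K (fobj (hom_smf F G) L) (fobj (hom_smf F G) M)) =
      cmp ?K (farr (hom_smf F G) (swp ?H L M)) (ftwo (hom_smf F G) L M)"
      by (auto intro!: nt_eqI[of _ _ "obj C"] simp: G.ftwo_swp)
    fix N assume "N \<in> obj ?H"
    then interpret N: symm_mon_functor N A B by simp
    note [simp] = N.symm_mon_functor_axioms
    show "cmp ?K (ftwo (hom_smf F G) (ten ?H L M) N) (cmp ?K (tena ?K (ftwo (hom_smf F G) L M) (idn ?K (fobj (hom_smf F G) N)))
         (ass ?K (fobj (hom_smf F G) L) (fobj (hom_smf F G) M) (fobj (hom_smf F G) N))) =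
      cmp ?K (farr (hom_smf F G) (ass ?H L M N)) (cmp ?K (ftwo (hom_smf F G) L (ten ?H M N))
         (tena ?K (idn ?K (fobj (hom_smf F G) L)) (ftwo (hom_smf F G) M N)))"
      by (auto intro!: nt_eqI[of _ _ "obj C"] simp: G.ftwo_ass)
  }
  {
    fix f assume "f \<in> arr ?H"
    then obtain L M where f: "mon_nat_trans f L M A B" by (simp only: hom_smc_arr)
    then interpret f: mon_nat_trans f L M A B .
    note [simp] = f.smf_src f.smf_tgt
    show "farr (hom_smf F G) f \<in> arr ?K \<and> src ?K (farr (hom_smf F G) f) = fobj (hom_smf F G) (src ?H f) \<and>
      tgt ?K (farr (hom_smf F G) f) = fobj (hom_smf F G) (tgt ?H f)"
      by simp
    fix g assume "g \<in> arr ?H"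
    then obtain L' M' where g: "mon_nat_trans g L' M' A B" by (simp only: hom_smc_arr)
    then interpret g: mon_nat_trans g L' M' A B .
    note [simp] = g.smf_src g.smf_tgt
    have "ftwo G (fobj M a) (fobj M' a) \<cdot>\<^bsub>D\<^esub> (farr G (ncmp f a) \<boxtimes>\<^bsub>D\<^esub> farr G (ncmp g a)) =
      farr G (ncmp f a \<boxtimes>\<^bsub>B\<^esub> ncmp g a) \<cdot>\<^bsub>D\<^esub> ftwo G (fobj L a) (fobj L' a)" if "a \<in> obj A" for a
      using G.ftwo_nat[of "ncmp f a" "ncmp g a"] that by simp
    then show "cmp ?K (ftwo (hom_smf F G) (tgt ?H f) (tgt ?H g)) (tena ?K (farr (hom_smf F G) f) (farr (hom_smf F G) g)) =
      cmp ?K (farr (hom_smf F G) (tena ?H f g)) (ftwo (hom_smf F G) (src ?H f) (src ?H g))"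
      by (auto intro!: nt_eqI[of _ _ "obj C"])
    assume "src ?H g = tgt ?H f"
    then have [simp]: "L' = M" by simp
    show "farr (hom_smf F G) (cmp ?H g f) = cmp ?K (farr (hom_smf F G) g) (farr (hom_smf F G) f)"
      by (auto intro!: nt_eqI[of _ _ "obj C"])
  }
qed

end

section \<open>Horizontal composition with two transformations\<close>

locale trans_pair = s: mon_nat_trans s F F' C A + t: mon_nat_trans t G G' B D
  for s :: "('q, 'k, 'o, 'm) nattr" and F F' C A and t :: "('p, 'n, 'r, 'l) nattr" and G G' B D
begin

sublocale FG: functor_pair F C A G B D + FG': functor_pair F' C A G' B D
  by (intro functor_pair.intro s.smf_src s.smf_tgt t.smf_src t.smf_tgt)+

lemma horizontal_facts:
  assumes "symm_mon_functor H A B"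
  shows "t *\<^sub>N id_nt H *\<^sub>N s \<in> arr (hom_smc C D)" "ncmp (t *\<^sub>N id_nt H *\<^sub>N s) \<in> extensional (obj C)"
    "c \<in> obj C \<Longrightarrow> ncmp (t *\<^sub>N id_nt H *\<^sub>N s) c = ncmp t (fobj H (fobj F' c)) \<cdot>\<^bsub>D\<^esub> farr G (farr H (ncmp s c))"
proof -
  interpret H: symm_mon_functor H A B by fact
  show "t *\<^sub>N id_nt H *\<^sub>N s \<in> arr (hom_smc C D)"
    by (rule mon_nat_trans.in_arr[OF hcomp_nt_trans[OF hcomp_nt_trans[OF s.mon_nat_trans_axioms id_nt_trans[OF assms]]
          t.mon_nat_trans_axioms]])
  show "ncmp (t *\<^sub>N id_nt H *\<^sub>N s) \<in> extensional (obj C)" by simp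
  show "ncmp (t *\<^sub>N id_nt H *\<^sub>N s) c = ncmp t (fobj H (fobj F' c)) \<cdot>\<^bsub>D\<^esub> farr G (farr H (ncmp s c))" if "c \<in> obj C"
    using that by simp
qed

lemma hom_nt_facts:
  shows "nsrc (hom_nt s t) = hom_smf F G" "ntgt (hom_nt s t) = hom_smf F' G'"
    "ncmp (hom_nt s t) \<in> extensional (obj (hom_smc A B))"
    "symm_mon_functor H A B \<Longrightarrow> ncmp (hom_nt s t) H = t *\<^sub>N id_nt H *\<^sub>N s"
  by (simp_all add: hom_nt_def)

text \<open>The component of \<open>\<tau> * id\<^sub>H * \<sigma>\<close> at \<open>c\<close> is \<open>\<tau>\<close> at \<open>H (F' c)\<close> after \<open>G (H (\<sigma> c))\<close>. Naturality in \<open>H\<close>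
  combines naturality of the given arrow at \<open>\<sigma> c\<close> with naturality of \<open>\<tau>\<close>, and monoidality combines
  naturality of \<open>G\<^sup>2\<close> with monoidality of \<open>\<tau>\<close>.\<close>

lemma hom_nt_trans: "mon_nat_trans (hom_nt s t) (hom_smf F G) (hom_smf F' G') (hom_smc A B) (hom_smc C D)"
proof (rule mon_nat_transI)
  note [simp] = s.F.smc_dom s.F.smc_cod t.F.smc_dom t.F.smc_cod hom_nt_facts horizontal_facts(1)
  note ext [simp] = horizontal_facts(2) and at [simp] = horizontal_facts(3)
  \<comment> \<open>The components at the functors \<open>H\<close> are computed by \<open>horizontal_facts\<close> instead.\<close>
  note [simp del] = hcomp_nt_simps(4)
  let ?H = "hom_smc A B" and ?K = "hom_smc C D"
  show "symm_mon_functor (hom_smf F G) ?H ?K" "symm_mon_functor (hom_smf F' G') ?H ?K"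
    by (rule FG.hom_smf_functor FG'.hom_smf_functor)+
  interpret U: symm_mon_functor "unit_smf A B" A B by simp
  show "cmp ?K (ncmp (hom_nt s t) (un ?H)) (fzero (hom_smf F G)) = fzero (hom_smf F' G')"
    by (auto intro!: nt_eqI[of _ _ "obj C"] simp: t.ncmp_zero)
  {
    fix H assume "H \<in> obj ?H"
    then interpret H: symm_mon_functor H A B by simp
    note [simp] = H.symm_mon_functor_axioms
    show "ncmp (hom_nt s t) H \<in> arr ?K \<and> src ?K (ncmp (hom_nt s t) H) = fobj (hom_smf F G) H \<and>
      tgt ?K (ncmp (hom_nt s t) H) = fobj (hom_smf F' G') H"
      by simp
    fix K assume "K \<in> obj ?H"
    then interpret K: symm_mon_functor K A B by simp
    note [simp] = K.symm_mon_functor_axioms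
    interpret HK: symm_mon_functor "H \<box> K" A B by simp
    have "ncmp t (fobj H (fobj F' c) \<otimes>\<^bsub>B\<^esub> fobj K (fobj F' c)) \<cdot>\<^bsub>D\<^esub> farr G (farr H (ncmp s c) \<boxtimes>\<^bsub>B\<^esub> farr K (ncmp s c)) \<cdot>\<^bsub>D\<^esub>
        ftwo G (fobj H (fobj F c)) (fobj K (fobj F c)) =
      ftwo G' (fobj H (fobj F' c)) (fobj K (fobj F' c)) \<cdot>\<^bsub>D\<^esub>
       ((ncmp t (fobj H (fobj F' c)) \<cdot>\<^bsub>D\<^esub> farr G (farr H (ncmp s c))) \<boxtimes>\<^bsub>D\<^esub> (ncmp t (fobj K (fobj F' c)) \<cdot>\<^bsub>D\<^esub> farr G (farr K (ncmp s c))))"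
      if [simp]: "c \<in> obj C" for c
      using t.F.ftwo_nat[of "farr H (ncmp s c)" "farr K (ncmp s c)"]
        t.F.cod.cmp_extend[OF t.ncmp_two[of "fobj H (fobj F' c)" "fobj K (fobj F' c)"],
          of "farr G (farr H (ncmp s c)) \<boxtimes>\<^bsub>D\<^esub> farr G (farr K (ncmp s c))"]
      by (simp add: t.F.cod.tena_fold)
    then show "cmp ?K (ncmp (hom_nt s t) (ten ?H H K)) (ftwo (hom_smf F G) H K) =
      cmp ?K (ftwo (hom_smf F' G') H K) (tena ?K (ncmp (hom_nt s t) H) (ncmp (hom_nt s t) K))"
      by (auto intro!: nt_eqI[of _ _ "obj C"])
  }
  fix f assume "f \<in> arr ?H"
  then obtain H K where f: "mon_nat_trans f H K A B" by (simp only: hom_smc_arr)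
  then interpret f: mon_nat_trans f H K A B .
  note [simp] = f.smf_src f.smf_tgt
  have "ncmp t (fobj K (fobj F' c)) \<cdot>\<^bsub>D\<^esub> farr G (farr K (ncmp s c)) \<cdot>\<^bsub>D\<^esub> farr G (ncmp f (fobj F c)) =
    farr G' (ncmp f (fobj F' c)) \<cdot>\<^bsub>D\<^esub> ncmp t (fobj H (fobj F' c)) \<cdot>\<^bsub>D\<^esub> farr G (farr H (ncmp s c))"
    if [simp]: "c \<in> obj C" for c
  proof -
    have "farr G (farr K (ncmp s c)) \<cdot>\<^bsub>D\<^esub> farr G (ncmp f (fobj F c)) = farr G (ncmp f (fobj F' c)) \<cdot>\<^bsub>D\<^esub> farr G (farr H (ncmp s c))"
      using f.ncmp_nat[of "ncmp s c"] by (simp flip: t.F.farr_comp)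
    then show ?thesis
      using t.F.cod.cmp_extend[OF t.ncmp_nat[of "ncmp f (fobj F' c)"], of "farr G (farr H (ncmp s c))"] by simp
  qed
  then show "cmp ?K (ncmp (hom_nt s t) (tgt ?H f)) (farr (hom_smf F G) f) =
    cmp ?K (farr (hom_smf F' G') f) (ncmp (hom_nt s t) (src ?H f))"
    by (auto intro!: nt_eqI[of _ _ "obj C"])
qed (auto simp: hom_nt_def)

end

section \<open>The 2-category of symmetric monoidal categories\<close>

lemma SMC_simps [simp]:
  "A \<in> cell0 SMC \<longleftrightarrow> symm_mon_category A"
  "src1 SMC = fdom" "tgt1 SMC = fcod" "src2 SMC = nsrc" "tgt2 SMC = ntgt" "id1 SMC = id_smf" "id2 SMC = id_nt"
  "comp1 SMC = comp_smf" "vcomp SMC = vcomp_nt" "hcomp SMC = hcomp_nt"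
  by (simp_all add: SMC_def)

lemma SMC_cell1: "F \<in> cell1 SMC \<longleftrightarrow> symm_mon_functor F (fdom F) (fcod F)"
  by (auto simp: SMC_def symm_mon_functor.fdom symm_mon_functor.fcod)

lemma SMC_hom1: "F \<in> hom1 SMC A B \<longleftrightarrow> symm_mon_functor F A B"
  by (auto simp: hom1_def SMC_cell1 symm_mon_functor.fdom symm_mon_functor.fcod)

lemma SMC_cell2: "t \<in> cell2 SMC \<longleftrightarrow> mon_nat_trans t (nsrc t) (ntgt t) (fdom (nsrc t)) (fcod (nsrc t))"
proof
  assume "t \<in> cell2 SMC"
  then obtain F G A B where "mon_nat_trans t F G A B" by (auto simp: SMC_def)
  then interpret mon_nat_trans t F G A B .
  show "mon_nat_trans t (nsrc t) (ntgt t) (fdom (nsrc t)) (fcod (nsrc t))"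
    using mon_nat_trans_axioms by simp
qed (auto simp: SMC_def)

lemma SMC_hom2:
  assumes "F \<in> hom1 SMC A B"
  shows "t \<in> hom2 SMC F G \<longleftrightarrow> mon_nat_trans t F G A B"
proof
  interpret F: symm_mon_functor F A B using assms by (simp add: SMC_hom1)
  assume "t \<in> hom2 SMC F G"
  then have "t \<in> cell2 SMC" and e: "nsrc t = F" "ntgt t = G" by (simp_all add: hom2_def)
  then have "mon_nat_trans t (nsrc t) (ntgt t) (fdom (nsrc t)) (fcod (nsrc t))"
    by (simp only: SMC_cell2)
  then show "mon_nat_trans t F G A B" unfolding e by simp
next
  assume "mon_nat_trans t F G A B"
  then interpret mon_nat_trans t F G A B .
  show "t \<in> hom2 SMC F G" using mon_nat_trans_axioms by (simp add: hom2_def SMC_cell2)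
qed

lemma comp_id_smf:
  assumes "symm_mon_functor F A B"
  shows "id_smf B \<circ>\<^sub>F F = F" "F \<circ>\<^sub>F id_smf A = F"
proof -
  interpret F: symm_mon_functor F A B by fact
  show "id_smf B \<circ>\<^sub>F F = F"
    by (rule smf_eqI[OF comp_smf_functor[OF assms id_smf_functor[OF F.smc_cod]] assms]) simp_all
  show "F \<circ>\<^sub>F id_smf A = F"
    by (rule smf_eqI[OF comp_smf_functor[OF id_smf_functor[OF F.smc_dom] assms] assms]) simp_all
qed

lemma vcomp_nt_id:
  assumes "mon_nat_trans t F G A B"
  shows "vcomp_nt (id_nt G) t = t" "vcomp_nt t (id_nt F) = t"
proof -
  interpret t: mon_nat_trans t F G A B by fact
  show "vcomp_nt (id_nt G) t = t" "vcomp_nt t (id_nt F) = t"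
    by (rule nt_eqI[of _ _ "obj A"]; simp)+
qed

lemma vcomp_nt_assoc:
  assumes "mon_nat_trans s F G A B" "mon_nat_trans t G H A B" "mon_nat_trans u H K A B"
  shows "vcomp_nt (vcomp_nt u t) s = vcomp_nt u (vcomp_nt t s)"
proof -
  interpret s: mon_nat_trans s F G A B by fact
  interpret t: mon_nat_trans t G H A B by fact
  interpret u: mon_nat_trans u H K A B by fact
  show ?thesis by (rule nt_eqI[of _ _ "obj A"]) simp_all
qed

lemma hcomp_nt_id:
  assumes "mon_nat_trans t F G A B"
  shows "id_nt (id_smf B) *\<^sub>N t = t" "t *\<^sub>N id_nt (id_smf A) = t"
proof -
  interpret t: mon_nat_trans t F G A B by fact
  note [simp] = comp_id_smf[OF t.smf_src] comp_id_smf[OF t.smf_tgt]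
  show "id_nt (id_smf B) *\<^sub>N t = t" "t *\<^sub>N id_nt (id_smf A) = t"
    by (rule nt_eqI[of _ _ "obj A"]; simp)+
qed

lemma hcomp_nt_assoc:
  assumes "mon_nat_trans s F F' A B" "mon_nat_trans t G G' B C" "mon_nat_trans u H H' C D"
  shows "(u *\<^sub>N t) *\<^sub>N s = u *\<^sub>N (t *\<^sub>N s)"
proof -
  interpret s: mon_nat_trans s F F' A B by fact
  interpret t: mon_nat_trans t G G' B C by fact
  interpret u: mon_nat_trans u H H' C D by fact
  show ?thesis
    by (rule nt_eqI[of _ _ "obj A"])
      (simp_all add: comp_smf_assoc[OF s.smf_src t.smf_src u.smf_src] comp_smf_assoc[OF s.smf_tgt t.smf_tgt u.smf_tgt])
qed

lemma hcomp_id_nt: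
  assumes "symm_mon_functor F A B" "symm_mon_functor G B C"
  shows "id_nt G *\<^sub>N id_nt F = id_nt (G \<circ>\<^sub>F F)"
proof -
  interpret F: symm_mon_functor F A B by fact
  interpret G: symm_mon_functor G B C by fact
  show ?thesis by (rule nt_eqI[of _ _ "obj A"]) simp_all
qed

lemma hcomp_vcomp_nt:
  assumes "mon_nat_trans s F F' A B" "mon_nat_trans s' F' F'' A B"
    "mon_nat_trans t G G' B C" "mon_nat_trans t' G' G'' B C"
  shows "vcomp_nt t' t *\<^sub>N vcomp_nt s' s = vcomp_nt (t' *\<^sub>N s') (t *\<^sub>N s)"
proof -
  interpret C: symm_mon_category C by (rule symm_mon_functor.smc_cod[OF mon_nat_trans.smf_src]) fact
  interpret s: mon_nat_trans s F F' A B by fact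
  interpret s': mon_nat_trans s' F' F'' A B by fact
  interpret t: mon_nat_trans t G G' B C by fact
  interpret t': mon_nat_trans t' G' G'' B C by fact
  have "ncmp t (fobj F'' a) \<cdot>\<^bsub>C\<^esub> farr G (ncmp s' a) \<cdot>\<^bsub>C\<^esub> farr G (ncmp s a) =
    farr G' (ncmp s' a) \<cdot>\<^bsub>C\<^esub> ncmp t (fobj F' a) \<cdot>\<^bsub>C\<^esub> farr G (ncmp s a)" if "a \<in> obj A" for a
    using C.cmp_extend[OF t.ncmp_nat[of "ncmp s' a"], of "farr G (ncmp s a)"] that by simp
  then show ?thesis by (intro nt_eqI[of _ _ "obj A"]) simp_all
qed

lemma SMC_hom2D: "t \<in> hom2 SMC F G \<Longrightarrow> symm_mon_functor F A B \<Longrightarrow> mon_nat_trans t F G A B"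
  using SMC_hom2 SMC_hom1 by blast

lemma SMC_hom2_functor: "t \<in> hom2 SMC F G \<Longrightarrow> \<exists>A B. symm_mon_functor F A B"
  using mon_nat_trans.smf_src by (fastforce simp: hom2_def SMC_def dest: mon_nat_trans.nsrc)

lemma SMC_hom2I: "mon_nat_trans t F G A B \<Longrightarrow> t \<in> hom2 SMC F G"
  using SMC_hom2 SMC_hom1 mon_nat_trans.smf_src by blast

lemma two_category_SMC: "two_category SMC"
proof (rule two_category.intro, unfold SMC_simps SMC_hom1)
  fix F :: "('a, 'b, 'a, 'b) smfun"
  assume "F \<in> cell1 SMC"
  then have F: "symm_mon_functor F (fdom F) (fcod F)" by (simp add: SMC_cell1)
  show "symm_mon_category (fdom F)" "symm_mon_category (fcod F)"
    by (rule symm_mon_functor.smc_dom[OF F], rule symm_mon_functor.smc_cod[OF F])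
  show "id_nt F \<in> hom2 SMC F F"
    using id_nt_trans[OF F] by (rule SMC_hom2I)
next
  fix t :: "('a, 'b, 'a, 'b) nattr"
  assume "t \<in> cell2 SMC"
  then obtain F G A B where t: "mon_nat_trans t F G A B" by (auto simp: SMC_def)
  interpret t: mon_nat_trans t F G A B by (rule t)
  show "nsrc t \<in> cell1 SMC" "ntgt t \<in> cell1 SMC" "fdom (nsrc t) = fdom (ntgt t)" "fcod (nsrc t) = fcod (ntgt t)"
    using t.smf_src t.smf_tgt by (simp_all add: SMC_cell1)
next
  fix F G H K :: "('a, 'b, 'a, 'b) smfun" and s t u
  assume s: "s \<in> hom2 SMC F G"
  obtain A B where F: "symm_mon_functor F A B" using SMC_hom2_functor[OF s] by blast
  note s' = SMC_hom2D[OF s F]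
  note G = mon_nat_trans.smf_tgt[OF s']
  show "vcomp_nt (id_nt G) s = s" "vcomp_nt s (id_nt F) = s" by (rule vcomp_nt_id[OF s'])+
  assume t: "t \<in> hom2 SMC G H"
  note t' = SMC_hom2D[OF t G]
  note H = mon_nat_trans.smf_tgt[OF t']
  show "vcomp_nt t s \<in> hom2 SMC F H" by (rule SMC_hom2I[OF vcomp_nt_trans[OF s' t']])
  assume u: "u \<in> hom2 SMC H K"
  show "vcomp_nt (vcomp_nt u t) s = vcomp_nt u (vcomp_nt t s)"
    by (rule vcomp_nt_assoc[OF s' t' SMC_hom2D[OF u H]])
next
  fix F F' G G' H H' :: "('a, 'b, 'a, 'b) smfun" and A B C D s t u
  assume F: "symm_mon_functor F A B" and s: "s \<in> hom2 SMC F F'"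
  note s' = SMC_hom2D[OF s F]
  show "id_nt (id_smf B) *\<^sub>N s = s" "s *\<^sub>N id_nt (id_smf A) = s" by (rule hcomp_nt_id[OF s'])+
  assume G: "symm_mon_functor G B C" and t: "t \<in> hom2 SMC G G'"
  note t' = SMC_hom2D[OF t G]
  show "t *\<^sub>N s \<in> hom2 SMC (G \<circ>\<^sub>F F) (G' \<circ>\<^sub>F F')" by (rule SMC_hom2I[OF hcomp_nt_trans[OF s' t']])
  assume H: "symm_mon_functor H C D" and u: "u \<in> hom2 SMC H H'"
  note u' = SMC_hom2D[OF u H]
  show "(u *\<^sub>N t) *\<^sub>N s = u *\<^sub>N (t *\<^sub>N s)" by (rule hcomp_nt_assoc[OF s' t' u'])
next
  fix F F' F'' G G' G'' :: "('a, 'b, 'a, 'b) smfun" and A B C s s' t t'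
  assume F: "symm_mon_functor F A B" and G: "symm_mon_functor G B C"
    and s: "s \<in> hom2 SMC F F'" "s' \<in> hom2 SMC F' F''" and t: "t \<in> hom2 SMC G G'" "t' \<in> hom2 SMC G' G''"
  note s1 = SMC_hom2D[OF s(1) F] and t1 = SMC_hom2D[OF t(1) G]
  note s2 = SMC_hom2D[OF s(2) mon_nat_trans.smf_tgt[OF s1]]
    and t2 = SMC_hom2D[OF t(2) mon_nat_trans.smf_tgt[OF t1]]
  show "vcomp_nt t' t *\<^sub>N vcomp_nt s' s = vcomp_nt (t' *\<^sub>N s') (t *\<^sub>N s)"
    by (rule hcomp_vcomp_nt[OF s1 s2 t1 t2])
qed (simp_all add: id_smf_functor comp_smf_functor comp_id_smf comp_smf_assoc hcomp_id_nt)

section \<open>Opposites and products of 2-categories\<close>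

lemma op1_simps [simp]:
  "cell0 (op1 X) = cell0 X" "cell1 (op1 X) = cell1 X" "cell2 (op1 X) = cell2 X"
  "src1 (op1 X) = tgt1 X" "tgt1 (op1 X) = src1 X" "src2 (op1 X) = src2 X" "tgt2 (op1 X) = tgt2 X"
  "id1 (op1 X) = id1 X" "id2 (op1 X) = id2 X" "comp1 (op1 X) g f = comp1 X f g"
  "vcomp (op1 X) = vcomp X" "hcomp (op1 X) t s = hcomp X s t"
  "hom1 (op1 X) a b = hom1 X b a" "hom2 (op1 X) = hom2 X"
  by (auto simp: op1_def hom1_def hom2_def fun_eq_iff)

lemma prod2_simps [simp]:
  "cell0 (X \<times>\<^sub>2 Y) = cell0 X \<times> cell0 Y" "cell1 (X \<times>\<^sub>2 Y) = cell1 X \<times> cell1 Y" "cell2 (X \<times>\<^sub>2 Y) = cell2 X \<times> cell2 Y"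
  "src1 (X \<times>\<^sub>2 Y) (f, f') = (src1 X f, src1 Y f')" "tgt1 (X \<times>\<^sub>2 Y) (f, f') = (tgt1 X f, tgt1 Y f')"
  "src2 (X \<times>\<^sub>2 Y) (t, t') = (src2 X t, src2 Y t')" "tgt2 (X \<times>\<^sub>2 Y) (t, t') = (tgt2 X t, tgt2 Y t')"
  "id1 (X \<times>\<^sub>2 Y) (a, a') = (id1 X a, id1 Y a')" "id2 (X \<times>\<^sub>2 Y) (f, f') = (id2 X f, id2 Y f')"
  "comp1 (X \<times>\<^sub>2 Y) (g, g') (f, f') = (comp1 X g f, comp1 Y g' f')"
  "vcomp (X \<times>\<^sub>2 Y) (t, t') (s, s') = (vcomp X t s, vcomp Y t' s')"
  "hcomp (X \<times>\<^sub>2 Y) (t, t') (s, s') = (hcomp X t s, hcomp Y t' s')"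
  "hom1 (X \<times>\<^sub>2 Y) (a, a') (b, b') = hom1 X a b \<times> hom1 Y a' b'"
  "hom2 (X \<times>\<^sub>2 Y) (f, f') (g, g') = hom2 X f g \<times> hom2 Y f' g'"
  by (auto simp: prod2_def hom1_def hom2_def)

lemma two_category_op1:
  assumes "two_category X"
  shows "two_category (op1 X)"
proof -
  interpret two_category X by fact
  show ?thesis
  proof (rule two_category.intro, unfold op1_simps)
    show "f \<in> hom1 X b a \<Longrightarrow> g \<in> hom1 X c b \<Longrightarrow> h \<in> hom1 X d c \<Longrightarrow>
      s \<in> hom2 X f f' \<Longrightarrow> t \<in> hom2 X g g' \<Longrightarrow> u \<in> hom2 X h h' \<Longrightarrow>
      hcomp X s (hcomp X t u) = hcomp X (hcomp X s t) u" for f g h s t u a b c d f' g' h'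
      by (rule hcomp_assoc[symmetric])
    show "f \<in> hom1 X b a \<Longrightarrow> g \<in> hom1 X c b \<Longrightarrow> h \<in> hom1 X d c \<Longrightarrow>
      comp1 X f (comp1 X g h) = comp1 X (comp1 X f g) h" for f g h a b c d
      by (rule comp1_assoc[symmetric])
    fix f b a g c s f' s' f'' t g' t' g''
    assume "f \<in> hom1 X b a" "g \<in> hom1 X c b" "s \<in> hom2 X f f'" "s' \<in> hom2 X f' f''" "t \<in> hom2 X g g'" "t' \<in> hom2 X g' g''"
    then show "hcomp X (vcomp X s' s) (vcomp X t' t) = vcomp X (hcomp X s' t') (hcomp X s t)"
      by (intro hcomp_vcomp)
  next
    fix f t g a b
    assume "f \<in> hom1 X b a" "t \<in> hom2 X f g"
    then show "hcomp X t (id2 X (id1 X b)) = t" "hcomp X (id2 X (id1 X a)) t = t"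
      by (rule hcomp_id_right, rule hcomp_id_left)
  next
    fix f f' g g' s t a b c
    assume "f \<in> hom1 X b a" "f' \<in> hom1 X b a" "g \<in> hom1 X c b" "g' \<in> hom1 X c b" "s \<in> hom2 X f f'" "t \<in> hom2 X g g'"
    then show "hcomp X s t \<in> hom2 X (comp1 X f g) (comp1 X f' g')"
      by (intro hcomp_hom)
  qed (use src1_cell tgt1_cell src2_cell tgt2_cell src1_src2 tgt1_src2 id1_hom in \<open>simp;fail\<close> |
      blast intro: comp1_hom comp1_id_left comp1_id_right id2_hom vcomp_hom vcomp_id_left vcomp_id_right
        vcomp_assoc hcomp_id2)+
qed

lemma two_category_prod2:
  assumes "two_category X" "two_category Y"
  shows "two_category (X \<times>\<^sub>2 Y)"
proof -
  interpret X: two_category X by fact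
  interpret Y: two_category Y by fact
  show ?thesis
    by (rule two_category.intro; clarsimp)
      (auto intro: X.src1_cell Y.src1_cell X.tgt1_cell Y.tgt1_cell X.src2_cell Y.src2_cell X.tgt2_cell Y.tgt2_cell
        X.src1_src2 Y.src1_src2 X.tgt1_src2 Y.tgt1_src2 X.id1_hom Y.id1_hom X.comp1_hom Y.comp1_hom
        X.comp1_id_left Y.comp1_id_left X.comp1_id_right Y.comp1_id_right X.comp1_assoc Y.comp1_assoc
        X.id2_hom Y.id2_hom X.vcomp_hom Y.vcomp_hom X.vcomp_id_left Y.vcomp_id_left X.vcomp_id_right Y.vcomp_id_right
        X.vcomp_assoc Y.vcomp_assoc X.hcomp_hom Y.hcomp_hom X.hcomp_id_left Y.hcomp_id_left
        X.hcomp_id_right Y.hcomp_id_right X.hcomp_assoc Y.hcomp_assoc X.hcomp_id2 Y.hcomp_id2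
        X.hcomp_vcomp Y.hcomp_vcomp)
qed

section \<open>Strict functoriality of Hom\<close>

lemma hom_smf_id:
  assumes "symm_mon_category A" "symm_mon_category B"
  shows "hom_smf (id_smf A) (id_smf B) = id_smf (hom_smc A B)"
proof -
  interpret functor_pair "id_smf A" A A "id_smf B" B B
    using assms by (intro functor_pair.intro id_smf_functor)
  have [simp]: "id_smf B \<circ>\<^sub>F H \<circ>\<^sub>F id_smf A = H" if "symm_mon_functor H A B" for H
    using comp_id_smf[OF that] by simp
  note [simp] = assms
  show ?thesis
  proof (rule smf_eqI[OF hom_smf_functor id_smf_functor[OF hom_smc_smc[OF assms]]])
    fix t assume t: "t \<in> arr (hom_smc A B)"
    then obtain H K where "mon_nat_trans t H K A B" by (simp only: hom_smc_arr)
    then interpret t: mon_nat_trans t H K A B .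
    show "farr (hom_smf (id_smf A) (id_smf B)) t = farr (id_smf (hom_smc A B)) t"
      using t hcomp_nt_id[OF t.mon_nat_trans_axioms] by simp
  next
    show "fzero (hom_smf (id_smf A) (id_smf B)) = fzero (id_smf (hom_smc A B))"
      by (auto intro!: nt_eqI[of _ _ "obj A"])
  next
    fix H K assume "H \<in> obj (hom_smc A B)" "K \<in> obj (hom_smc A B)"
    then interpret H: symm_mon_functor H A B + K: symm_mon_functor K A B by simp_all
    note [simp] = H.symm_mon_functor_axioms K.symm_mon_functor_axioms
    show "ftwo (hom_smf (id_smf A) (id_smf B)) H K = ftwo (id_smf (hom_smc A B)) H K"
      by (auto intro!: nt_eqI[of _ _ "obj A"])
  qed simp
qed

lemma hom_smf_comp:
  assumes F: "symm_mon_functor F A' A" and F': "symm_mon_functor F' A'' A'"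
    and G: "symm_mon_functor G B B'" and G': "symm_mon_functor G' B' B''"
  shows "hom_smf (F \<circ>\<^sub>F F') (G' \<circ>\<^sub>F G) = hom_smf F' G' \<circ>\<^sub>F hom_smf F G"
proof -
  interpret F: symm_mon_functor F A' A by fact
  interpret F': symm_mon_functor F' A'' A' by fact
  interpret G: symm_mon_functor G B B' by fact
  interpret G': symm_mon_functor G' B' B'' by fact
  interpret a: functor_pair F A' A G B B' using assms by (intro functor_pair.intro)
  interpret b: functor_pair F' A'' A' G' B' B'' using assms by (intro functor_pair.intro)
  interpret c: functor_pair "F \<circ>\<^sub>F F'" A'' A "G' \<circ>\<^sub>F G" B B''
    by (rule functor_pair.intro[OF comp_smf_functor[OF F' F] comp_smf_functor[OF G G']])
  note [simp] = F.smc_dom F.smc_cod F'.smc_dom G.smc_dom G.smc_cod G'.smc_cod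
  have o: "(G' \<circ>\<^sub>F G) \<circ>\<^sub>F H \<circ>\<^sub>F F \<circ>\<^sub>F F' = G' \<circ>\<^sub>F (G \<circ>\<^sub>F H \<circ>\<^sub>F F) \<circ>\<^sub>F F'" if H: "symm_mon_functor H A B" for H
    using comp_smf_assoc[OF F' comp_smf_functor[OF F H] G] comp_smf_assoc[OF F' F H]
      comp_smf_assoc[OF comp_smf_functor[OF F' comp_smf_functor[OF F H]] G G'] by simp
  note [simp] = o
  show ?thesis
  proof (rule smf_eqI[OF c.hom_smf_functor comp_smf_functor[OF a.hom_smf_functor b.hom_smf_functor]])
    fix t assume t: "t \<in> arr (hom_smc A B)"
    then obtain H K where "mon_nat_trans t H K A B" by (simp only: hom_smc_arr)
    then interpret t: mon_nat_trans t H K A B .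
    note [simp] = t.smf_src t.smf_tgt
    show "farr (hom_smf (F \<circ>\<^sub>F F') (G' \<circ>\<^sub>F G)) t = farr (hom_smf F' G' \<circ>\<^sub>F hom_smf F G) t"
      by (auto intro!: nt_eqI[of _ _ "obj A''"])
  next
    show "fzero (hom_smf (F \<circ>\<^sub>F F') (G' \<circ>\<^sub>F G)) = fzero (hom_smf F' G' \<circ>\<^sub>F hom_smf F G)"
      by (auto intro!: nt_eqI[of _ _ "obj A''"])
  next
    fix H K assume "H \<in> obj (hom_smc A B)" "K \<in> obj (hom_smc A B)"
    then interpret H: symm_mon_functor H A B + K: symm_mon_functor K A B by simp_all
    note [simp] = H.symm_mon_functor_axioms K.symm_mon_functor_axioms
    show "ftwo (hom_smf (F \<circ>\<^sub>F F') (G' \<circ>\<^sub>F G)) H K = ftwo (hom_smf F' G' \<circ>\<^sub>F hom_smf F G) H K"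
      by (auto intro!: nt_eqI[of _ _ "obj A''"])
  qed simp
qed

lemma hom_nt_id:
  assumes F: "symm_mon_functor F C A" and G: "symm_mon_functor G B D"
  shows "hom_nt (id_nt F) (id_nt G) = id_nt (hom_smf F G)"
proof -
  interpret F: symm_mon_functor F C A by fact
  interpret G: symm_mon_functor G B D by fact
  interpret functor_pair F C A G B D using assms by (intro functor_pair.intro)
  have "id_nt G *\<^sub>N id_nt H *\<^sub>N id_nt F = id_nt (G \<circ>\<^sub>F H \<circ>\<^sub>F F)" if H: "symm_mon_functor H A B" for H
    by (simp add: hcomp_id_nt[OF F H] hcomp_id_nt[OF comp_smf_functor[OF F H] G])
  then show ?thesis
    by (intro nt_eqI[of _ _ "obj (hom_smc A B)"]) (auto simp: hom_nt_def)
qed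

text \<open>The interchange law, after the identity of \<open>H\<close> is written as a vertical composite with itself.\<close>

lemma hom_nt_vcomp:
  assumes s: "mon_nat_trans s F F' C A" "mon_nat_trans s' F' F'' C A"
    and t: "mon_nat_trans t G G' B D" "mon_nat_trans t' G' G'' B D"
  shows "hom_nt (vcomp_nt s' s) (vcomp_nt t' t) = vcomp_nt (hom_nt s' t') (hom_nt s t)"
proof -
  interpret s: mon_nat_trans s F F' C A by fact
  interpret s': mon_nat_trans s' F' F'' C A by fact
  interpret t: mon_nat_trans t G G' B D by fact
  interpret t': mon_nat_trans t' G' G'' B D by fact
  interpret st: trans_pair s F F' C A t G G' B D using assms by (intro trans_pair.intro)
  interpret st': trans_pair s' F' F'' C A t' G' G'' B D using assms by (intro trans_pair.intro)
  show ?thesis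
  proof (rule nt_eqI[of _ _ "obj (hom_smc A B)"])
    fix H assume "H \<in> obj (hom_smc A B)"
    then have H: "symm_mon_functor H A B" by simp
    have "vcomp_nt t' t *\<^sub>N id_nt H *\<^sub>N vcomp_nt s' s =
        vcomp_nt t' t *\<^sub>N vcomp_nt (id_nt H) (id_nt H) *\<^sub>N vcomp_nt s' s"
      by (simp add: vcomp_nt_id[OF id_nt_trans[OF H]])
    also have "\<dots> = vcomp_nt (t' *\<^sub>N id_nt H *\<^sub>N s') (t *\<^sub>N id_nt H *\<^sub>N s)"
      by (simp add: hcomp_vcomp_nt[OF s id_nt_trans[OF H] id_nt_trans[OF H]]
          hcomp_vcomp_nt[OF hcomp_nt_trans[OF s(1) id_nt_trans[OF H]] hcomp_nt_trans[OF s(2) id_nt_trans[OF H]] t])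
    finally show "ncmp (hom_nt (vcomp_nt s' s) (vcomp_nt t' t)) H = ncmp (vcomp_nt (hom_nt s' t') (hom_nt s t)) H"
      using H st.horizontal_facts(1)[OF H] st'.horizontal_facts(1)[OF H] by (simp add: hom_nt_def)
  qed (auto simp: hom_nt_def)
qed

text \<open>The right-hand side at \<open>H\<close> is the vertical composite of \<open>t' * id * s'\<close>, at the functor \<open>G1 H F1\<close>, with
  the whiskering of \<open>t * id\<^sub>H * s\<close> by \<open>G'\<close> and \<open>F'\<close>. The interchange law contracts it to
  \<open>t' * (t * id\<^sub>H * s) * s'\<close>, which is the left-hand side by associativity.\<close>

lemma hom_nt_hcomp:
  assumes s: "mon_nat_trans s F F1 A' A" and s': "mon_nat_trans s' F' F1' A'' A'"
    and t: "mon_nat_trans t G G1 B B'" and t': "mon_nat_trans t' G' G1' B' B''"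
  shows "hom_nt (s *\<^sub>N s') (t' *\<^sub>N t) = hom_nt s' t' *\<^sub>N hom_nt s t"
proof -
  interpret B'': symm_mon_category B'' by (rule symm_mon_functor.smc_cod[OF mon_nat_trans.smf_src[OF t']])
  interpret s: mon_nat_trans s F F1 A' A by fact
  interpret s': mon_nat_trans s' F' F1' A'' A' by fact
  interpret t: mon_nat_trans t G G1 B B' by fact
  interpret t': mon_nat_trans t' G' G1' B' B'' by fact
  interpret st: trans_pair s F F1 A' A t G G1 B B' using assms by (intro trans_pair.intro)
  interpret st': trans_pair s' F' F1' A'' A' t' G' G1' B' B'' using assms by (intro trans_pair.intro)
  note src = hom_smf_comp[OF s.smf_src s'.smf_src t.smf_src t'.smf_src]
    and tgt = hom_smf_comp[OF s.smf_tgt s'.smf_tgt t.smf_tgt t'.smf_tgt]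
  show ?thesis
  proof (rule nt_eqI[of _ _ "obj (hom_smc A B)"])
    fix H assume "H \<in> obj (hom_smc A B)"
    then have H [simp]: "symm_mon_functor H A B" by simp
    let ?u = "t *\<^sub>N id_nt H *\<^sub>N s" and ?K = "G1 \<circ>\<^sub>F H \<circ>\<^sub>F F1"
    note iH = id_nt_trans[OF H]
    \<comment> \<open>\<open>?u\<close> is the component at \<open>H\<close> of the transformation that is applied first.\<close>
    have u: "mon_nat_trans ?u (G \<circ>\<^sub>F H \<circ>\<^sub>F F) ?K A' B'"
      by (rule hcomp_nt_trans[OF hcomp_nt_trans[OF s iH] t])
    note K = mon_nat_trans.smf_tgt[OF u]
    note iK = id_nt_trans[OF K] and iF' = id_nt_trans[OF s'.smf_src] and iG' = id_nt_trans[OF t'.smf_src]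
    have "vcomp_nt (t' *\<^sub>N id_nt ?K *\<^sub>N s') (id_nt G' *\<^sub>N ?u *\<^sub>N id_nt F') = t' *\<^sub>N ?u *\<^sub>N s'"
      using hcomp_vcomp_nt[OF hcomp_nt_trans[OF iF' u] hcomp_nt_trans[OF s' iK] iG' t']
        hcomp_vcomp_nt[OF iF' s' u iK] vcomp_nt_id[OF u] vcomp_nt_id[OF s'] vcomp_nt_id[OF t'] by simp
    also have "?u *\<^sub>N s' = t *\<^sub>N id_nt H *\<^sub>N s *\<^sub>N s'"
      by (simp only: hcomp_nt_assoc[OF s' hcomp_nt_trans[OF s iH] t] hcomp_nt_assoc[OF s' s iH])
    also have "t' *\<^sub>N \<dots> = (t' *\<^sub>N t) *\<^sub>N id_nt H *\<^sub>N s *\<^sub>N s'"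
      by (rule hcomp_nt_assoc[symmetric, OF hcomp_nt_trans[OF hcomp_nt_trans[OF s' s] iH] t t'])
    finally have "vcomp_nt (t' *\<^sub>N id_nt ?K *\<^sub>N s') (id_nt G' *\<^sub>N ?u *\<^sub>N id_nt F') = (t' *\<^sub>N t) *\<^sub>N id_nt H *\<^sub>N s *\<^sub>N s'" .
    then show "ncmp (hom_nt (s *\<^sub>N s') (t' *\<^sub>N t)) H = ncmp (hom_nt s' t' *\<^sub>N hom_nt s t) H"
      using K st.horizontal_facts(1)[OF H] st'.horizontal_facts(1)[OF K] by (simp add: hom_nt_def)
  qed (auto simp: hom_nt_def src tgt)
qed

theorem proposition9p7:
  "\<exists>Hom :: (('o, 'm) smcat \<times> ('p, 'n) smcat,
            ('o, 'm, 'o, 'm) smfun \<times> ('p, 'n, 'p, 'n) smfun,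
            ('o, 'm, 'o, 'm) nattr \<times> ('p, 'n, 'p, 'n) nattr,
            (('o, 'm, 'p, 'n) smfun, ('o, 'm, 'p, 'n) nattr) smcat,
            (('o, 'm, 'p, 'n) smfun, ('o, 'm, 'p, 'n) nattr,
             ('o, 'm, 'p, 'n) smfun, ('o, 'm, 'p, 'n) nattr) smfun,
            (('o, 'm, 'p, 'n) smfun, ('o, 'm, 'p, 'n) nattr,
             ('o, 'm, 'p, 'n) smfun, ('o, 'm, 'p, 'n) nattr) nattr) two_map.
     two_functor (op1 SMC \<times>\<^sub>2 SMC) SMC Hom \<and>
     (\<forall>A\<in>cell0 SMC. \<forall>B\<in>cell0 SMC. map0 Hom (A, B) = hom_smc A B) \<and>
     (\<forall>F\<in>cell1 SMC. \<forall>G\<in>cell1 SMC. map1 Hom (F, G) = hom_smf F G) \<and>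
     (\<forall>s\<in>cell2 SMC. \<forall>t\<in>cell2 SMC. map2 Hom (s, t) = hom_nt s t)"
proof (intro exI conjI ballI)
  let ?Hom = "\<lparr>map0 = \<lambda>(A :: ('o, 'm) smcat, B :: ('p, 'n) smcat). hom_smc A B,
    map1 = \<lambda>(F :: ('o, 'm, 'o, 'm) smfun, G :: ('p, 'n, 'p, 'n) smfun). hom_smf F G,
    map2 = \<lambda>(s :: ('o, 'm, 'o, 'm) nattr, t :: ('p, 'n, 'p, 'n) nattr). hom_nt s t\<rparr>"
  show "two_functor (op1 SMC \<times>\<^sub>2 SMC) SMC ?Hom"
  proof (intro two_functor.intro two_functor_axioms.intro two_category_prod2 two_category_op1 two_category_SMC)
    fix a :: "('o, 'm) smcat \<times> ('p, 'n) smcat"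
    assume "a \<in> cell0 (op1 SMC \<times>\<^sub>2 SMC)"
    then show "map0 ?Hom a \<in> cell0 SMC" "map1 ?Hom (id1 (op1 SMC \<times>\<^sub>2 SMC) a) = id1 SMC (map0 ?Hom a)"
      by (auto simp: hom_smc_smc hom_smf_id)
  next
    fix f :: "('o, 'm, 'o, 'm) smfun \<times> ('p, 'n, 'p, 'n) smfun"
    assume "f \<in> cell1 (op1 SMC \<times>\<^sub>2 SMC)"
    then show "map2 ?Hom (id2 (op1 SMC \<times>\<^sub>2 SMC) f) = id2 SMC (map1 ?Hom f)"
      by (auto simp: SMC_cell1 hom_nt_id)
  next
    fix f g :: "('o, 'm, 'o, 'm) smfun \<times> ('p, 'n, 'p, 'n) smfun" and a b c
    assume f: "f \<in> hom1 (op1 SMC \<times>\<^sub>2 SMC) a b"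
    then show "map1 ?Hom f \<in> hom1 SMC (map0 ?Hom a) (map0 ?Hom b)"
      by (cases f; cases a; cases b)
        (auto simp: SMC_hom1 intro!: functor_pair.hom_smf_functor functor_pair.intro)
    assume "g \<in> hom1 (op1 SMC \<times>\<^sub>2 SMC) b c"
    with f show "map1 ?Hom (comp1 (op1 SMC \<times>\<^sub>2 SMC) g f) = comp1 SMC (map1 ?Hom g) (map1 ?Hom f)"
      by (cases f; cases g; cases a; cases b; cases c) (auto simp: SMC_hom1 intro: hom_smf_comp)
  next
    fix f g h :: "('o, 'm, 'o, 'm) smfun \<times> ('p, 'n, 'p, 'n) smfun" and s t
    assume s: "s \<in> hom2 (op1 SMC \<times>\<^sub>2 SMC) f g"
    obtain F F' G G' s1 s2 where [simp]: "f = (F, F')" "g = (G, G')" "s = (s1, s2)" by (cases f; cases g; cases s)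
    obtain A B C D where F: "symm_mon_functor F A B" "symm_mon_functor F' C D"
      using s SMC_hom2_functor[of s1 F G] SMC_hom2_functor[of s2 F' G'] by auto
    then have s': "mon_nat_trans s1 F G A B" "mon_nat_trans s2 F' G' C D"
      using s by (auto intro: SMC_hom2D)
    show "map2 ?Hom s \<in> hom2 SMC (map1 ?Hom f) (map1 ?Hom g)"
      using SMC_hom2I[OF trans_pair.hom_nt_trans[OF trans_pair.intro[OF s']]] by simp
    assume t: "t \<in> hom2 (op1 SMC \<times>\<^sub>2 SMC) g h"
    obtain H H' t1 t2 where [simp]: "h = (H, H')" "t = (t1, t2)" by (cases h; cases t)
    have t': "mon_nat_trans t1 G H A B" "mon_nat_trans t2 G' H' C D"
      using t s'[THEN mon_nat_trans.smf_tgt] by (auto intro: SMC_hom2D)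
    show "map2 ?Hom (vcomp (op1 SMC \<times>\<^sub>2 SMC) t s) = vcomp SMC (map2 ?Hom t) (map2 ?Hom s)"
      using hom_nt_vcomp[OF s'(1) t'(1) s'(2) t'(2)] by simp
  next
    fix f f' g g' :: "('o, 'm, 'o, 'm) smfun \<times> ('p, 'n, 'p, 'n) smfun" and a b c s t
    assume "f \<in> hom1 (op1 SMC \<times>\<^sub>2 SMC) a b" "g \<in> hom1 (op1 SMC \<times>\<^sub>2 SMC) b c"
      "s \<in> hom2 (op1 SMC \<times>\<^sub>2 SMC) f f'" "t \<in> hom2 (op1 SMC \<times>\<^sub>2 SMC) g g'"
    then show "map2 ?Hom (hcomp (op1 SMC \<times>\<^sub>2 SMC) t s) = hcomp SMC (map2 ?Hom t) (map2 ?Hom s)"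
      by (cases f; cases g; cases f'; cases g'; cases a; cases b; cases c; cases s; cases t)
        (auto simp: SMC_hom1 intro!: hom_nt_hcomp dest: SMC_hom2D)
  qed
qed simp_all

end
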